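(* Let $\Omega\subset\mathbb{R}^p$ be a domain, let $f\in AP(T_\Omega)$, $f\not\equiv 0$, and let $D_0$ be a connected component of $\Omega\setminus A_f$. Then there is a vector $c(D_0)\in G(f)$ such that for every domain $D'\Subset D_0$ there is a function $g\in AP(T_{D'})$, bounded on $T_{D'}$, with $$f(z)=\exp\{g(z)+i\langle z,c(D_0)\rangle\},\qquad z\in T_{D'}.$$ In particular the mean motion $c(D_0)=-\operatorname{grad}J_f(y)$, $y\in D_0$, belongs to $G(f)$.
   Context: For a domain $\Omega\subset\mathbb{R}^p$, $T_\Omega=\{z=x+iy:\ x\in\mathbb{R}^p,\ y\in\Omega\}\subset\mathbb{C}^p$. The topology $\tau(T_\Omega)$ is that of uniform convergence on every $T_D$ with $D\Subset\Omega$ ($D$ relatively compact in $\Omega$). $AP(T_\Omega)$ is the class of holomorphic functions $f$ on $T_\Omega$ such that the family of translates $\{f(z+t)\}_{t\in\mathbb{R}^p}$ is relatively compact in $\tau(T_\Omega)$ (equivalently, $f$ is a $\tau(T_\Omega)$-limit of finite exponential sums $\sum c_\lambda e^{i\langle z,\lambda\rangle}$, $\lambda\in\mathbb{R}^p$, $c_\lambda\in\mathbb{C}$). The amoeba $A_f$ of $f$ is the closure in $\Omega$ of the set $\{y\in\Omega:\ \exists x\in\mathbb{R}^p,\ f(x+iy)=0\}$. The spectrum of $f$ is $\operatorname{sp} f=\{\lambda\in\mathbb{R}^p:\ \lim_{s\to\infty}(2s)^{-p}\int_{|x_j|<s,\,j=1,\dots,p}e^{-i\langle x+iy,\lambda\rangle}f(x+iy)\,dx\neq0\}$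 (for some, equivalently any, $y\in\Omega$); it is at most countable. $G(f)$ is the additive subgroup of $\mathbb{R}^p$ generated by $\operatorname{sp}f$ (all finite integer combinations of spectral elements). The Jessen function is $J_f(y)=\lim_{s\to\infty}(2s)^{-p}\int_{|x_j|<s,\,j=1,\dots,p}\log|f(x+iy)|\,dx$, $y\in\Omega$; the limit exists and is convex, and it is affine on any domain $D$ with $f\neq0$ on $T_D$. For such a domain $D$ (in particular a connected component of $\Omega\setminus A_f$ or of $D''\setminus A_f$ for $D''\subset\Omega$), the mean motion of $f$ in $D$ is $c(D)=-\operatorname{grad}J_f(y)$, $y\in D$; equivalently it is the unique vector $c\in\mathbb{R}^p$ such that on each $T_{D'}$, $D'\Subset D$, $f=\exp\{g+i\langle z,c\rangle\}$ with $g$ holomorphic and bounded. *)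

theory Defs
  imports "HOL-Analysis.Analysis"
begin

text \<open>Points of C^p are modelled as complex^'n, points of R^p as real^'n,
  with p = CARD('n).\<close>

definition cpt :: "real^'n \<Rightarrow> real^'n \<Rightarrow> complex^'n" where
  "cpt x y = (\<chi> j. Complex (x$j) (y$j))"

definition imv :: "complex^'n \<Rightarrow> real^'n" where
  "imv z = (\<chi> j. Im (z$j))"

definition cvec :: "real^'n \<Rightarrow> complex^'n" where
  "cvec t = (\<chi> j. complex_of_real (t$j))"

definition tube :: "(real^'n) set \<Rightarrow> (complex^'n) set" where
  "tube \<Omega> = {z. imv z \<in> \<Omega>}"

definition cinner :: "complex^'n \<Rightarrow> real^'n \<Rightarrow> complex" where
  "cinner z l = (\<Sum>j\<in>UNIV. z$j * complex_of_real (l$j))"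

definition domain :: "(real^'n) set \<Rightarrow> bool" where
  "domain D \<longleftrightarrow> open D \<and> connected D \<and> D \<noteq> {}"

definition rel_compact_in :: "(real^'n) set \<Rightarrow> (real^'n) set \<Rightarrow> bool" where
  "rel_compact_in D \<Omega> \<longleftrightarrow> compact (closure D) \<and> closure D \<subseteq> \<Omega>"

definition holo_on :: "(complex^'n \<Rightarrow> complex) \<Rightarrow> (complex^'n) set \<Rightarrow> bool" where
  "holo_on f U \<longleftrightarrow> (\<forall>z\<in>U. \<exists>L. (f has_derivative L) (at z) \<and>
        (\<forall>c v. L (c *s v) = c * L v))"

text \<open>AP(T_Omega): holomorphic, and the family of real translates is relatively
  compact in tau(T_Omega), the (metrizable) topology of uniform convergence on every
  T_D with D relatively compact in Omega; relative compactness is expressed sequentially.\<close>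
definition AP :: "(real^'n) set \<Rightarrow> (complex^'n \<Rightarrow> complex) \<Rightarrow> bool" where
  "AP \<Omega> f \<longleftrightarrow> holo_on f (tube \<Omega>) \<and>
     (\<forall>t :: nat \<Rightarrow> real^'n. \<exists>r h. strict_mono r \<and>
        (\<forall>D. rel_compact_in D \<Omega> \<longrightarrow>
           uniform_limit (tube D) (\<lambda>n z. f (z + cvec (t (r n)))) h sequentially))"

definition amoeba :: "(real^'n) set \<Rightarrow> (complex^'n \<Rightarrow> complex) \<Rightarrow> (real^'n) set" where
  "amoeba \<Omega> f = \<Omega> \<inter> closure {y\<in>\<Omega>. \<exists>x. f (cpt x y) = 0}"

definition cube :: "real \<Rightarrow> (real^'n) set" where
  "cube s = {x. \<forall>j. \<bar>x$j\<bar> < s}"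

definition spec :: "(real^'n) set \<Rightarrow> (complex^'n \<Rightarrow> complex) \<Rightarrow> (real^'n) set" where
  "spec \<Omega> f = {l. \<exists>y\<in>\<Omega>. \<exists>L. L \<noteq> 0 \<and>
      ((\<lambda>s. integral (cube s) (\<lambda>x. exp (- \<i> * cinner (cpt x y) l) * f (cpt x y))
              / complex_of_real ((2 * s) ^ card (UNIV::'n set))) \<longlongrightarrow> L) at_top}"

definition Gf :: "(real^'n) set \<Rightarrow> (complex^'n \<Rightarrow> complex) \<Rightarrow> (real^'n) set" where
  "Gf \<Omega> f = {v. \<exists>S k. finite S \<and> S \<subseteq> spec \<Omega> f \<and>
                    v = (\<Sum>l\<in>S. of_int (k l) *\<^sub>R l)}"

definition jessen :: "(complex^'n \<Rightarrow> complex) \<Rightarrow> real^'n \<Rightarrow> real" where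
  "jessen f y = Lim at_top (\<lambda>s. integral (cube s) (\<lambda>x. ln (norm (f (cpt x y))))
                                  / (2 * s) ^ card (UNIV::'n set))"

end

theory Submission
  imports Defs "HOL-Complex_Analysis.Complex_Analysis" "HOL-Library.Diagonal_Subsequence"
begin

text \<open>
  By Hurwitz's theorem and compactness of the translates, \<open>f\<close> is bounded away from zero on
  the tube over a compact subset of \<open>D0\<close>. Over a ball it has a continuous logarithm \<open>G\<close>.
  Two translates of \<open>f\<close> that are uniformly close have logarithms whose difference oscillates
  little, so \<open>G (z + t) - G z\<close> is, up to a bounded error, independent of \<open>z\<close> and
  additive in \<open>t\<close>; Hyers' theorem then makes \<open>G\<close> a linear function plus a bounded
  almost periodic \<open>g\<close>. The mean of \<open>g\<close> over a horizontal slice is a uniform limit of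
  holomorphic functions and does not depend on the real part, hence not on the height. Fixing this
  mean removes the ambiguity in the choice of the local logarithms, which therefore glue even when
  \<open>D0\<close> is not simply connected; it also evaluates the Jessen function.

  For the frequency: if \<open>f\<close> is nearly invariant under \<open>t\<close>, comparing the mean of
  \<open>g\<close> before and after the translation shows that \<open>exp (\<i> * (c \<bullet> t))\<close> is near 1. If
  \<open>c\<close> were not an integer combination of spectral elements, powers of a trigonometric
  polynomial concentrated where all characters of a finite set of large Fourier coefficients are
  near 1 would yield a sequence of translations \<open>t\<close> along which these characters tend to 1 but
  \<open>exp (\<i> * (c \<bullet> t))\<close> does not. A limit of the translates of \<open>f\<close> along it has the same
  Fourier coefficients as \<open>f\<close>, so equals \<open>f\<close> by uniqueness, a contradiction.
\<close>

section \<open>Almost periodic families and their means\<close>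

text \<open>The frequency argument rests on a uniqueness theorem, \<open>ap_eq_0\<close>: an almost
  periodic function whose Fourier coefficients all vanish is zero. On R^p it is reduced to
  sequences. For a vector a, a suitable twisted mean of the values along the progression x + n a,
  taken for every x at once, is an eigenfunction of translation by a; doing this for all basis
  vectors leads to a lattice-periodic function, which the same concentration argument that later
  finds the translations can handle. Only Z needs a direct proof, and there finite Fourier analysis
  is available.

  Because Z and R^p occur side by side, almost periodicity and means are set up on an arbitrary
  abelian group, with averages over finite lists of translations instead of integrals; cube
  integrals enter only to match \<open>spec\<close> and \<open>jessen\<close>. The parameter set
  \<open>K\<close> is present because a mean taken at every height, or at every point of R^p, has to
  be a uniform limit of finite averages in order to inherit holomorphy, continuity or almost
  periodicity.\<close>

text \<open>
  Relative compactness of the translates, uniformly over the parameter set \<open>K\<close>, is expressed by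
  finite colourings of the group; two families are then treated simultaneously by pairing colours.
\<close>

definition uap :: "'k set \<Rightarrow> ('k \<Rightarrow> 'a::ab_group_add \<Rightarrow> complex) \<Rightarrow> bool" where
  "uap K F \<longleftrightarrow> (\<forall>e>0. \<exists>c::'a \<Rightarrow> nat. finite (range c) \<and>
     (\<forall>t t'. c t = c t' \<longrightarrow> (\<forall>k\<in>K. \<forall>x. norm (F k (x + t) - F k (x + t')) < e)))"

abbreviation ap :: "('a::ab_group_add \<Rightarrow> complex) \<Rightarrow> bool" where
  "ap u \<equiv> uap (UNIV :: unit set) (\<lambda>_. u)"

lemma finite_range_colour:
  fixes c :: "'a \<Rightarrow> 'b"
  assumes "finite (range c)"
  obtains d :: "'a \<Rightarrow> nat" where "finite (range d)" "\<And>t t'. d t = d t' \<longleftrightarrow> c t = c t'"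
proof -
  obtain f :: "'b \<Rightarrow> nat" where f: "inj_on f (range c)"
    using finite_imp_inj_to_nat_seg[OF assms] by blast
  have "range (f \<circ> c) = f ` range c" by auto
  with assms have "finite (range (f \<circ> c))" by simp
  moreover have "(f \<circ> c) t = (f \<circ> c) t' \<longleftrightarrow> c t = c t'" for t t'
    using f by (auto simp: inj_on_def)
  ultimately show ?thesis using that by blast
qed

text \<open>Proofs may colour by pairs, grid cells or net points, whereas \<open>uap\<close> fixes
  the colour type \<open>nat\<close>; finitely many colours can always be renumbered.\<close>

lemma uapI:
  fixes F :: "'k \<Rightarrow> 'a::ab_group_add \<Rightarrow> complex"
  assumes "\<And>e. e > 0 \<Longrightarrow> \<exists>c::'a \<Rightarrow> 'b. finite (range c) \<and>
     (\<forall>t t'. c t = c t' \<longrightarrow> (\<forall>k\<in>K. \<forall>x. norm (F k (x + t) - F k (x + t')) < e))"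
  shows "uap K F"
  unfolding uap_def
proof (intro allI impI)
  fix e :: real assume "e > 0"
  then obtain c :: "'a \<Rightarrow> 'b" where c: "finite (range c)"
    "\<And>t t' k x. c t = c t' \<Longrightarrow> k \<in> K \<Longrightarrow> norm (F k (x + t) - F k (x + t')) < e"
    using assms by meson
  obtain d :: "'a \<Rightarrow> nat" where "finite (range d)" "\<And>t t'. d t = d t' \<longleftrightarrow> c t = c t'"
    using finite_range_colour[OF c(1)] by blast
  with c(2) show "\<exists>c::'a \<Rightarrow> nat. finite (range c) \<and>
     (\<forall>t t'. c t = c t' \<longrightarrow> (\<forall>k\<in>K. \<forall>x. norm (F k (x + t) - F k (x + t')) < e))" by blast
qed

lemma uapE:
  assumes "uap K F" "e > 0"
  obtains c :: "'a::ab_group_add \<Rightarrow> nat" where "finite (range c)"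
    "\<And>t t' k x. c t = c t' \<Longrightarrow> k \<in> K \<Longrightarrow> norm (F k (x + t) - F k (x + t')) < e"
  using assms unfolding uap_def by meson

lemma finite_colour_reps:
  fixes c :: "'a \<Rightarrow> nat"
  assumes "finite (range c)"
  obtains T \<rho> where "finite T" "\<And>t. \<rho> t \<in> T" "\<And>t. c (\<rho> t) = c t"
proof
  show "finite ((inv c) ` range c)" using assms by simp
  show "(inv c) (c t) \<in> (inv c) ` range c" for t by simp
  show "c (inv c (c t)) = c t" for t by (simp add: f_inv_into_f)
qed

text \<open>The classical finite net of translations: \<open>\<rho> t\<close> is a representative of
  the colour class of \<open>t\<close>, chosen independently of \<open>k\<close> and
  \<open>x\<close>.\<close>

lemma uap_net:
  fixes F :: "'k \<Rightarrow> 'a::ab_group_add \<Rightarrow> complex"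
  assumes "uap K F" "e > 0"
  obtains T \<rho> where "finite T" "\<And>t. \<rho> t \<in> T"
    "\<And>t k x. k \<in> K \<Longrightarrow> norm (F k (x + t) - F k (x + \<rho> t)) < e"
proof -
  obtain c :: "'a \<Rightarrow> nat" where c: "finite (range c)"
    "\<And>t t' k x. c t = c t' \<Longrightarrow> k \<in> K \<Longrightarrow> norm (F k (x + t) - F k (x + t')) < e"
    using uapE[OF assms] by blast
  obtain T \<rho> where "finite T" "\<And>t. \<rho> t \<in> T" "\<And>t. c (\<rho> t) = c t"
    using finite_colour_reps[OF c(1)] by blast
  with c(2) that show ?thesis by metis
qed

lemma uap_combine:
  fixes F :: "'k \<Rightarrow> 'a::ab_group_add \<Rightarrow> complex" and G :: "'l \<Rightarrow> 'a \<Rightarrow> complex"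
    and H :: "'m \<Rightarrow> 'a \<Rightarrow> complex"
  assumes "uap K F" "uap L G"
    and H: "\<And>e. e > 0 \<Longrightarrow> \<exists>d>0. \<forall>t t'.
      (\<forall>k\<in>K. \<forall>x. norm (F k (x + t) - F k (x + t')) < d) \<longrightarrow>
      (\<forall>l\<in>L. \<forall>x. norm (G l (x + t) - G l (x + t')) < d) \<longrightarrow>
      (\<forall>m\<in>M. \<forall>x. norm (H m (x + t) - H m (x + t')) < e)"
  shows "uap M H"
proof (rule uapI)
  fix e :: real assume "e > 0"
  then obtain d where d: "d > 0" "\<And>t t'. (\<forall>k\<in>K. \<forall>x. norm (F k (x + t) - F k (x + t')) < d) \<Longrightarrow>
      (\<forall>l\<in>L. \<forall>x. norm (G l (x + t) - G l (x + t')) < d) \<Longrightarrow>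
      (\<forall>m\<in>M. \<forall>x. norm (H m (x + t) - H m (x + t')) < e)"
    using H by meson
  obtain c :: "'a \<Rightarrow> nat" where c: "finite (range c)"
    "\<And>t t' k x. c t = c t' \<Longrightarrow> k \<in> K \<Longrightarrow> norm (F k (x + t) - F k (x + t')) < d"
    using uapE[OF assms(1) d(1)] by blast
  obtain c' :: "'a \<Rightarrow> nat" where c': "finite (range c')"
    "\<And>t t' k x. c' t = c' t' \<Longrightarrow> k \<in> L \<Longrightarrow> norm (G k (x + t) - G k (x + t')) < d"
    using uapE[OF assms(2) d(1)] by blast
  have "finite (range (\<lambda>t. (c t, c' t)))"
    by (rule finite_subset[of _ "range c \<times> range c'"]) (use c(1) c'(1) in auto)
  then show "\<exists>c::'a \<Rightarrow> nat \<times> nat. finite (range c) \<and>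
     (\<forall>t t'. c t = c t' \<longrightarrow> (\<forall>k\<in>M. \<forall>x. norm (H k (x + t) - H k (x + t')) < e))"
    using d(2) c(2) c'(2) by (intro exI[of _ "\<lambda>t. (c t, c' t)"]) auto
qed

lemma uap_map:
  fixes F :: "'k \<Rightarrow> 'a::ab_group_add \<Rightarrow> complex" and H :: "'m \<Rightarrow> 'a \<Rightarrow> complex"
  assumes "uap K F"
    and H: "\<And>e. e > 0 \<Longrightarrow> \<exists>d>0. \<forall>t t'.
      (\<forall>k\<in>K. \<forall>x. norm (F k (x + t) - F k (x + t')) < d) \<longrightarrow>
      (\<forall>m\<in>M. \<forall>x. norm (H m (x + t) - H m (x + t')) < e)"
  shows "uap M H"
  by (rule uap_combine[OF assms(1) assms(1)]) (use H in meson)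

text \<open>Evaluated at the point 0, the net puts \<open>u x\<close> within 1 of one of finitely
  many values.\<close>

lemma ap_bounded:
  assumes "ap u"
  obtains B where "B > 0" "\<And>x. norm (u x) \<le> B"
proof -
  obtain T \<rho> where T: "finite T" "\<And>t. \<rho> t \<in> T" "\<And>t x. norm (u (x + t) - u (x + \<rho> t)) < 1"
    using uap_net[OF assms zero_less_one] by (metis UNIV_I)
  define B where "B = 1 + (\<Sum>t\<in>T. norm (u t))"
  have "norm (u x) \<le> B" for x
  proof -
    have "norm (u x) \<le> norm (u (\<rho> x)) + 1"
      using T(3)[of 0 x] norm_triangle_sub[of "u x" "u (\<rho> x)"] by simp
    also have "norm (u (\<rho> x)) \<le> (\<Sum>t\<in>T. norm (u t))"
      using T by (intro member_le_sum) auto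
    finally show ?thesis by (simp add: B_def)
  qed
  moreover have "B > 0" by (simp add: B_def add_pos_nonneg sum_nonneg)
  ultimately show ?thesis using that by blast
qed

lemma uap_const: "uap K (\<lambda>k _. a k)"
  by (rule uapI[where ?'b = unit]) auto

lemma uap_mono: "uap K F \<Longrightarrow> L \<subseteq> K \<Longrightarrow> uap L F"
  by (erule uap_map) auto

lemma uap_slice: "uap K F \<Longrightarrow> k \<in> K \<Longrightarrow> ap (F k)"
  by (erule uap_map) auto

lemma uap_add:
  assumes "uap K F" "uap K G"
  shows "uap K (\<lambda>k x. F k x + G k x)"
proof (rule uap_combine[OF assms])
  fix e :: real assume e: "e > 0"
  have *: "norm ((a + b) - (c + d)) < e" if "norm (a - c) < e/2" "norm (b - d) < e/2"
    for a b c d :: complex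
    using norm_triangle_ineq[of "a - c" "b - d"] that by (simp add: algebra_simps)
  show "\<exists>d>0. \<forall>t t'. (\<forall>k\<in>K. \<forall>x. norm (F k (x + t) - F k (x + t')) < d) \<longrightarrow>
      (\<forall>l\<in>K. \<forall>x. norm (G l (x + t) - G l (x + t')) < d) \<longrightarrow>
      (\<forall>m\<in>K. \<forall>x. norm ((F m (x + t) + G m (x + t)) - (F m (x + t') + G m (x + t'))) < e)"
    by (intro exI[of _ "e/2"] conjI allI impI ballI *) (use e in auto)
qed

lemma uap_mult:
  assumes "uap K F" "uap K G" and F: "\<And>k x. k \<in> K \<Longrightarrow> norm (F k x) \<le> B"
    and G: "\<And>k x. k \<in> K \<Longrightarrow> norm (G k x) \<le> B"
  shows "uap K (\<lambda>k x. F k x * G k x)"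
proof (rule uap_combine[OF assms(1,2)])
  fix e :: real assume e: "e > 0"
  define C where "C = \<bar>B\<bar> + 1"
  have C: "C > 0" by (simp add: C_def)
  have *: "norm (a * b - c * d) < e" if "norm (a - c) < e/(2*C)" "norm (b - d) < e/(2*C)" 
    "norm a \<le> B" "norm d \<le> B" for a b c d :: complex
  proof -
    have "norm (a * b - c * d) = norm (a * (b - d) + (a - c) * d)" by (simp add: algebra_simps)
    also have "\<dots> \<le> norm a * norm (b - d) + norm (a - c) * norm d"
      by (metis norm_mult norm_triangle_ineq)
    also have "\<dots> \<le> C * norm (b - d) + norm (a - c) * C"
      using that C_def by (intro add_mono mult_right_mono mult_left_mono) auto
    also have "\<dots> < C * (e/(2*C)) + (e/(2*C)) * C"
      using that C by (intro add_strict_mono mult_strict_right_mono mult_strict_left_mono) auto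
    also have "\<dots> = e" using C by (simp add: field_simps)
    finally show ?thesis .
  qed
  show "\<exists>d>0. \<forall>t t'. (\<forall>k\<in>K. \<forall>x. norm (F k (x + t) - F k (x + t')) < d) \<longrightarrow>
      (\<forall>l\<in>K. \<forall>x. norm (G l (x + t) - G l (x + t')) < d) \<longrightarrow>
      (\<forall>m\<in>K. \<forall>x. norm (F m (x + t) * G m (x + t) - F m (x + t') * G m (x + t')) < e)"
    by (intro exI[of _ "e/(2*C)"] conjI allI impI ballI *) (use e C F G in auto)
qed

lemma ap_mult:
  assumes "ap u" "ap v" shows "ap (\<lambda>x. u x * v x)"
proof -
  obtain B B' where "\<And>x. norm (u x) \<le> B" "\<And>x. norm (v x) \<le> B'"
    using ap_bounded assms by metis
  then have "\<And>x. norm (u x) \<le> max B B'" "\<And>x. norm (v x) \<le> max B B'"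
    by (simp_all add: le_max_iff_disj)
  then show ?thesis using uap_mult[OF assms] by blast
qed

lemma uap_cnj: "uap K F \<Longrightarrow> uap K (\<lambda>k x. cnj (F k x))"
  by (erule uap_map) (metis complex_cnj_diff complex_mod_cnj)

lemma uap_shift: 
  assumes "uap K F" shows "uap K (\<lambda>k x. F k (x + a))"
proof (rule uap_map[OF assms])
  fix e :: real assume "e > 0"
  show "\<exists>d>0. \<forall>t t'. (\<forall>k\<in>K. \<forall>x. cmod (F k (x + t) - F k (x + t')) < d) \<longrightarrow>
                  (\<forall>m\<in>K. \<forall>x. cmod (F m (x + t + a) - F m (x + t' + a)) < e)"
  proof (intro exI[of _ e] conjI allI impI ballI)
    fix t t' m x
    assume "\<forall>k\<in>K. \<forall>x. cmod (F k (x + t) - F k (x + t')) < e" "m \<in> K"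
    then have "cmod (F m (x + a + t) - F m (x + a + t')) < e" by blast
    then show "cmod (F m (x + t + a) - F m (x + t' + a)) < e" by (simp add: ac_simps)
  qed fact
qed

lemma ap_cmult: "ap u \<Longrightarrow> ap (\<lambda>x. a * u x)"
  by (rule ap_mult[OF uap_const])

lemma ap_diff: "ap u \<Longrightarrow> ap v \<Longrightarrow> ap (\<lambda>x. u x - v x)"
  using uap_add[of UNIV "\<lambda>_. u" "\<lambda>_ x. (-1) * v x"] ap_cmult[of v "-1"] by simp

lemma ap_sum:
  assumes "\<And>i. i \<in> I \<Longrightarrow> ap (u i)" shows "ap (\<lambda>x. \<Sum>i\<in>I. u i x)"
  using assms
proof (induction I rule: infinite_finite_induct)
  case (insert i I)
  then have "ap (\<lambda>x. u i x + (\<Sum>i\<in>I. u i x))"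
    by (intro uap_add[where K = "UNIV::unit set"]) auto
  then show ?case using insert by simp
qed (simp_all add: uap_const)

lemma ap_power: "ap u \<Longrightarrow> ap (\<lambda>x. u x ^ n)"
  by (induction n) (auto intro: ap_mult uap_const)

lemma uap_uniform_limit:
  assumes "\<And>n::nat. uap K (F n)"
    and "\<And>e. e > 0 \<Longrightarrow> \<exists>n. \<forall>k\<in>K. \<forall>x. norm (F n k x - G k x) \<le> e"
  shows "uap K G"
  unfolding uap_def
proof (intro allI impI)
  fix e :: real assume "e > 0"
  then have e: "e/4 > 0" by simp
  then obtain n where n: "\<And>k x. k \<in> K \<Longrightarrow> norm (F n k x - G k x) \<le> e/4"
    using assms(2) by blast
  obtain c :: "'b \<Rightarrow> nat" where c: "finite (range c)"
    "\<And>t t' k x. c t = c t' \<Longrightarrow> k \<in> K \<Longrightarrow> norm (F n k (x + t) - F n k (x + t')) < e/4"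
    using uapE[OF assms(1) e] by blast
  have "norm (G k (x + t) - G k (x + t')) < e" if "c t = c t'" "k \<in> K" for t t' k x
    using c(2)[OF that, of x] n[OF that(2), of "x + t"] n[OF that(2), of "x + t'"] \<open>e > 0\<close>
    by norm
  with c(1) show "\<exists>c::'b \<Rightarrow> nat. finite (range c) \<and>
     (\<forall>t t'. c t = c t' \<longrightarrow> (\<forall>k\<in>K. \<forall>x. norm (G k (x + t) - G k (x + t')) < e))" by blast
qed

section \<open>Finite averages of translates and the mean\<close>

definition avg :: "'a::ab_group_add list \<Rightarrow> ('a \<Rightarrow> complex) \<Rightarrow> 'a \<Rightarrow> complex" where
  "avg ts u x = (\<Sum>t\<leftarrow>ts. u (x + t)) / of_nat (length ts)"

text \<open>Composition is why \<open>avg\<close> takes a list: sums of translations from the two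
  lists may coincide, and multiplicities must be counted.\<close>

lemma avg_avg:
  "avg ss (avg ts u) = avg (concat (map (\<lambda>s. map ((+) s) ts) ss)) u"
proof
  fix x
  have "(\<Sum>t\<leftarrow>concat (map (\<lambda>s. map ((+) s) ts) ss). u (x + t))
      = (\<Sum>s\<leftarrow>ss. \<Sum>t\<leftarrow>ts. u (x + s + t))"
    by (induction ss) (simp_all add: o_def add.assoc)
  moreover have "length (concat (map (\<lambda>s. map ((+) s) ts) ss)) = length ss * length ts"
    by (induction ss) simp_all
  moreover have "(\<Sum>s\<leftarrow>ss. g s / c) = (\<Sum>s\<leftarrow>ss. g s) / c" for g :: "'a \<Rightarrow> complex" and c
    by (induction ss) (simp_all add: add_divide_distrib)
  ultimately show "avg ss (avg ts u) x = avg (concat (map (\<lambda>s. map ((+) s) ts) ss)) u x"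
    by (simp add: avg_def)
qed

lemma avg_add: "avg ts (\<lambda>x. u x + v x) x = avg ts u x + avg ts v x"
  by (simp add: avg_def sum_list_addf add_divide_distrib)

lemma avg_cmult: "avg ts (\<lambda>x. a * u x) x = a * avg ts u x"
  by (simp add: avg_def sum_list_const_mult)

lemma avg_const: "ts \<noteq> [] \<Longrightarrow> avg ts (\<lambda>x. a) x = a"
  by (simp add: avg_def sum_list_triv)

lemma avg_shift: "avg ts (\<lambda>x. u (x + a)) x = avg ts u (x + a)"
  by (simp add: avg_def ac_simps)

lemma avg_commute: "avg ss (avg ts u) = avg ts (avg ss u)"
proof
  fix x
  have "(\<Sum>s\<leftarrow>ss. \<Sum>t\<leftarrow>ts. u (x + s + t)) = (\<Sum>t\<leftarrow>ts. \<Sum>s\<leftarrow>ss. u (x + t + s))"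
    by (induction ss) (simp_all add: sum_list_addf ac_simps)
  moreover have "(\<Sum>s\<leftarrow>ss. g s / c) = (\<Sum>s\<leftarrow>ss. g s) / c" for g :: "'a \<Rightarrow> complex" and c ss
    by (induction ss) (simp_all add: add_divide_distrib)
  ultimately show "avg ss (avg ts u) x = avg ts (avg ss u) x"
    by (simp add: avg_def mult.commute)
qed

lemma avg_diff_le:
  assumes "ts \<noteq> []" "\<And>t. t \<in> set ts \<Longrightarrow> norm (u (x + t) - v (y + t)) \<le> e"
  shows "norm (avg ts u x - avg ts v y) \<le> e"
proof -
  have "norm ((\<Sum>t\<leftarrow>ts. u (x + t)) - (\<Sum>t\<leftarrow>ts. v (y + t))) \<le> length ts * e"
    using assms(2)
  proof (induction ts)
    case (Cons t ts)
    have "norm (u (x + t) - v (y + t)) \<le> e" using Cons.prems by simp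
    moreover have "norm ((\<Sum>t\<leftarrow>ts. u (x + t)) - (\<Sum>t\<leftarrow>ts. v (y + t))) \<le> length ts * e"
      using Cons by simp
    ultimately show ?case
      using norm_triangle_ineq[of "u (x + t) - v (y + t)" "(\<Sum>t\<leftarrow>ts. u (x + t)) - (\<Sum>t\<leftarrow>ts. v (y + t))"]
      by (simp add: algebra_simps)
  qed simp
  moreover have "avg ts u x - avg ts v y
      = ((\<Sum>t\<leftarrow>ts. u (x + t)) - (\<Sum>t\<leftarrow>ts. v (y + t))) / of_nat (length ts)"
    by (simp add: avg_def diff_divide_distrib)
  ultimately show ?thesis using assms(1)
    by (simp add: norm_divide divide_le_eq mult.commute)
qed

lemma avg_dist_le:
  assumes "ts \<noteq> []" "\<And>x. norm (u x - m) \<le> e"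
  shows "norm (avg ts u x - m) \<le> e"
  using avg_diff_le[of ts u x "\<lambda>_. m" x e] assms by (simp add: avg_const)

text \<open>A Folner sequence by hand. Averaging over 0, a, ..., (N - 1) a makes a bounded function
  nearly invariant under \<open>a\<close>, as the difference telescopes to two terms. Composing with
  the average for the earlier translations keeps their near-invariance, because averaging commutes
  with translation and does not increase the sup norm. The list depends only on \<open>T\<close> and
  \<open>\<eta>\<close>, so it serves all members of a family.\<close>

lemma folner_list:
  fixes T :: "'a::ab_group_add set"
  assumes "finite T" "\<eta> > 0"
  shows "\<exists>ts. ts \<noteq> [] \<and> (\<forall>u B t x. t \<in> T \<longrightarrow> (\<forall>x. norm (u x) \<le> B) \<longrightarrow>
           norm (avg ts u (x + t) - avg ts u x) \<le> \<eta> * B)"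
  using assms(1)
proof induction
  case empty
  show ?case by (rule exI[of _ "[0]"]) simp
next
  case (insert a T)
  then obtain ts where ts: "ts \<noteq> []" "\<And>u B t x. t \<in> T \<Longrightarrow> (\<And>x. norm (u x) \<le> B) \<Longrightarrow>
           norm (avg ts u (x + t) - avg ts u x) \<le> \<eta> * B" by blast
  obtain N :: nat where N: "2 / \<eta> < N" using reals_Archimedean2 by blast
  have N0: "N > 0" using N \<open>\<eta> > 0\<close> by (metis divide_pos_pos of_nat_0_less_iff less_trans zero_less_numeral)
  \<comment> \<open>The n-fold multiple of \<open>a\<close>, written as an iterate because an
    abstract group has no scalars.\<close>
  define m :: "nat \<Rightarrow> 'a" where "m n = ((+) a ^^ n) 0" for n
  have m: "m 0 = 0" "m (Suc n) = m n + a" for n by (simp_all add: m_def add.commute)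
  define ss where "ss = map m [0..<N]"
  have ss: "ss \<noteq> []" using N0 by (simp add: ss_def)
  have near: "norm (avg ss u (x + a) - avg ss u x) \<le> \<eta> * B" if B: "\<And>x. norm (u x) \<le> B" for u B x
  proof -
    have B0: "B \<ge> 0" using B[of 0] norm_ge_zero order_trans by blast
    have s: "(\<Sum>t\<leftarrow>ss. u (y + t)) = (\<Sum>n<N. u (y + m n))" for y
      by (simp add: ss_def interv_sum_list_conv_sum_set_nat o_def atLeast0LessThan)
    have "(\<Sum>n<N. u (x + a + m n)) - (\<Sum>n<N. u (x + m n)) = (\<Sum>n<N. u (x + m (Suc n)) - u (x + m n))"
      by (simp add: sum_subtractf m ac_simps)
    also have "\<dots> = u (x + m N) - u (x + m 0)" by (rule sum_lessThan_telescope)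
    finally have "norm ((\<Sum>n<N. u (x + a + m n)) - (\<Sum>n<N. u (x + m n))) \<le> 2 * B"
      using B[of "x + m N"] B[of "x + m 0"] norm_triangle_ineq4[of "u (x + m N)" "u (x + m 0)"] by simp
    then have "norm (avg ss u (x + a) - avg ss u x) \<le> 2 * B / N"
      unfolding avg_def s by (simp add: ss_def norm_divide divide_right_mono flip: diff_divide_distrib)
    also have "\<dots> \<le> \<eta> * B"
    proof -
      have "2 / N \<le> \<eta>" using N N0 \<open>\<eta> > 0\<close> by (simp add: field_simps)
      then show ?thesis using mult_right_mono[of "2/N" \<eta> B] B0 by simp
    qed
    finally show ?thesis .
  qed
  have "norm (avg ss (avg ts u) (x + t) - avg ss (avg ts u) x) \<le> \<eta> * B" 
    if t: "t \<in> insert a T" and B: "\<And>x. norm (u x) \<le> B" for u B t x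
  proof (cases "t = a")
    case True
    have "norm (avg ts u x) \<le> B" for x using avg_dist_le[OF ts(1), of u 0 B] B by simp
    with True near show ?thesis by blast
  next
    case False
    then have "norm (avg ts u (x + t) - avg ts u x) \<le> \<eta> * B" for x using t B ts(2) by blast
    then have "norm (avg ss (avg ts u) (x + t) - avg ss (avg ts u) x) \<le> \<eta> * B"
      by (intro avg_diff_le[OF ss]) (metis add.commute add.left_commute)
    then show ?thesis .
  qed
  then show ?case
    using ss ts(1) unfolding avg_avg
    by (intro exI[of _ "concat (map (\<lambda>s. map ((+) s) ts) ss)"]) (auto simp: neq_Nil_conv)
qed

text \<open>
  Von Neumann's mean: the constant that is a uniform limit of finite averages of translates.
\<close>

definition is_mean :: "('a::ab_group_add \<Rightarrow> complex) \<Rightarrow> complex \<Rightarrow> bool" where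
  "is_mean u m \<longleftrightarrow> (\<forall>e>0. \<exists>ts. ts \<noteq> [] \<and> (\<forall>x. norm (avg ts u x - m) \<le> e))"

text \<open>Averages over a Folner list for a net \<open>T\<close> oscillate little:
  \<open>x\<close> may be replaced by \<open>\<rho> x\<close>, and translation by
  \<open>\<rho> x\<close> hardly changes the average. One list works for all \<open>k\<close>
  simultaneously, which is what makes the means of a whole family uniform limits.\<close>

lemma uap_mean:
  fixes F :: "'k \<Rightarrow> 'a::ab_group_add \<Rightarrow> complex"
  assumes "uap K F" and B: "\<And>k x. k \<in> K \<Longrightarrow> norm (F k x) \<le> B"
  shows "\<exists>m. (\<forall>e>0. \<exists>ts. ts \<noteq> [] \<and> (\<forall>k\<in>K. \<forall>x. norm (avg ts (F k) x - m k) \<le> e)) \<and>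
    (\<forall>k\<in>K. is_mean (F k) (m k))"
proof -
  have osc: "\<exists>ts. ts \<noteq> [] \<and> (\<forall>k\<in>K. \<forall>x. norm (avg ts (F k) x - avg ts (F k) 0) \<le> e)"
    if e: "e > 0" for e
  proof -
    have "e/2 > 0" using e by simp
    then obtain T \<rho> where T: "finite T" "\<And>t. \<rho> t \<in> T"
      "\<And>t k x. k \<in> K \<Longrightarrow> norm (F k (x + t) - F k (x + \<rho> t)) < e/2"
      using uap_net[OF assms(1)] by metis
    define \<eta> where "\<eta> = e / (2 * (\<bar>B\<bar> + 1))"
    have "\<eta> > 0" using e by (simp add: \<eta>_def)
    obtain ts where ts: "ts \<noteq> []" "\<And>u B t x. t \<in> T \<Longrightarrow> (\<And>x. norm (u x) \<le> B) \<Longrightarrow>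
           norm (avg ts u (x + t) - avg ts u x) \<le> \<eta> * B"
      using folner_list[OF T(1) \<open>\<eta> > 0\<close>] by meson
    have "\<bar>B\<bar> + 1 \<noteq> 0" by linarith
    then have \<eta>B: "\<eta> * (\<bar>B\<bar> + 1) = e/2" unfolding \<eta>_def by (simp add: divide_simps)
    have "norm (avg ts (F k) x - avg ts (F k) 0) \<le> e" if k: "k \<in> K" for k x
    proof -
      have "norm (F k (x + t) - F k (\<rho> x + t)) \<le> e/2" for t
        using T(3)[OF k, of t x] by (simp add: add.commute)
      then have 1: "norm (avg ts (F k) x - avg ts (F k) (\<rho> x)) \<le> e/2"
        by (intro avg_diff_le[OF ts(1)])
      have "norm (F k y) \<le> \<bar>B\<bar> + 1" for y using B[OF k, of y] by linarith
      then have 2: "norm (avg ts (F k) (0 + \<rho> x) - avg ts (F k) 0) \<le> e/2"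
        using ts(2)[OF T(2)] \<eta>B by metis
      show ?thesis using 1 2 norm_triangle_ineq[of "avg ts (F k) x - avg ts (F k) (\<rho> x)"
          "avg ts (F k) (\<rho> x) - avg ts (F k) 0"] by simp
    qed
    with ts(1) show ?thesis by blast
  qed
  have "\<forall>n. \<exists>ts. ts \<noteq> [] \<and> (\<forall>k\<in>K. \<forall>x. norm (avg ts (F k) x - avg ts (F k) 0) \<le> 1/Suc n)"
    by (intro allI osc) simp
  then obtain ts where ts: "\<And>n. ts n \<noteq> []"
    "\<And>n k x. k \<in> K \<Longrightarrow> norm (avg (ts n) (F k) x - avg (ts n) (F k) 0) \<le> 1/Suc n"
    by metis
  define a where "a k n = avg (ts n) (F k) 0" for k n
  \<comment> \<open>Averaging over both lists gives the same number in either order, and it is close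
    to both constants.\<close>
  have dist: "norm (a k n - a k l) \<le> 1/Suc n + 1/Suc l" if k: "k \<in> K" for k n l
  proof -
    have 1: "norm (avg (ts n) (avg (ts l) (F k)) 0 - a k l) \<le> 1/Suc l"
      unfolding a_def by (rule avg_dist_le[OF ts(1) ts(2)[OF k]])
    have 2: "norm (avg (ts l) (avg (ts n) (F k)) 0 - a k n) \<le> 1/Suc n"
      unfolding a_def by (rule avg_dist_le[OF ts(1) ts(2)[OF k]])
    have 3: "avg (ts l) (avg (ts n) (F k)) 0 = avg (ts n) (avg (ts l) (F k)) 0" by (metis avg_commute)
    show ?thesis using 1 2 norm_triangle_ineq4[of "avg (ts n) (avg (ts l) (F k)) 0 - a k l"
        "avg (ts n) (avg (ts l) (F k)) 0 - a k n"] unfolding 3 by (simp add: norm_minus_commute)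
  qed
  have lim0: "(\<lambda>n. 1 / real (Suc n)) \<longlonglongrightarrow> 0" by (rule LIMSEQ_Suc) (rule lim_1_over_n)
  have "\<exists>m. a k \<longlonglongrightarrow> m" if k: "k \<in> K" for k
  proof -
    have "Cauchy (a k)"
    proof (rule CauchyI)
      fix e :: real assume "e > 0"
      then have "eventually (\<lambda>n. 1 / real (Suc n) < e/2) sequentially"
        using order_tendstoD(2)[OF lim0, of "e/2"] by simp
      then obtain N where N: "\<And>n. n \<ge> N \<Longrightarrow> 1 / real (Suc n) < e/2"
        by (auto simp: eventually_sequentially)
      show "\<exists>M. \<forall>m\<ge>M. \<forall>n\<ge>M. norm (a k m - a k n) < e"
        using N dist[OF k] by (intro exI[of _ N] allI impI) (smt (verit) field_sum_of_halves)
    qed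
    then show ?thesis by (simp add: Cauchy_convergent_iff convergent_def)
  qed
  then obtain m where m: "\<And>k. k \<in> K \<Longrightarrow> a k \<longlonglongrightarrow> m k" by metis
  have am: "norm (a k n - m k) \<le> 1/Suc n" if k: "k \<in> K" for k n
  proof -
    have "(\<lambda>l. norm (a k n - a k l)) \<longlonglongrightarrow> norm (a k n - m k)"
      by (intro tendsto_intros m k)
    moreover have "(\<lambda>l. 1/Suc n + 1/Suc l) \<longlonglongrightarrow> 1/Suc n + 0"
      by (intro tendsto_intros lim0)
    ultimately show ?thesis
      using dist[OF k] LIMSEQ_le[of "\<lambda>l. norm (a k n - a k l)" _ "\<lambda>l. 1/Suc n + 1/Suc l"] by auto
  qed
  have *: "\<exists>ts. ts \<noteq> [] \<and> (\<forall>k\<in>K. \<forall>x. norm (avg ts (F k) x - m k) \<le> e)" if "e > 0" for e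
  proof -
    obtain n where n: "1 / real (Suc n) < e/2"
      using \<open>e > 0\<close> nat_approx_posE[of "e/2"] by auto
    have "norm (avg (ts n) (F k) x - m k) \<le> e" if k: "k \<in> K" for k x
    proof -
      have "norm (avg (ts n) (F k) x - m k) \<le> norm (avg (ts n) (F k) x - a k n) + norm (a k n - m k)"
        using norm_triangle_ineq[of "avg (ts n) (F k) x - a k n" "a k n - m k"] by simp
      also have "\<dots> \<le> 1/Suc n + 1/Suc n"
        using ts(2)[OF k, of n x] am[OF k, of n] unfolding a_def by (rule add_mono)
      also have "\<dots> \<le> e" using n by linarith
      finally show ?thesis .
    qed
    then show ?thesis using ts(1) by blast
  qed
  have "is_mean (F k) (m k)" if "k \<in> K" for k
    unfolding is_mean_def using * that by meson
  with * show ?thesis by (intro exI[of _ m] conjI allI impI ballI) auto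
qed

lemma is_mean_dist:
  assumes "is_mean u m" "is_mean v m'" "\<And>x. norm (u x - v x) \<le> d"
  shows "norm (m - m') \<le> d"
proof (rule field_le_epsilon)
  fix e :: real assume "e > 0"
  then obtain ts ss where ts: "ts \<noteq> []" "\<And>x. norm (avg ts u x - m) \<le> e/2"
    and ss: "ss \<noteq> []" "\<And>x. norm (avg ss v x - m') \<le> e/2"
    using assms(1,2) unfolding is_mean_def by (meson half_gt_zero)
  have 1: "norm (avg ss (avg ts u) 0 - m) \<le> e/2" by (intro avg_dist_le ss ts)
  have 2: "norm (avg ss (avg ts v) 0 - m') \<le> e/2" unfolding avg_commute[of ss] by (intro avg_dist_le ss ts)
  have 3: "norm (avg ss (avg ts u) 0 - avg ss (avg ts v) 0) \<le> d"
    by (intro avg_diff_le ss ts assms)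
  show "norm (m - m') \<le> d + e" using 1 2 3 by norm
qed

lemma is_mean_unique: "is_mean u m \<Longrightarrow> is_mean u m' \<Longrightarrow> m = m'"
  using is_mean_dist[of u m u m' 0] by simp

lemma is_mean_add:
  assumes "is_mean u m" "is_mean v m'"
  shows "is_mean (\<lambda>x. u x + v x) (m + m')"
  unfolding is_mean_def
proof (intro allI impI)
  fix e :: real assume "e > 0"
  then obtain ts ss where ts: "ts \<noteq> []" "\<And>x. norm (avg ts u x - m) \<le> e/2"
    and ss: "ss \<noteq> []" "\<And>x. norm (avg ss v x - m') \<le> e/2"
    using assms unfolding is_mean_def by (meson half_gt_zero)
  have "norm (avg ss (avg ts (\<lambda>x. u x + v x)) x - (m + m')) \<le> e" for x
  proof -
    have 1: "norm (avg ss (avg ts u) x - m) \<le> e/2" by (intro avg_dist_le ss ts)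
    have 2: "norm (avg ss (avg ts v) x - m') \<le> e/2" unfolding avg_commute[of ss] by (intro avg_dist_le ss ts)
    have "avg ts (\<lambda>x. u x + v x) = (\<lambda>x. avg ts u x + avg ts v x)" by (intro ext avg_add)
    then have "avg ss (avg ts (\<lambda>x. u x + v x)) x = avg ss (avg ts u) x + avg ss (avg ts v) x"
      by (simp add: avg_add)
    then show ?thesis using 1 2 norm_triangle_ineq[of "avg ss (avg ts u) x - m" "avg ss (avg ts v) x - m'"]
      by (simp add: algebra_simps)
  qed
  then show "\<exists>ts. ts \<noteq> [] \<and> (\<forall>x. norm (avg ts (\<lambda>x. u x + v x) x - (m + m')) \<le> e)"
    using ts(1) ss(1) unfolding avg_avg
    by (intro exI[of _ "concat (map (\<lambda>s. map ((+) s) ts) ss)"]) (auto simp: neq_Nil_conv)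
qed

lemma is_mean_const: "is_mean (\<lambda>x. a) a"
  unfolding is_mean_def by (intro allI impI exI[of _ "[0]"]) (simp add: avg_const)

lemma is_mean_cmult:
  assumes "is_mean u m" shows "is_mean (\<lambda>x. a * u x) (a * m)"
  unfolding is_mean_def
proof (intro allI impI)
  fix e :: real assume e: "e > 0"
  then have "e / (norm a + 1) > 0" by (simp add: add_nonneg_pos)
  then obtain ts where ts: "ts \<noteq> []" "\<And>x. norm (avg ts u x - m) \<le> e/(norm a + 1)"
    using assms unfolding is_mean_def by meson
  have "norm (avg ts (\<lambda>x. a * u x) x - a * m) \<le> e" for x
  proof -
    have "norm (avg ts (\<lambda>x. a * u x) x - a * m) = norm a * norm (avg ts u x - m)"
      by (simp add: avg_cmult flip: norm_mult right_diff_distrib)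
    also have "\<dots> \<le> norm a * (e/(norm a + 1))" using ts by (intro mult_left_mono) auto
    also have "\<dots> \<le> e" using e
      by (simp add: divide_le_eq add_nonneg_pos)
    finally show ?thesis .
  qed
  with ts show "\<exists>ts. ts \<noteq> [] \<and> (\<forall>x. norm (avg ts (\<lambda>x. a * u x) x - a * m) \<le> e)" by blast
qed

lemma is_mean_diff:
  assumes "is_mean u m" "is_mean v m'" shows "is_mean (\<lambda>x. u x - v x) (m - m')"
  using is_mean_add[OF assms(1) is_mean_cmult[OF assms(2), of "-1"]] by simp

lemma is_mean_sum:
  assumes "\<And>i. i \<in> I \<Longrightarrow> is_mean (u i) (m i)" shows "is_mean (\<lambda>x. \<Sum>i\<in>I. u i x) (\<Sum>i\<in>I. m i)"
  using assms
proof (induction I rule: infinite_finite_induct)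
  case (insert i I)
  then have "is_mean (\<lambda>x. u i x + (\<Sum>i\<in>I. u i x)) (m i + (\<Sum>i\<in>I. m i))"
    by (intro is_mean_add) auto
  then show ?case using insert by simp
qed (simp_all add: is_mean_const)

lemma is_mean_shift: "is_mean u m \<Longrightarrow> is_mean (\<lambda>x. u (x + a)) m"
  unfolding is_mean_def by (metis avg_shift)

lemma avg_cnj: "avg ts (\<lambda>x. cnj (u x)) x = cnj (avg ts u x)"
proof -
  have "(\<Sum>t\<leftarrow>ts. cnj (u (x + t))) = cnj (\<Sum>t\<leftarrow>ts. u (x + t))" by (induction ts) simp_all
  then show ?thesis by (simp add: avg_def)
qed

lemma is_mean_cnj: "is_mean u m \<Longrightarrow> is_mean (\<lambda>x. cnj (u x)) (cnj m)"
  unfolding is_mean_def by (metis avg_cnj complex_cnj_diff complex_mod_cnj)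

lemma is_mean_Re_ge:
  assumes "is_mean u m" "\<And>x. Re (u x) \<ge> c" shows "Re m \<ge> c"
proof (rule field_le_epsilon)
  fix e :: real assume "e > 0"
  then obtain ts where ts: "ts \<noteq> []" "\<And>x. norm (avg ts u x - m) \<le> e"
    using assms unfolding is_mean_def by meson
  have "Re (\<Sum>t\<leftarrow>ts. u (0 + t)) \<ge> length ts * c"
  proof (induction ts)
    case (Cons t ts) 
    with assms(2)[of t] show ?case by (simp add: algebra_simps)
  qed simp
  then have "Re (avg ts u 0) \<ge> c"
    using ts(1) by (simp add: avg_def field_simps)
  moreover have "\<bar>Re (avg ts u 0 - m)\<bar> \<le> e" using ts(2) abs_Re_le_cmod order_trans by blast
  ultimately show "c \<le> Re m + e" by simp
qed

lemma ap_mean: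
  assumes "ap u" obtains m where "is_mean u m"
proof -
  obtain B where B: "\<And>x. norm (u x) \<le> B" using ap_bounded[OF assms] by blast
  from uap_mean[OF assms B] obtain m :: "unit \<Rightarrow> complex" where "\<forall>k\<in>UNIV. is_mean u (m k)" by blast
  then show ?thesis using that by blast
qed

text \<open>Almost periodicity makes the points where \<open>Re (u x)\<close> exceeds half of
  \<open>Re (u a)\<close> relatively dense: finitely many translates of \<open>u\<close>, one for
  each net element, have a sum bounded below by \<open>c\<close>, and all of them share the mean of
  \<open>u\<close>.\<close>

lemma is_mean_pos:
  assumes "ap u" "is_mean u m" "\<And>x. Re (u x) \<ge> 0" "Re (u a) > 0"
  shows "Re m > 0"
proof -
  define c where "c = Re (u a) / 2"
  have c: "c > 0" using assms by (simp add: c_def)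
  obtain T \<rho> where T: "finite T" "\<And>t. \<rho> t \<in> T" "\<And>t x. norm (u (x + t) - u (x + \<rho> t)) < c"
    using uap_net[OF assms(1) c] by (metis UNIV_I)
  have "is_mean (\<lambda>x. \<Sum>t\<in>T. u (x + (a - t))) (\<Sum>t\<in>T. m)"
    by (intro is_mean_sum is_mean_shift assms)
  moreover have "Re (\<Sum>t\<in>T. u (x + (a - t))) \<ge> c" for x
  proof -
    have "norm (u ((a - \<rho> x) + x) - u ((a - \<rho> x) + \<rho> x)) < c" by (rule T(3))
    then have "norm (u (x + (a - \<rho> x)) - u a) < c" by (simp add: add.commute)
    then have "\<bar>Re (u (x + (a - \<rho> x))) - Re (u a)\<bar> < c"
      using abs_Re_le_cmod[of "u (x + (a - \<rho> x)) - u a"] by simp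
    then have "c \<le> Re (u (x + (a - \<rho> x)))" unfolding c_def by (simp add: abs_if split: if_splits)
    also have "\<dots> \<le> (\<Sum>t\<in>T. Re (u (x + (a - t))))"
      using T assms(3) by (intro member_le_sum[where f = "\<lambda>t. Re (u (x + (a - t)))"]) auto
    finally show ?thesis by simp
  qed
  ultimately have "c \<le> Re (\<Sum>t\<in>T. m)" by (rule is_mean_Re_ge)
  then have "c \<le> card T * Re m" by simp
  with c show ?thesis by (metis linorder_not_le mult_nonneg_nonpos of_nat_0_le_iff order_trans)
qed

text \<open>
  The mean of \<open>\<kappa> ^ N\<close> decays more slowly than \<open>(1 - \<eta>) ^ N\<close>, because \<open>\<kappa>\<close> is near 1 on a set of
  positive density; hence \<open>\<kappa> ^ N\<close> concentrates where \<open>\<kappa> > 1 - \<eta>\<close>.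
\<close>

lemma concentration:
  fixes \<kappa> :: "'a::ab_group_add \<Rightarrow> real" and \<psi> :: "'a \<Rightarrow> complex"
  assumes "ap (\<lambda>x. of_real (\<kappa> x))" "ap \<psi>"
    and \<kappa>: "\<And>x. 0 \<le> \<kappa> x" "\<And>x. \<kappa> x \<le> 1" "\<kappa> 0 = 1"
    and mean0: "\<And>N. is_mean (\<lambda>x. \<psi> x * of_real (\<kappa> x) ^ N) 0"
    and "\<eta> > 0"
  obtains t where "\<kappa> t > 1 - \<eta>" "Re (\<psi> t) < 1/2"
proof (rule ccontr)
  assume neg: "\<not> thesis"
  note goal = that
  \<comment> \<open>The cut at 1/2 keeps 1 - e positive, so that the two exponential bounds can be
    divided.\<close>
  define e where "e = min \<eta> (1/2)"
  have e: "e > 0" "e < 1" "e \<le> \<eta>" using \<open>\<eta> > 0\<close> by (auto simp: e_def)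
  have good: "Re (\<psi> t) \<ge> 1/2" if t: "\<kappa> t > 1 - e" for t
  proof (rule ccontr)
    assume "\<not> Re (\<psi> t) \<ge> 1/2"
    moreover have "\<kappa> t > 1 - \<eta>" using t e(3) by linarith
    ultimately show False using goal[of t] neg by simp
  qed
  obtain B where B: "B > 0" "\<And>x. norm (\<psi> x) \<le> B" using ap_bounded[OF assms(2)] by blast
  have "e/2 > 0" using e by simp
  then obtain T \<rho> where T: "finite T" "\<And>t. \<rho> t \<in> T"
    "\<And>t x. norm (complex_of_real (\<kappa> (x + t)) - of_real (\<kappa> (x + \<rho> t))) < e/2"
    using uap_net[OF assms(1)] by (metis UNIV_I)
  have "(1 - e/2)^N \<le> card T * ((2*B + 1) * (1 - e)^N)" for N
  proof -
    obtain m where m: "is_mean (\<lambda>x. of_real (\<kappa> x) ^ N) m"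
      using ap_mean[OF ap_power[OF assms(1)]] by blast
    \<comment> \<open>Where \<kappa> exceeds 1 - e, (\<psi> - 1/2) \<kappa>^N has nonnegative real
      part by \<open>good\<close>; elsewhere it is at most a constant times (1 - e)^N. As \<psi>
      \<kappa>^N has mean 0, this bounds the mean of \<kappa>^N from above.\<close>
    have "Re (0 - (1/2) * m) \<ge> - ((B + 1/2) * (1 - e)^N)"
    proof (rule is_mean_Re_ge)
      show "is_mean (\<lambda>x. \<psi> x * of_real (\<kappa> x) ^ N - (1/2) * of_real (\<kappa> x) ^ N) (0 - (1/2) * m)"
        by (intro is_mean_diff mean0 is_mean_cmult m)
      fix x
      have eq: "Re (\<psi> x * of_real (\<kappa> x) ^ N - (1/2) * of_real (\<kappa> x) ^ N) = (Re (\<psi> x) - 1/2) * \<kappa> x ^ N"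
        by (simp add: algebra_simps flip: of_real_power)
      show "- ((B + 1/2) * (1 - e)^N) \<le> Re (\<psi> x * of_real (\<kappa> x) ^ N - (1/2) * of_real (\<kappa> x) ^ N)"
      proof (cases "\<kappa> x > 1 - e")
        case True
        then have "(Re (\<psi> x) - 1/2) * \<kappa> x ^ N \<ge> 0" using good \<kappa>(1) by (intro mult_nonneg_nonneg) auto
        moreover have "(B + 1/2) * (1 - e)^N \<ge> 0" using B e by (intro mult_nonneg_nonneg) auto
        ultimately show ?thesis unfolding eq by linarith
      next
        case False
        then have "\<kappa> x ^ N \<le> (1 - e)^N" using \<kappa>(1) by (intro power_mono) auto
        moreover have "\<bar>Re (\<psi> x) - 1/2\<bar> \<le> B + 1/2" using B(2)[of x] abs_Re_le_cmod[of "\<psi> x"] by linarith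
        ultimately have "\<bar>(Re (\<psi> x) - 1/2) * \<kappa> x ^ N\<bar> \<le> (B + 1/2) * (1 - e)^N"
          unfolding abs_mult using \<kappa>(1)[of x] B(1) by (intro mult_mono) auto
        then show ?thesis unfolding eq by linarith
      qed
    qed
    then have 1: "Re m \<le> (2*B + 1) * (1 - e)^N" by (simp add: algebra_simps)
    \<comment> \<open>Every \<open>x\<close> has a translate by a net element at which \<kappa> is
      within e/2 of its value 1 at the origin, so the sum over the net is bounded below.\<close>
    have "(1 - e/2)^N \<le> Re (\<Sum>t\<in>T. m)"
    proof (rule is_mean_Re_ge)
      show "is_mean (\<lambda>x. \<Sum>t\<in>T. of_real (\<kappa> (x + (- t))) ^ N) (\<Sum>t\<in>T. m)"
        by (intro is_mean_sum is_mean_shift[OF m, of "- t" for t])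
      fix x
      have "norm (complex_of_real (\<kappa> (- \<rho> x + x)) - of_real (\<kappa> (- \<rho> x + \<rho> x))) < e/2" by (rule T(3))
      then have "norm (complex_of_real (\<kappa> (x + - \<rho> x) - 1)) < e/2" using \<kappa>(3)
        by (simp add: add.commute)
      then have "\<bar>\<kappa> (x + - \<rho> x) - 1\<bar> < e/2" unfolding norm_of_real .
      then have "1 - e/2 \<le> \<kappa> (x + - \<rho> x)" by linarith
      then have "(1 - e/2)^N \<le> \<kappa> (x + - \<rho> x) ^ N" using e by (intro power_mono) auto
      also have "\<dots> \<le> (\<Sum>t\<in>T. \<kappa> (x + - t) ^ N)"
        using T \<kappa>(1) by (intro member_le_sum[where f = "\<lambda>t. \<kappa> (x + - t) ^ N"]) auto
      finally show "(1 - e/2)^N \<le> Re (\<Sum>t\<in>T. of_real (\<kappa> (x + - t)) ^ N)"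
        by (simp flip: of_real_power)
    qed
    also have "\<dots> \<le> card T * ((2*B + 1) * (1 - e)^N)"
      using 1 by (simp add: mult_left_mono)
    finally show ?thesis .
  qed
  then have le: "((1 - e/2) / (1 - e))^N \<le> card T * (2*B + 1)" for N
    using e by (simp add: power_divide divide_le_eq mult.assoc)
  have "(1 - e/2) / (1 - e) > 1" using e by (simp add: field_simps)
  then obtain N where "card T * (2*B + 1) < ((1 - e/2) / (1 - e))^N"
    using real_arch_pow by blast
  with le[of N] show False by simp
qed

section \<open>Window sums of sequences on the integers\<close>

lemma sum_shift_bound:
  fixes v :: "int \<Rightarrow> complex"
  assumes B: "\<And>n. norm (v n) \<le> B"
  shows "norm ((\<Sum>n<N. v (x + int n + t)) - (\<Sum>n<N. v (x + int n))) \<le> 2 * B * \<bar>t\<bar>"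
proof -
  have B0: "B \<ge> 0" using B[of 0] norm_ge_zero order_trans by blast
  have nn: "norm ((\<Sum>n<N. v (y + int n + int k)) - (\<Sum>n<N. v (y + int n))) \<le> 2 * B * k" for y k
  proof (induction k)
    case (Suc k)
    have "(\<Sum>n<N. v (y + int n + int (Suc k))) - (\<Sum>n<N. v (y + int n + int k))
        = (\<Sum>n<N. v (y + int (Suc n) + int k) - v (y + int n + int k))"
      by (simp add: sum_subtractf algebra_simps)
    also have "\<dots> = v (y + int N + int k) - v (y + int 0 + int k)"
      by (rule sum_lessThan_telescope)
    finally have "norm ((\<Sum>n<N. v (y + int n + int (Suc k))) - (\<Sum>n<N. v (y + int n + int k))) \<le> 2 * B"
      using B[of "y + int N + int k"] B[of "y + int 0 + int k"]
        norm_triangle_ineq4[of "v (y + int N + int k)" "v (y + int 0 + int k)"] by simp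
    then show ?case using Suc
        norm_triangle_ineq[of "(\<Sum>n<N. v (y + int n + int (Suc k))) - (\<Sum>n<N. v (y + int n + int k))"
        "(\<Sum>n<N. v (y + int n + int k)) - (\<Sum>n<N. v (y + int n))"] by (simp add: algebra_simps)
  qed simp
  show ?thesis
  proof (cases "t \<ge> 0")
    case True
    then show ?thesis using nn[of x "nat t"] by simp
  next
    case False
    have "(\<Sum>n<N. v (x + t + int n + int (nat (- t)))) = (\<Sum>n<N. v (x + int n))"
      using False by (intro sum.cong) auto
    moreover have "(\<Sum>n<N. v (x + t + int n)) = (\<Sum>n<N. v (x + int n + t))"
      by (intro sum.cong) (auto simp: algebra_simps)
    ultimately show ?thesis using nn[of "x + t" "nat (- t)"] False by (simp add: norm_minus_commute)
  qed
qed

text \<open>Averaging a window sum over \<open>ts\<close> moves the window by at most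
  \<open>L\<close>, at a boundary cost independent of the window length; averaging the terms instead
  makes each of them e/2-close to \<open>m\<close>. So the abstract mean is the Cesaro limit,
  uniformly in the starting point.\<close>

lemma is_mean_int_sums:
  fixes v :: "int \<Rightarrow> complex"
  assumes "is_mean v m" and B: "\<And>n. norm (v n) \<le> B" and "e > 0"
  shows "\<exists>N0>0. \<forall>N\<ge>N0. \<forall>x. norm ((\<Sum>n<N. v (x + int n)) - N * m) \<le> e * N"
proof -
  have B0: "B \<ge> 0" using B[of 0] norm_ge_zero order_trans by blast
  obtain ts where ts: "ts \<noteq> []" "\<And>x. norm (avg ts v x - m) \<le> e/2"
    using assms unfolding is_mean_def by (meson half_gt_zero)
  define L where "L = (\<Sum>t\<in>set ts. real_of_int \<bar>t\<bar>)"
  have L: "real_of_int \<bar>t\<bar> \<le> L" if "t \<in> set ts" for t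
    unfolding L_def using that by (intro member_le_sum[where f = "\<lambda>t. real_of_int \<bar>t\<bar>"]) auto
  have L0: "L \<ge> 0" unfolding L_def by (intro sum_nonneg) auto
  \<comment> \<open>From this size on the boundary term \<open>2 * B * L\<close> is at most half of
    \<open>e * N\<close>.\<close>
  obtain N0 :: nat where N0: "4 * B * L / e < N0" using reals_Archimedean2 by blast
  have "norm ((\<Sum>n<N. v (x + int n)) - N * m) \<le> e * N" if "N \<ge> Suc N0" for N x
  proof -
    define g where "g y = (\<Sum>n<N. v (y + int n))" for y
    have "norm (avg ts g x - g x) \<le> 2 * B * L"
    proof -
      have "norm (g (x + t) - g (x)) \<le> 2 * B * L" if t: "t \<in> set ts" for t
      proof -
        have "g (x + t) = (\<Sum>n<N. v (x + int n + t))"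
          unfolding g_def by (intro sum.cong) (auto simp: algebra_simps)
        then have "norm (g (x + t) - g x) \<le> 2 * B * \<bar>t\<bar>"
          using sum_shift_bound[OF B] by (simp add: g_def)
        also have "\<dots> \<le> 2 * B * L" using L[OF t] B0 by (intro mult_left_mono) auto
        finally show ?thesis .
      qed
      then show ?thesis using avg_diff_le[OF ts(1), of g x "\<lambda>_. g x" x] by (simp add: avg_const ts(1))
    qed
    moreover have "avg ts g x = (\<Sum>n<N. avg ts v (x + int n))"
    proof -
      have "(\<Sum>t\<leftarrow>ts. g (x + t)) = (\<Sum>n<N. \<Sum>t\<leftarrow>ts. v (x + int n + t))"
        unfolding g_def by (induction ts) (simp_all add: sum.distrib algebra_simps)
      then show ?thesis by (simp add: avg_def sum_divide_distrib)
    qed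
    moreover have "norm ((\<Sum>n<N. avg ts v (x + int n)) - N * m) \<le> N * (e/2)"
    proof -
      have "(\<Sum>n<N. avg ts v (x + int n)) - N * m = (\<Sum>n<N. avg ts v (x + int n) - m)"
        by (simp add: sum_subtractf)
      also have "norm \<dots> \<le> (\<Sum>n<N. e/2)" by (intro sum_norm_le ts)
      finally show ?thesis by simp
    qed
    moreover have "2 * B * L \<le> N * (e/2)"
    proof -
      have "4 * B * L / e \<le> N" using N0 that by linarith
      then show ?thesis using \<open>e > 0\<close> by (simp add: field_simps)
    qed
    ultimately have "norm (g x - N * m) \<le> N * (e/2) + N * (e/2)"
      using norm_triangle_ineq[of "g x - avg ts g x" "avg ts g x - N * m"]
      by (simp add: norm_minus_commute algebra_simps)
    then show ?thesis by (simp add: g_def algebra_simps)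
  qed
  then show ?thesis by (intro exI[of _ "Suc N0"]) blast
qed

lemma sum_lessThan_add:
  fixes f :: "nat \<Rightarrow> 'a::comm_monoid_add"
  shows "(\<Sum>i<a + b. f i) = (\<Sum>i<a. f i) + (\<Sum>i<b. f (a + i))"
  by (induction b) (simp_all add: add.assoc)

text \<open>Uniformity in the frequency comes from compactness of the unit circle. A window length
  \<open>M\<close> that is good for a limit frequency \<open>z\<close> is good for all nearby
  frequencies by continuity; a long window is cut into blocks of that length, and moving from one
  block to the next only introduces a unimodular factor.\<close>

lemma sum_twisted_uniformly_small:
  fixes u :: "int \<Rightarrow> complex" and e :: real
  assumes B: "\<And>n. norm (u n) \<le> B"
    and mean0: "\<And>w. norm w = 1 \<Longrightarrow> is_mean (\<lambda>n. u n * w powi n) 0"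
    and "e > 0"
  shows "\<exists>N0>0. \<forall>N\<ge>N0. \<forall>w x. norm w = 1 \<longrightarrow> norm (\<Sum>n<N. u (x + int n) * w ^ n) \<le> e * N"
proof (rule ccontr)
  assume "\<not> ?thesis"
  then have "\<exists>N\<ge>N0. \<exists>w x. norm w = 1 \<and> norm (\<Sum>n<N. u (x + int n) * w ^ n) > e * N" if "N0 > 0" for N0
    using that by (meson not_le)
  then have "\<forall>k. \<exists>N w x. N \<ge> Suc k \<and> norm w = 1 \<and> norm (\<Sum>n<N. u (x + int n) * w ^ n) > e * N"
    by (meson zero_less_Suc)
  then obtain N w x where bad: "\<And>k. N k \<ge> Suc k" "\<And>k. norm (w k) = 1"
    "\<And>k. norm (\<Sum>n<N k. u (x k + int n) * w k ^ n) > e * N k"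
    by metis
  have "compact (sphere (0::complex) 1)" by simp
  moreover have "\<forall>k. w k \<in> sphere 0 1" using bad by simp
  ultimately obtain z r where z': "z \<in> sphere 0 1" "strict_mono (r :: nat \<Rightarrow> nat)" "(w \<circ> r) \<longlonglongrightarrow> z"
    unfolding compact_def by blast
  then have z: "norm z = 1" "strict_mono r" "(w \<circ> r) \<longlonglongrightarrow> z" by simp_all
  have B0: "B \<ge> 0" using B[of 0] norm_ge_zero order_trans by blast
  have Bz: "norm (u n * z powi n) \<le> B" for n using B[of n] z(1) by (simp add: norm_mult norm_power_int)
  have "e/4 > 0" using \<open>e > 0\<close> by simp
  from is_mean_int_sums[OF mean0[OF z(1)] Bz this]
  obtain M where M0: "M > 0"
    "\<forall>n\<ge>M. \<forall>y. norm ((\<Sum>i<n. u (y + int i) * z powi (y + int i))) \<le> e/4 * n" by auto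
  have M: "M > 0" "\<And>n y. n \<ge> M \<Longrightarrow> norm ((\<Sum>i<n. u (y + int i) * z powi (y + int i))) \<le> e/4 * n"
    using M0(1) M0(2)[rule_format] by blast+
  have z0: "z \<noteq> 0" using z(1) by auto
  have Mz: "norm (\<Sum>i<M. u (y + int i) * z ^ i) \<le> e/4 * M" for y
  proof -
    have "(\<Sum>i<M. u (y + int i) * z powi (y + int i)) = z powi y * (\<Sum>i<M. u (y + int i) * z ^ i)"
      by (simp add: sum_distrib_left power_int_add z0 mult_ac)
    then show ?thesis using M(2)[of M y] z(1) by (simp add: norm_mult norm_power_int)
  qed
  \<comment> \<open>Powers with exponent below \<open>M\<close> of two points of the unit circle at
    distance \<open>d\<close> differ by at most M d, so a block sum changes by at most (e/4)
    M.\<close>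
  define d where "d = e / (4 * (B + 1) * M)"
  have d: "d > 0" using \<open>e > 0\<close> B0 M(1) by (simp add: d_def)
  have "eventually (\<lambda>k. dist ((w \<circ> r) k) z < d) sequentially" using tendstoD[OF z(3) d] .
  \<comment> \<open>Makes the incomplete last block, of size at most B M, at most a quarter of e
    n.\<close>
  moreover have "eventually (\<lambda>k. real k > 4 * B * M / e) sequentially"
    using filterlim_real_sequentially by (simp add: filterlim_at_top_dense)
  ultimately have "eventually (\<lambda>k. dist ((w \<circ> r) k) z < d \<and> real k > 4 * B * M / e) sequentially"
    by (rule eventually_conj)
  then obtain k where k: "dist ((w \<circ> r) k) z < d" "real k > 4 * B * M / e"
    by (metis (no_types, lifting) eventually_sequentially order_refl)
  define v where "v = w (r k)"
  define n where "n = N (r k)"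
  have v: "norm v = 1" "norm (v - z) \<le> d" using bad k by (auto simp: v_def dist_norm)
  have "k \<le> r k" by (rule seq_suble[OF z(2)])
  then have n: "n > 4 * B * M / e" using bad(1)[of "r k"] k(2) unfolding n_def by linarith
  have block: "norm (\<Sum>i<M. u (y + int i) * v ^ i) \<le> e/2 * M" for y
  proof -
    have "norm ((\<Sum>i<M. u (y + int i) * v ^ i) - (\<Sum>i<M. u (y + int i) * z ^ i))
        = norm (\<Sum>i<M. u (y + int i) * (v ^ i - z ^ i))"
      by (simp add: sum_subtractf right_diff_distrib)
    also have "\<dots> \<le> (\<Sum>i<M. B * (M * d))"
    proof (rule sum_norm_le)
      fix i assume "i \<in> {..<M}"
      have "norm (v ^ i - z ^ i) \<le> i * norm (v - z)" by (intro norm_power_diff) (use v z in auto)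
      also have "\<dots> \<le> M * d" using v \<open>i \<in> _\<close> by (intro mult_mono) auto
      finally show "norm (u (y + int i) * (v ^ i - z ^ i)) \<le> B * (M * d)"
        unfolding norm_mult using B B0 by (intro mult_mono) auto
    qed
    also have "\<dots> \<le> e/4 * M"
    proof -
      have "B + 1 \<noteq> 0" using B0 by linarith
      then have "B * (M * d) = (e/4) * (B / (B + 1))" using M(1) by (simp add: d_def)
      also have "\<dots> \<le> (e/4) * 1" using B0 \<open>e > 0\<close> by (intro mult_left_mono) auto
      finally have "B * (M * d) \<le> e/4" by simp
      then show ?thesis using mult_left_mono[of "B * (M * d)" "e/4" M] by (simp add: mult.commute)
    qed
    finally show ?thesis using Mz[of y]
        norm_triangle_ineq2[of "(\<Sum>i<M. u (y + int i) * v ^ i)" "(\<Sum>i<M. u (y + int i) * z ^ i)"]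
      by (simp add: algebra_simps)
  qed
  have blocks: "norm (\<Sum>i<q * M. u (y + int i) * v ^ i) \<le> q * (e/2 * M)" for q y
  proof (induction q)
    case (Suc q)
    have "(\<Sum>i<Suc q * M. u (y + int i) * v ^ i) =
       (\<Sum>i<q * M. u (y + int i) * v ^ i) + (\<Sum>i<M. u (y + int (q * M + i)) * v ^ (q * M + i))"
      using sum_lessThan_add[of "\<lambda>i. u (y + int i) * v ^ i" "q * M" M] by (simp add: add.commute)
    also have "(\<Sum>i<M. u (y + int (q * M + i)) * v ^ (q * M + i))
       = v ^ (q * M) * (\<Sum>i<M. u ((y + int (q * M)) + int i) * v ^ i)"
      by (simp add: sum_distrib_left power_add mult_ac add_ac)
    also have "norm ((\<Sum>i<q * M. u (y + int i) * v ^ i) + \<dots>) \<le> q * (e/2 * M) + 1 * (e/2 * M)"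
      using Suc block[of "y + int (q * M)"] v(1)
      by (intro norm_triangle_le add_mono) (auto simp: norm_mult norm_power)
    finally show ?case by (simp add: algebra_simps)
  qed simp
  define q where "q = n div M"
  have nq: "n = q * M + n mod M" by (simp add: q_def)
  have "(\<Sum>i<n. u (x (r k) + int i) * v ^ i) = (\<Sum>i<q * M. u (x (r k) + int i) * v ^ i)
     + (\<Sum>i\<in>{q * M..<n}. u (x (r k) + int i) * v ^ i)"
    unfolding lessThan_atLeast0 using nq by (intro sum.atLeastLessThan_concat[symmetric]) linarith+
  also have "norm \<dots> \<le> q * (e/2 * M) + B * M"
  proof (intro norm_triangle_le add_mono blocks)
    have "norm (\<Sum>i\<in>{q * M..<n}. u (x (r k) + int i) * v ^ i) \<le> (\<Sum>i\<in>{q * M..<n}. B)"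
      by (intro sum_norm_le) (simp add: norm_mult norm_power v B)
    also have "\<dots> = (n mod M) * B" using nq by (simp add: q_def minus_div_mult_eq_mod)
    also have "\<dots> \<le> M * B" using M(1) B0 by (intro mult_right_mono) (auto intro: less_imp_le)
    finally show "norm (\<Sum>i\<in>{q * M..<n}. u (x (r k) + int i) * v ^ i) \<le> B * M" by (simp add: mult.commute)
  qed
  also have "\<dots> \<le> e/2 * n + e/4 * n"
  proof (rule add_mono)
    have "real (q * M) \<le> n" using nq unfolding of_nat_le_iff by linarith
    then show "q * (e/2 * M) \<le> e/2 * n" using \<open>e > 0\<close> by simp
    show "B * M \<le> e/4 * n" using n \<open>e > 0\<close> by (simp add: field_simps)
  qed
  also have "\<dots> < e * n"
  proof -
    have "n > 0" using bad(1)[of "r k"] by (simp add: n_def)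
    then show ?thesis using \<open>e > 0\<close> by (simp add: field_simps)
  qed
  finally show False using bad(3)[of "r k"] by (simp add: n_def v_def)
qed

section \<open>Uniqueness for almost periodic sequences\<close>

lemma periodic_sum_shift:
  fixes g :: "int \<Rightarrow> 'a::ab_group_add"
  assumes per: "\<And>n. g (n + int N) = g n"
  shows "(\<Sum>k<N. g (int k + a)) = (\<Sum>k<N. g (int k))"
proof -
  have step: "(\<Sum>k<N. g (int k + (b + 1))) = (\<Sum>k<N. g (int k + b))" for b
  proof -
    have "(\<Sum>k<N. g (int k + (b + 1))) - (\<Sum>k<N. g (int k + b))
        = (\<Sum>k<N. g (int (Suc k) + b) - g (int k + b))"
      by (simp add: sum_subtractf algebra_simps)
    also have "\<dots> = g (int N + b) - g (int 0 + b)"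
      by (rule sum_lessThan_telescope)
    also have "\<dots> = 0" using per[of b] by (simp add: add.commute)
    finally show ?thesis by simp
  qed
  show ?thesis
  proof (induction a rule: int_induct[where k = 0])
    case (step2 i)
    then show ?case using step[of "i - 1"] by simp
  qed (use step in simp_all)
qed

section \<open>Fourier analysis on the cyclic group of order N\<close>

definition root1 :: "nat \<Rightarrow> nat \<Rightarrow> complex" where
  "root1 N j = cis (2 * pi * real j / real N)"

lemma norm_root1 [simp]: "norm (root1 N j) = 1"
  by (simp add: root1_def)

lemma root1_powi: "root1 N j powi n = cis (2 * pi * real j / real N * of_int n)"
  by (simp add: root1_def cis_power_int mult.commute)

lemma root1_powi_N: "N > 0 \<Longrightarrow> root1 N j powi (n + int N) = root1 N j powi n"
proof -
  assume "N > 0"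
  then have "2 * pi * real j / real N * of_int (n + int N) = 2 * pi * real j / real N * of_int n + 2 * pi * real j"
    by (simp add: field_simps)
  then show ?thesis by (simp add: root1_powi flip: cis_mult)
qed

lemma root1_orthogonal:
  assumes "n < N" "m < N"
  shows "(\<Sum>j<N. root1 N j ^ n * cnj (root1 N j ^ m)) = (if n = m then of_nat N else 0)"
proof -
  define w where "w = cis (2 * pi * (real n - real m) / real N)"
  have eq: "root1 N j ^ n * cnj (root1 N j ^ m) = w ^ j" for j
    by (simp add: root1_def w_def Complex.DeMoivre cis_mult cis_cnj algebra_simps diff_divide_distrib)
  show ?thesis
  proof (cases "n = m")
    case True
    then show ?thesis unfolding eq by (simp add: w_def)
  next
    case False
    have "w \<noteq> 1"
    proof
      assume "w = 1"
      then have "cos (2 * pi * (real n - real m) / real N) = 1" unfolding w_def by (metis cis.sel(1) one_complex.sel(1))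
      then obtain k :: int where "2 * pi * (real n - real m) / real N = real_of_int k * 2 * pi"
        using cos_one_2pi_int by blast
      then have "(2 * pi) * (real n - real m) = (2 * pi) * (k * real N)" using assms by (simp add: field_simps)
      then have "real n - real m = k * real N" unfolding mult_cancel_left by simp
      then have "of_int (int n - int m) = (of_int (k * int N) :: real)" by simp
      then have k: "int n - int m = k * int N" unfolding of_int_eq_iff .
      then have "int N dvd int n - int m" by simp
      moreover have "int n - int m \<noteq> 0" using False by simp
      ultimately have "\<bar>int N\<bar> \<le> \<bar>int n - int m\<bar>" by (rule dvd_imp_le_int[rotated])
      then show False using assms by linarith
    qed
    moreover have "w ^ N = 1"
    proof -
      have "w ^ N = cis (2 * pi * (real n - real m))" using assms by (simp add: w_def Complex.DeMoivre)
      also have "\<dots> = cis (2 * pi * of_int (int n - int m))" by simp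
      also have "\<dots> = 1" by (metis cis_multiple_2pi Ints_of_int)
      finally show ?thesis .
    qed
    ultimately show ?thesis unfolding eq using False by (simp add: sum_gp_strict)
  qed
qed

definition dft :: "nat \<Rightarrow> (int \<Rightarrow> complex) \<Rightarrow> nat \<Rightarrow> complex" where
  "dft N v j = (\<Sum>n<N. v (int n) * root1 N j ^ n) / of_nat N"

lemma dft_parseval:
  assumes "N > 0"
  shows "(\<Sum>j<N. (norm (dft N v j))\<^sup>2) = (\<Sum>n<N. (norm (v (int n)))\<^sup>2) / N"
proof -
  have "of_real (\<Sum>j<N. (norm (dft N v j))\<^sup>2) = (\<Sum>j<N. dft N v j * cnj (dft N v j))"
    unfolding of_real_sum by (intro sum.cong refl complex_norm_square)
  also have "\<dots> = (\<Sum>j<N. (\<Sum>n<N. \<Sum>m<N. v (int n) * cnj (v (int m)) * (root1 N j ^ n * cnj (root1 N j ^ m))) / (of_nat N)^2)"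
    by (intro sum.cong refl) (simp add: dft_def sum_product power2_eq_square mult_ac)
  also have "\<dots> = (\<Sum>n<N. \<Sum>m<N. v (int n) * cnj (v (int m)) * (\<Sum>j<N. root1 N j ^ n * cnj (root1 N j ^ m))) / (of_nat N)^2"
  proof -
    have "(\<Sum>j<N. \<Sum>n<N. \<Sum>m<N. f j n m) = (\<Sum>n<N. \<Sum>m<N. \<Sum>j<N. f j n m)" for f :: "nat \<Rightarrow> nat \<Rightarrow> nat \<Rightarrow> complex"
    proof -
      have "(\<Sum>j<N. \<Sum>n<N. \<Sum>m<N. f j n m) = (\<Sum>n<N. \<Sum>j<N. \<Sum>m<N. f j n m)" by (rule sum.swap)
      also have "\<dots> = (\<Sum>n<N. \<Sum>m<N. \<Sum>j<N. f j n m)" by (intro sum.cong refl sum.swap)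
      finally show ?thesis .
    qed
    then show ?thesis unfolding sum_distrib_left sum_divide_distrib[symmetric] by (intro arg_cong2[where f = "(/)"] refl)
  qed
  also have "\<dots> = (\<Sum>n<N. \<Sum>m<N. if n = m then v (int n) * cnj (v (int m)) * of_nat N else 0) / (of_nat N)^2"
    by (intro arg_cong2[where f = "(/)"] sum.cong refl) (simp add: root1_orthogonal del: complex_cnj_power)
  also have "\<dots> = (\<Sum>n<N. v (int n) * cnj (v (int n))) / of_nat N"
    using assms by (simp add: power2_eq_square flip: sum_distrib_right)
  also have "\<dots> = of_real ((\<Sum>n<N. (norm (v (int n)))\<^sup>2) / N)"
    by (simp add: complex_norm_square del: of_real_power)
  finally show ?thesis unfolding of_real_eq_iff .
qed

definition cyc_corr :: "nat \<Rightarrow> (int \<Rightarrow> complex) \<Rightarrow> int \<Rightarrow> complex" where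
  "cyc_corr N v k = (\<Sum>n<N. v (int n + k) * cnj (v (int n))) / of_nat N"

text \<open>Wiener-Khinchin on the cyclic group. Inserting the factor z^n cnj (z^n) = 1 separates
  the double sum, and periodicity makes the inner sum independent of \<open>n\<close>. The squares
  of these values are the fourth powers of the coefficients of \<open>v\<close>.\<close>

lemma dft_cyc_corr:
  assumes per: "\<And>n. v (n + int N) = v n" and "N > 0"
  shows "dft N (cyc_corr N v) j = of_real ((norm (dft N v j))\<^sup>2)"
proof -
  define z where "z = root1 N j"
  have z: "norm z = 1" "z \<noteq> 0" by (auto simp: z_def root1_def)
  have zc: "z ^ n * cnj (z ^ n) = 1" for n
    using complex_norm_square[of "z ^ n"] z by (simp add: norm_power)
  have sh: "(\<Sum>k<N. v (int n + int k) * z ^ (n + k)) = (\<Sum>k<N. v (int k) * z ^ k)" for n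
  proof -
    have "(\<Sum>k<N. v (int k + int n) * z powi (int k + int n)) = (\<Sum>k<N. v (int k) * z powi (int k))"
      by (rule periodic_sum_shift) (use per root1_powi_N \<open>N > 0\<close> in \<open>simp add: z_def\<close>)
    moreover have "z powi (int k + int n) = z ^ (n + k)" for k
      using z by (metis add.commute of_nat_add power_int_of_nat)
    ultimately show ?thesis by (simp add: add.commute)
  qed
  have "(\<Sum>k<N. cyc_corr N v (int k) * z ^ k) = (\<Sum>k<N. (\<Sum>n<N. v (int n + int k) * cnj (v (int n)) * z ^ k) / of_nat N)"
    by (simp add: cyc_corr_def sum_distrib_right)
  also have "\<dots> = (\<Sum>n<N. \<Sum>k<N. v (int n + int k) * cnj (v (int n)) * z ^ k) / of_nat N"
    unfolding sum_divide_distrib[symmetric] by (subst sum.swap) simp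
  also have "\<dots> = (\<Sum>n<N. (\<Sum>k<N. v (int n + int k) * z ^ (n + k)) * cnj (v (int n) * z ^ n)) / of_nat N"
  proof (intro arg_cong2[where f = "(/)"] sum.cong refl)
    fix n
    have "v (int n + int k) * cnj (v (int n)) * z ^ k = v (int n + int k) * z ^ (n + k) * cnj (v (int n) * z ^ n)" for k
    proof -
      have "v (int n + int k) * z ^ (n + k) * cnj (v (int n) * z ^ n) 
         = v (int n + int k) * cnj (v (int n)) * z ^ k * (z ^ n * cnj (z ^ n))"
        by (simp add: power_add mult_ac)
      then show ?thesis unfolding zc mult_1_right ..
    qed
    then show "(\<Sum>k<N. v (int n + int k) * cnj (v (int n)) * z ^ k)
       = (\<Sum>k<N. v (int n + int k) * z ^ (n + k)) * cnj (v (int n) * z ^ n)"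
      unfolding sum_distrib_right by (intro sum.cong refl)
  qed
  also have "\<dots> = (\<Sum>k<N. v (int k) * z ^ k) * cnj (\<Sum>n<N. v (int n) * z ^ n) / of_nat N"
    unfolding sh by (simp add: sum_distrib_left)
  finally show ?thesis
    unfolding dft_def z_def[symmetric] complex_norm_square by simp
qed

lemma ap_int_almost_period:
  fixes u :: "int \<Rightarrow> complex"
  assumes "ap u" "e > 0"
  obtains N :: nat where "N \<ge> M" "\<And>n. norm (u (n + int N) - u n) < e"
proof -
  obtain c :: "int \<Rightarrow> nat" where c: "finite (range c)"
    "\<And>t t' k x. c t = c t' \<Longrightarrow> k \<in> (UNIV :: unit set) \<Longrightarrow> norm (u (x + t) - u (x + t')) < e"
    using uapE[OF assms] by blast
  \<comment> \<open>Pigeonhole on multiples of \<open>Suc M\<close>, so that the difference of two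
    with equal colour is automatically at least \<open>M\<close>.\<close>
  have "\<not> inj (\<lambda>j. c (int (j * Suc M)))"
  proof
    assume "inj (\<lambda>j. c (int (j * Suc M)))"
    then have "infinite (range (\<lambda>j. c (int (j * Suc M))))" using finite_imageD by blast
    moreover have "range (\<lambda>j. c (int (j * Suc M))) \<subseteq> range c" by auto
    ultimately show False using c(1) finite_subset by blast
  qed
  then obtain i j where "i \<noteq> j" "c (int (i * Suc M)) = c (int (j * Suc M))" unfolding inj_def by blast
  then obtain i j where ij: "i < j" "c (int (i * Suc M)) = c (int (j * Suc M))"
    by (metis linorder_neqE_nat)
  define N where "N = (j - i) * Suc M"
  have "j * Suc M = i * Suc M + N" using ij(1) unfolding N_def
    by (metis add_mult_distrib le_add_diff_inverse less_imp_le)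
  then have iN: "int (j * Suc M) = int (i * Suc M) + int N" by (metis of_nat_add)
  have "norm (u (n + int N) - u n) < e" for n
    using c(2)[OF ij(2)[symmetric] UNIV_I, of "n - int (i * Suc M)"] unfolding iN by simp
  moreover have "1 * Suc M \<le> N" using ij(1) unfolding N_def by (intro mult_le_mono1) auto
  then have "N \<ge> M" by simp
  ultimately show ?thesis using that by blast
qed

text \<open>
  For a large almost period \<open>N\<close>, Parseval on the cyclic group of order \<open>N\<close>, applied to the
  autocorrelation of \<open>u\<close>, bounds the sum of the fourth powers of the Fourier coefficients from below
  independently of \<open>N\<close>, whereas vanishing means make all these coefficients small.
\<close>

theorem ap_int_eq_0:
  fixes u :: "int \<Rightarrow> complex"
  assumes "ap u" and mean0: "\<And>w. norm w = 1 \<Longrightarrow> is_mean (\<lambda>n. u n * w powi n) 0"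
  shows "u n0 = 0"
proof (rule ccontr)
  assume nz: "u n0 \<noteq> 0"
  obtain B where B: "B > 0" "\<And>x. norm (u x) \<le> B" using ap_bounded[OF assms(1)] by blast
  have ap2: "ap (\<lambda>n. u n * cnj (u n))" by (intro ap_mult uap_cnj assms(1))
  have sq: "u n * cnj (u n) = of_real ((norm (u n))\<^sup>2)" for n by (rule complex_norm_square[symmetric])
  obtain m where m: "is_mean (\<lambda>n. u n * cnj (u n)) m" using ap_mean[OF ap2] by blast
  define b where "b = Re m"
  have b: "b > 0" unfolding b_def
    by (rule is_mean_pos[OF ap2 m, of n0]) (use nz in \<open>auto simp: sq\<close>)
  have B2: "norm (u n * cnj (u n)) \<le> B * B" for n
    unfolding norm_mult using B by (intro mult_mono) auto
  have "b/2 > 0" using b by simp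
  from is_mean_int_sums[OF m B2 this] obtain N1 where N1: "N1 > 0"
    "\<And>N x. N \<ge> N1 \<Longrightarrow> norm ((\<Sum>n<N. u (x + int n) * cnj (u (x + int n))) - of_nat N * m) \<le> b/2 * N"
    by blast
  have energy: "(\<Sum>n<N. (norm (u (int n)))\<^sup>2) \<ge> b/2 * N" if "N \<ge> N1" for N
  proof -
    have "(\<Sum>n<N. u (0 + int n) * cnj (u (0 + int n))) = of_real (\<Sum>n<N. (norm (u (int n)))\<^sup>2)"
      unfolding sq by simp
    then have "norm (of_real (\<Sum>n<N. (norm (u (int n)))\<^sup>2) - of_nat N * m) \<le> b/2 * N"
      using N1(2)[OF that, of 0] by simp
    then have "\<bar>Re (of_real (\<Sum>n<N. (norm (u (int n)))\<^sup>2) - of_nat N * m)\<bar> \<le> b/2 * N"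
      using abs_Re_le_cmod order_trans by blast
    then have "\<bar>(\<Sum>n<N. (norm (u (int n)))\<^sup>2) - N * b\<bar> \<le> b/2 * N" by (simp add: b_def)
    then have "N * b - (\<Sum>n<N. (norm (u (int n)))\<^sup>2) \<le> b/2 * N" by linarith
    then show ?thesis by (simp add: algebra_simps)
  qed
  \<comment> \<open>The shifted correlation below differs from the energy by at most
    \<open>2 * e1 * B\<close>, that is b/4, per term; this leaves b/4 of the lower bound
    b/2.\<close>
  define e1 where "e1 = b / (8 * B)"
  have e1: "e1 > 0" using b B by (simp add: e1_def)
  obtain T \<rho> where T: "finite T" "\<And>t. \<rho> t \<in> T" "\<And>t x. norm (u (x + t) - u (x + \<rho> t)) < e1"
    using uap_net[OF assms(1) e1] by (metis UNIV_I)
  define L where "L = nat (\<Sum>t\<in>T. \<bar>t\<bar>)"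
  have L: "\<bar>t\<bar> \<le> int L" if "t \<in> T" for t
  proof -
    have "\<bar>t\<bar> \<le> (\<Sum>t\<in>T. \<bar>t\<bar>)" by (rule member_le_sum[where f = abs]) (use T that in auto)
    then show ?thesis by (simp add: L_def)
  qed
  have T0: "card T > 0" using T by (metis card_gt_0_iff empty_iff)
  \<comment> \<open>Chosen so that the closing bound \<open>card T * (e\<^sup>2 * B\<^sup>2)\<close>
    is at most (b/8)^2, below the required (b/4)^2.\<close>
  define e where "e = b / (8 * B * card T)"
  have e: "e > 0" using b B T0 by (simp add: e_def)
  obtain N2 where N2: "\<And>N w x. N \<ge> N2 \<Longrightarrow> norm w = 1 \<Longrightarrow> norm (\<Sum>n<N. u (x + int n) * w ^ n) \<le> e * N"
    using sum_twisted_uniformly_small[of u B, OF B(2) mean0 e] by blast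
  have "e1/2 > 0" using e1 by simp
  then obtain N :: nat where N: "N \<ge> N1 + N2 + L + 1" and per: "\<And>n. norm (u (n + int N) - u n) < e1/2"
    using ap_int_almost_period[OF assms(1)] by metis
  have Npos: "N > 0" using N by simp
  \<comment> \<open>The periodization of \<open>u\<close> makes the cyclic group available;
    \<open>vclose\<close> controls the error on the range that is used.\<close>
  define v where "v n = u (n mod int N)" for n
  have vper: "v (n + int N) = v n" for n by (simp add: v_def)
  have vu: "v (int n) = u (int n)" if "n < N" for n using that by (simp add: v_def)
  \<comment> \<open>The range contains every \<open>int n + s\<close> with n < N and s between -N
    and 2 N. At most two jumps by the almost period are needed, each costing e1/2.\<close>
  have vclose: "norm (v n - u n) \<le> e1" if "- int N \<le> n" "n < 3 * int N" for n
  proof -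
    have p1: "norm (u (k + int N) - u k) \<le> e1/2" for k using per less_imp_le by blast
    consider "n < 0" | "0 \<le> n" "n < int N" | "int N \<le> n" "n < 2 * int N" | "2 * int N \<le> n" by linarith
    then show ?thesis
    proof cases
      case 1
      then have "n mod int N = n + int N" using that Npos by (intro mod_pos_pos_trivial[of "n + int N" "int N", simplified]) auto
      then show ?thesis using p1[of n] e1 by (simp add: v_def)
    next
      case 2
      then show ?thesis using e1 by (simp add: v_def)
    next
      case 3
      then have "(n - int N) mod int N = n - int N" by (intro mod_pos_pos_trivial) auto
      then have "n mod int N = n - int N" by simp
      then show ?thesis using p1[of "n - int N"] e1 by (simp add: v_def norm_minus_commute)
    next
      case 4
      then have "(n - 2 * int N) mod int N = n - 2 * int N" using that by (intro mod_pos_pos_trivial) auto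
      moreover have "(n - 2 * int N) mod int N = n mod int N"
        using mod_mult_self1[of n "-2" "int N"] by simp
      ultimately have "n mod int N = n - 2 * int N" by simp
      moreover have "norm (u (n - 2 * int N) - u n) \<le> e1/2 + e1/2"
      proof -
        have "u (n - 2 * int N + int N) = u (n - int N)" by (simp add: algebra_simps)
        then show ?thesis using p1[of "n - int N"] p1[of "n - 2 * int N"]
            norm_triangle_ineq[of "u (n - 2 * int N) - u (n - int N)" "u (n - int N) - u n"]
          by (simp add: norm_minus_commute)
      qed
      ultimately show ?thesis by (simp add: v_def)
    qed
  qed
  define c where "c = cyc_corr N v"
  have cper: "c (k + int N) = c k" for k
    using vper by (simp add: c_def cyc_corr_def add.assoc[symmetric])
  \<comment> \<open>The translates of \<open>u\<close> by \<open>int k\<close> and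
    \<open>\<rho> (int k)\<close> are close, so the difference of the two is an almost period of
    \<open>u\<close>; at such a lag the autocorrelation is close to its value at 0, the
    energy.\<close>
  have cbig: "norm (c (int k - \<rho> (int k))) \<ge> b/4" if k: "k < N" for k
  proof -
    define s where "s = int k - \<rho> (int k)"
    have s: "- int N \<le> s" "s \<le> 2 * int N" using L[OF T(2)[of "int k"]] k N unfolding s_def by linarith+
    have "norm (v (int n + s) * cnj (v (int n)) - of_real ((norm (u (int n)))\<^sup>2)) \<le> 2 * e1 * B" if n: "n < N" for n
    proof -
      have "norm (v (int n + s) - u (int n + s)) \<le> e1" using s n by (intro vclose) auto
      moreover have "norm (u (int n + s) - u (int n)) < e1"
        using T(3)[of "int n - \<rho> (int k)" "int k"] by (simp add: s_def algebra_simps)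
      ultimately have "norm (v (int n + s) - u (int n)) \<le> 2 * e1"
        using norm_triangle_ineq[of "v (int n + s) - u (int n + s)" "u (int n + s) - u (int n)"] by simp
      then have "norm ((v (int n + s) - u (int n)) * cnj (u (int n))) \<le> 2 * e1 * B"
        unfolding norm_mult using B e1 by (intro mult_mono) auto
      then show ?thesis using vu[OF n] unfolding sq[symmetric] by (simp add: algebra_simps)
    qed
    then have "norm ((\<Sum>n<N. v (int n + s) * cnj (v (int n))) - of_real (\<Sum>n<N. (norm (u (int n)))\<^sup>2))
        \<le> (\<Sum>n<N. 2 * e1 * B)"
      unfolding of_real_sum sum_subtractf[symmetric] by (intro sum_norm_le) auto
    also have "\<dots> = b/4 * N" using B by (simp add: e1_def)
    finally have a: "norm (of_real (\<Sum>n<N. (norm (u (int n)))\<^sup>2) - (\<Sum>n<N. v (int n + s) * cnj (v (int n)))) \<le> b/4 * N"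
      by (subst norm_minus_commute)
    have "norm ((\<Sum>n<N. v (int n + s) * cnj (v (int n)))) \<ge> b/2 * N - b/4 * N"
    proof -
      have "norm (complex_of_real (\<Sum>n<N. (norm (u (int n)))\<^sup>2)) \<ge> b/2 * N"
        unfolding norm_of_real using energy[of N] N by linarith
      then show ?thesis using a norm_triangle_ineq2[of "complex_of_real (\<Sum>n<N. (norm (u (int n)))\<^sup>2)"
         "(\<Sum>n<N. v (int n + s) * cnj (v (int n)))"] by linarith
    qed
    then have "norm ((\<Sum>n<N. v (int n + s) * cnj (v (int n)))) \<ge> (b/4) * N" by (simp add: algebra_simps)
    then show ?thesis using Npos unfolding c_def cyc_corr_def s_def[symmetric]
      by (simp add: norm_divide le_divide_eq)
  qed
  have "N * (b/4)\<^sup>2 = (\<Sum>k<N. (b/4)\<^sup>2)" by simp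
  also have "\<dots> \<le> (\<Sum>k<N. \<Sum>t\<in>T. (norm (c (int k - t)))\<^sup>2)"
  proof (rule sum_mono)
    fix k assume "k \<in> {..<N}"
    then have "(b/4)\<^sup>2 \<le> (norm (c (int k - \<rho> (int k))))\<^sup>2" using cbig b by (intro power_mono) auto
    also have "\<dots> \<le> (\<Sum>t\<in>T. (norm (c (int k - t)))\<^sup>2)"
      using T by (intro member_le_sum[where f = "\<lambda>t. (norm (c (int k - t)))\<^sup>2"]) auto
    finally show "(b/4)\<^sup>2 \<le> (\<Sum>t\<in>T. (norm (c (int k - t)))\<^sup>2)" .
  qed
  also have "\<dots> = (\<Sum>t\<in>T. \<Sum>k<N. (norm (c (int k + (- t))))\<^sup>2)" by (subst sum.swap) simp
  \<comment> \<open>Summed over a full period, the shift by a net element disappears.\<close>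
  also have "\<dots> = (\<Sum>t\<in>T. \<Sum>k<N. (norm (c (int k)))\<^sup>2)"
    by (intro sum.cong refl periodic_sum_shift) (simp add: cper)
  also have "\<dots> = card T * (\<Sum>k<N. (norm (c (int k)))\<^sup>2)" by simp
  also have "(\<Sum>k<N. (norm (c (int k)))\<^sup>2) = N * (\<Sum>j<N. (norm (dft N c j))\<^sup>2)"
    using dft_parseval[OF Npos, of c] Npos by simp
  also have "(\<Sum>j<N. (norm (dft N c j))\<^sup>2) = (\<Sum>j<N. (norm (dft N v j))\<^sup>2 * (norm (dft N v j))\<^sup>2)"
    unfolding c_def using dft_cyc_corr[of v N, OF vper Npos] by (simp add: power2_eq_square norm_mult)
  \<comment> \<open>One factor is bounded by the uniform smallness of the coefficients, the other is
    summed by Parseval.\<close>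
  also have "\<dots> \<le> (\<Sum>j<N. e\<^sup>2 * (norm (dft N v j))\<^sup>2)"
  proof (intro sum_mono mult_right_mono power_mono)
    fix j
    have "(\<Sum>n<N. v (int n) * root1 N j ^ n) = (\<Sum>n<N. u (0 + int n) * root1 N j ^ n)"
      using vu by (intro sum.cong) auto
    then have "norm (\<Sum>n<N. v (int n) * root1 N j ^ n) \<le> e * N" using N2[of N "root1 N j" 0] N by simp
    then show "norm (dft N v j) \<le> e" using Npos by (simp add: dft_def norm_divide divide_le_eq)
  qed auto
  also have "\<dots> = e\<^sup>2 * ((\<Sum>n<N. (norm (v (int n)))\<^sup>2) / N)"
    by (simp add: dft_parseval[OF Npos] flip: sum_distrib_left)
  also have "(\<Sum>n<N. (norm (v (int n)))\<^sup>2) / N \<le> B\<^sup>2"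
  proof -
    have "(\<Sum>n<N. (norm (v (int n)))\<^sup>2) \<le> (\<Sum>n<N. B\<^sup>2)"
      using B by (intro sum_mono power_mono) (auto simp: v_def)
    then show ?thesis using Npos by (simp add: divide_le_eq mult.commute)
  qed
  finally have "N * (b/4)\<^sup>2 \<le> card T * (N * (e\<^sup>2 * B\<^sup>2))" 
    by (simp add: mult_left_mono)
  then have "(b/4)\<^sup>2 \<le> card T * (e\<^sup>2 * B\<^sup>2)" using Npos by (simp add: algebra_simps)
  also have "\<dots> = (b/8)\<^sup>2 / card T" using B T0 by (simp add: e_def power2_eq_square field_simps)
  also have "\<dots> \<le> (b/8)\<^sup>2" using T0 by (simp add: divide_le_eq mult_le_cancel_left1)
  finally have "b/4 \<le> b/8" using b by (intro power2_le_imp_le[of "b/4" "b/8"]) auto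
  with b show False by simp
qed

section \<open>Characters\<close>

lemma finite_colour_bounded:
  fixes \<phi> :: "'a \<Rightarrow> complex"
  assumes B: "\<And>t. norm (\<phi> t) \<le> B" and e: "e > 0"
  shows "\<exists>c::'a \<Rightarrow> int \<times> int. finite (range c) \<and> (\<forall>t t'. c t = c t' \<longrightarrow> norm (\<phi> t - \<phi> t') < e)"
proof -
  \<comment> \<open>Two points in one grid cell of this side differ by less than e/2 in each
    coordinate, and \<open>cmod_le\<close> adds the two.\<close>
  define d where "d = e / 2"
  have d: "d > 0" using e by (simp add: d_def)
  define c where "c t = (\<lfloor>Re (\<phi> t) / d\<rfloor>, \<lfloor>Im (\<phi> t) / d\<rfloor>)" for t
  define M where "M = \<lceil>B / d\<rceil> + 1"
  have fl: "\<lfloor>a / d\<rfloor> \<in> {- M..M}" if "\<bar>a\<bar> \<le> B" for a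
  proof -
    have "\<bar>a / d\<bar> \<le> B / d" using that d by (simp add: divide_right_mono)
    then show ?thesis unfolding M_def atLeastAtMost_iff by linarith
  qed
  have "range c \<subseteq> {- M..M} \<times> {- M..M}"
    using fl abs_Re_le_cmod abs_Im_le_cmod B order_trans unfolding c_def by blast
  then have fin: "finite (range c)" by (rule finite_subset) simp
  have flr: "\<bar>a - b\<bar> < d" if "\<lfloor>a / d\<rfloor> = \<lfloor>b / d\<rfloor>" for a b
  proof -
    have "\<bar>a / d - b / d\<bar> < 1" using that by linarith
    then show ?thesis using d by (simp add: abs_divide divide_less_eq flip: diff_divide_distrib)
  qed
  have "norm (\<phi> t - \<phi> t') < e" if "c t = c t'" for t t'
  proof -
    have "\<bar>Re (\<phi> t - \<phi> t')\<bar> < d" "\<bar>Im (\<phi> t - \<phi> t')\<bar> < d" using that flr by (auto simp: c_def)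
    then show ?thesis using cmod_le[of "\<phi> t - \<phi> t'"] by (simp add: d_def)
  qed
  with fin show ?thesis by blast
qed

lemma ap_character:
  fixes \<xi> :: "'a::ab_group_add \<Rightarrow> complex"
  assumes "\<And>x y. \<xi> (x + y) = \<xi> x * \<xi> y" "\<And>x. norm (\<xi> x) = 1"
  shows "ap \<xi>"
proof (rule uapI)
  fix e :: real assume "e > 0"
  then obtain c :: "'a \<Rightarrow> int \<times> int" where "finite (range c)" "\<forall>t t'. c t = c t' \<longrightarrow> norm (\<xi> t - \<xi> t') < e"
    using finite_colour_bounded[of \<xi> 1 e] assms(2) by auto
  then show "\<exists>c::'a \<Rightarrow> int \<times> int. finite (range c) \<and>
     (\<forall>t t'. c t = c t' \<longrightarrow> (\<forall>k\<in>UNIV::unit set. \<forall>x. norm (\<xi> (x + t) - \<xi> (x + t')) < e))"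
    using assms by (intro exI[of _ c]) (simp add: norm_mult flip: right_diff_distrib)
qed

definition chr :: "'v::real_inner \<Rightarrow> 'v \<Rightarrow> complex" where
  "chr l x = cis (l \<bullet> x)"

lemma chr_add: "chr l (x + y) = chr l x * chr l y"
  by (simp add: chr_def inner_add_right cis_mult)

lemma chr_add_left: "chr (l + l') x = chr l x * chr l' x"
  by (simp add: chr_def inner_add_left cis_mult)

lemma norm_chr [simp]: "norm (chr l x) = 1"
  by (simp add: chr_def)

lemma chr_nonzero [simp]: "chr l x \<noteq> 0"
  by (simp add: chr_def)

lemma chr_0 [simp]: "chr 0 x = 1" "chr l 0 = 1"
  by (simp_all add: chr_def)

lemma chr_minus: "chr (- l) x = cnj (chr l x)"
  by (simp add: chr_def cis_cnj)

lemma chr_minus_mult [simp]: "chr (- l) x * chr l x = 1" "chr l x * chr (- l) x = 1"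
  by (simp_all add: chr_def cis_mult)

lemma Re_chr: "Re (chr l x) = cos (l \<bullet> x)"
  by (simp add: chr_def)

lemma norm_chr_minus_1: "(norm (chr l x - 1))\<^sup>2 = 2 * (1 - cos (l \<bullet> x))"
proof -
  have "(norm (chr l x - 1))\<^sup>2 = (cos (l \<bullet> x) - 1)\<^sup>2 + (sin (l \<bullet> x))\<^sup>2"
    by (simp add: cmod_power2 chr_def)
  also have "\<dots> = 2 * (1 - cos (l \<bullet> x))"
    using sin_cos_squared_add[of "l \<bullet> x"] by (simp add: power2_eq_square algebra_simps)
  finally show ?thesis .
qed

lemma continuous_on_chr: "continuous_on S (chr l)"
  unfolding chr_def by (intro continuous_intros)

lemma ap_chr: "ap (chr l)"
  by (intro ap_character chr_add norm_chr)

lemma is_mean_chr: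
  assumes "l \<noteq> 0" shows "is_mean (chr l) 0"
proof -
  obtain m where m: "is_mean (chr l) m" using ap_mean[OF ap_chr] by blast
  \<comment> \<open>Half a period in the direction of \<open>l\<close>: this translation turns the
    character into its negative, so the mean equals its own negative.\<close>
  define a where "a = (pi / (l \<bullet> l)) *\<^sub>R l"
  have a: "chr l a = -1" using assms by (simp add: chr_def a_def)
  have "is_mean (\<lambda>x. chr l (x + a)) m" by (rule is_mean_shift[OF m])
  moreover have "is_mean (\<lambda>x. (-1) * chr l x) (-1 * m)" by (rule is_mean_cmult[OF m])
  moreover have "(\<lambda>x. chr l (x + a)) = (\<lambda>x. (-1) * chr l x)" by (simp add: chr_add a)
  ultimately have "m = - 1 * m" using is_mean_unique by metis
  then show ?thesis using m by simp
qed

text \<open>The kernel \<kappa> is a trigonometric polynomial with frequencies 0 and plus or minus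
  the elements of \<open>S\<close>. Multiplying by \<kappa> therefore moves a frequency
  \<open>\<mu>\<close> by at most one step within \<open>\<Gamma>\<close>, and induction on N gives
  the vanishing mean of \<psi> \<kappa>^N that \<open>concentration\<close> requires.\<close>

lemma chr_concentration:
  fixes S \<Gamma> :: "'v::real_inner set"
  assumes "finite S" "ap \<psi>" "0 \<in> \<Gamma>"
    and \<Gamma>: "\<And>\<mu> l. \<mu> \<in> \<Gamma> \<Longrightarrow> l \<in> S \<Longrightarrow> \<mu> + l \<in> \<Gamma>" "\<And>\<mu> l. \<mu> \<in> \<Gamma> \<Longrightarrow> l \<in> S \<Longrightarrow> \<mu> - l \<in> \<Gamma>"
    and mean0: "\<And>\<mu>. \<mu> \<in> \<Gamma> \<Longrightarrow> is_mean (\<lambda>x. \<psi> x * chr \<mu> x) 0"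
    and "\<delta> > 0"
  obtains t where "\<And>l. l \<in> S \<Longrightarrow> 1 - cos (l \<bullet> t) < \<delta>" "Re (\<psi> t) < 1/2"
proof -
  \<comment> \<open>Normalized so that \<kappa> stays between 0 and 1; the summand 1 covers empty
    \<open>S\<close>.\<close>
  define q where "q = 1 / (real (card S) + 1)"
  have q: "q > 0" "q * card S \<le> 1" by (simp_all add: q_def divide_le_eq)
  define \<kappa> where "\<kappa> x = 1 - q * (\<Sum>l\<in>S. (1 - cos (l \<bullet> x)) / 2)" for x
  have cos_chr: "of_real (cos (l \<bullet> x)) = (chr l x + chr (- l) x) / 2" for l x :: 'v
    by (simp add: chr_def complex_eq_iff)
  have \<kappa>_chr: "of_real (\<kappa> x) = 1 - of_real q * (\<Sum>l\<in>S. 1/2 - (chr l x + chr (- l) x) / 4)" for x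
    by (simp add: \<kappa>_def cos_chr algebra_simps diff_divide_distrib add_divide_distrib)
  have ap\<kappa>: "ap (\<lambda>x. of_real (\<kappa> x))"
  proof -
    have "ap (\<lambda>x. 1/2 - (1/4) * (chr l x + chr (- l) x))" for l :: 'v
      by (intro ap_diff ap_cmult uap_const uap_add[where K = "UNIV::unit set"] ap_chr)
    then have "ap (\<lambda>x. 1 - of_real q * (\<Sum>l\<in>S. 1/2 - (1/4) * (chr l x + chr (- l) x)))"
      by (rule ap_diff[OF uap_const ap_cmult[OF ap_sum]])
    then show ?thesis unfolding \<kappa>_chr by simp
  qed
  have rng: "0 \<le> (1 - cos (l \<bullet> x)) / 2" "(1 - cos (l \<bullet> x)) / 2 \<le> 1" for l x :: 'v
    using cos_le_one[of "l \<bullet> x"] cos_ge_minus_one[of "l \<bullet> x"] by simp_all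
  have \<kappa>1: "\<kappa> x \<le> 1" for x unfolding \<kappa>_def using q rng by (simp add: sum_nonneg)
  have \<kappa>0: "0 \<le> \<kappa> x" for x
  proof -
    have "(\<Sum>l\<in>S. (1 - cos (l \<bullet> x)) / 2) \<le> (\<Sum>l\<in>S. 1)" by (intro sum_mono rng)
    then have "q * (\<Sum>l\<in>S. (1 - cos (l \<bullet> x)) / 2) \<le> q * card S" using q by (intro mult_left_mono) auto
    then show ?thesis using q unfolding \<kappa>_def by linarith
  qed
  have mean: "\<forall>\<mu>\<in>\<Gamma>. is_mean (\<lambda>x. \<psi> x * chr \<mu> x * of_real (\<kappa> x) ^ N) 0" for N
  proof (induction N)
    case (Suc N)
    show ?case
    proof
      fix \<mu> assume \<mu>: "\<mu> \<in> \<Gamma>"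
      define g where "g \<nu> x = \<psi> x * chr \<nu> x * of_real (\<kappa> x) ^ N" for \<nu> x
      have g: "is_mean (g \<nu>) 0" if "\<nu> \<in> \<Gamma>" for \<nu> using Suc that unfolding g_def by blast
      have "is_mean (\<lambda>x. g \<mu> x - of_real q * (\<Sum>l\<in>S. (1/2) * g \<mu> x - (1/4) * (g (\<mu> + l) x + g (\<mu> - l) x)))
         (0 - of_real q * (\<Sum>l\<in>S. (1/2) * 0 - (1/4) * (0 + 0)))"
        by (intro is_mean_diff is_mean_cmult is_mean_sum is_mean_add g \<mu> \<Gamma>)
      moreover have "g \<mu> x - of_real q * (\<Sum>l\<in>S. (1/2) * g \<mu> x - (1/4) * (g (\<mu> + l) x + g (\<mu> - l) x))
        = \<psi> x * chr \<mu> x * of_real (\<kappa> x) ^ Suc N" for x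
      proof -
        have "g (\<mu> + l) x = g \<mu> x * chr l x" "g (\<mu> - l) x = g \<mu> x * chr (- l) x" for l
          using chr_add_left[of \<mu> "- l" x] by (simp_all add: g_def chr_add_left mult_ac)
        then have "(\<Sum>l\<in>S. (1/2) * g \<mu> x - (1/4) * (g (\<mu> + l) x + g (\<mu> - l) x))
          = g \<mu> x * (\<Sum>l\<in>S. 1/2 - (chr l x + chr (- l) x) / 4)"
          unfolding sum_distrib_left by (intro sum.cong refl) (simp add: algebra_simps)
        then have "g \<mu> x - of_real q * (\<Sum>l\<in>S. (1/2) * g \<mu> x - (1/4) * (g (\<mu> + l) x + g (\<mu> - l) x))
          = g \<mu> x * of_real (\<kappa> x)" unfolding \<kappa>_chr by (simp add: algebra_simps)
        then show ?thesis by (simp add: g_def mult_ac)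
      qed
      ultimately show "is_mean (\<lambda>x. \<psi> x * chr \<mu> x * of_real (\<kappa> x) ^ Suc N) 0" by simp
    qed
  qed (use mean0 in simp)
  have mean': "is_mean (\<lambda>x. \<psi> x * of_real (\<kappa> x) ^ N) 0" for N
    using bspec[OF mean[of N] assms(3)] by simp
  \<comment> \<open>Each nonnegative summand of 1 - \<kappa> is at most the whole, so \<kappa> t > 1
    - q \<delta> / 2 bounds every single 1 - cos (l \<bullet> t) by \<delta>.\<close>
  have \<eta>: "q * \<delta> / 2 > 0" using q \<open>\<delta> > 0\<close> by simp
  obtain t where t: "\<kappa> t > 1 - q * \<delta> / 2" "Re (\<psi> t) < 1/2"
    by (rule concentration[OF ap\<kappa> assms(2) \<kappa>0 \<kappa>1 _ mean' \<eta>]) (auto simp: \<kappa>_def)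
  have "1 - cos (l \<bullet> t) < \<delta>" if "l \<in> S" for l
  proof -
    have "(1 - cos (l \<bullet> t)) / 2 \<le> (\<Sum>l\<in>S. (1 - cos (l \<bullet> t)) / 2)"
      by (rule member_le_sum[where f = "\<lambda>l. (1 - cos (l \<bullet> t)) / 2"]) (use that assms(1) rng in auto)
    then have "q * ((1 - cos (l \<bullet> t)) / 2) \<le> q * (\<Sum>l\<in>S. (1 - cos (l \<bullet> t)) / 2)"
      using q by (intro mult_left_mono) auto
    also have "\<dots> < q * \<delta> / 2" using t(1) by (simp add: \<kappa>_def)
    finally show ?thesis using q by simp
  qed
  then show ?thesis using t(2) that by blast
qed

text \<open>
  The eigenfunction is the mean of \<open>u (x + n a) w\<^sup>n\<close> over the integers \<open>n\<close>, for a \<open>w\<close> for which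
  this mean does not vanish at \<open>x0\<close>.
\<close>

lemma eigen_step:
  fixes u :: "'v::real_inner \<Rightarrow> complex"
  assumes "ap u" "continuous_on UNIV u" "u x0 \<noteq> 0"
  shows "\<exists>H w. norm w = 1 \<and> ap H \<and> continuous_on UNIV H \<and> H x0 \<noteq> 0 \<and> (\<forall>x. H (x + a) = w * H x) \<and>
    (\<forall>l. is_mean (\<lambda>x. u x * chr l x) 0 \<longrightarrow> is_mean (\<lambda>x. H x * chr l x) 0) \<and>
    (\<forall>b w'. (\<forall>x. u (x + b) = w' * u x) \<longrightarrow> (\<forall>x. H (x + b) = w' * H x))"
proof -
  obtain B where B: "B > 0" "\<And>x. norm (u x) \<le> B" using ap_bounded[OF assms(1)] by blast
  define B1 where "B1 = max B 1"
  define U where "U x n = u (x + of_int n *\<^sub>R a)" for x n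
  have uapU: "uap UNIV U"
    unfolding uap_def
  proof (intro allI impI)
    fix e :: real assume "e > 0"
    then obtain c :: "'v \<Rightarrow> nat" where c: "finite (range c)"
      "\<And>t t' k x. c t = c t' \<Longrightarrow> k \<in> (UNIV::unit set) \<Longrightarrow> norm (u (x + t) - u (x + t')) < e"
      using uapE[OF assms(1)] by blast
    have "range (\<lambda>n. c (of_int n *\<^sub>R a)) \<subseteq> range c" for a :: 'v by auto
    then have "finite (range (\<lambda>n. c (of_int n *\<^sub>R a)))" using c(1) finite_subset by blast
    moreover have "norm (U k (n + t) - U k (n + t')) < e"
      if "c (of_int t *\<^sub>R a) = c (of_int t' *\<^sub>R a)" for k n t t'
      using c(2)[OF that UNIV_I, of "k + of_int n *\<^sub>R a"] by (simp add: U_def scaleR_add_left add.assoc)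
    ultimately show "\<exists>c::int \<Rightarrow> nat. finite (range c) \<and>
     (\<forall>t t'. c t = c t' \<longrightarrow> (\<forall>k\<in>UNIV. \<forall>x. norm (U k (x + t) - U k (x + t')) < e))"
      by (intro exI[of _ "\<lambda>n. c (of_int n *\<^sub>R a)"]) blast
  qed
  \<comment> \<open>Uniqueness for sequences is used at the single point \<open>x0\<close>; the same
    \<open>w\<close> then serves all \<open>x\<close>.\<close>
  have "\<exists>w. norm w = 1 \<and> \<not> is_mean (\<lambda>n. U x0 n * w powi n) 0"
  proof (rule ccontr)
    assume "\<not> ?thesis"
    then have "U x0 0 = 0" by (intro ap_int_eq_0 uap_slice[OF uapU]) auto
    then show False using assms(3) by (simp add: U_def)
  qed
  then obtain w where w: "norm w = 1" "\<not> is_mean (\<lambda>n. U x0 n * w powi n) 0" by blast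
  have w0: "w \<noteq> 0" using w by auto
  define F where "F x n = U x n * w powi n" for x n
  have apw: "ap (\<lambda>n::int. w powi n)"
    by (rule ap_character) (simp_all add: power_int_add w0 norm_power_int w)
  have uapw: "uap (UNIV::'v set) (\<lambda>_ n::int. w powi n)" by (rule uap_map[OF apw]) auto
  have uapF: "uap UNIV F"
    unfolding F_def
  proof (rule uap_mult[OF uapU uapw])
    show "norm (U x n) \<le> B1" for x n unfolding B1_def U_def by (rule order_trans[OF B(2) max.cobounded1])
    show "norm (w powi n) \<le> B1" for n by (simp add: B1_def norm_power_int w)
  qed
  have FB: "norm (F x n) \<le> B" for x n using B(2) by (simp add: F_def U_def norm_mult norm_power_int w)
  from uap_mean[OF uapF FB]
  obtain H where H': "\<forall>e>0. \<exists>ts. ts \<noteq> [] \<and> (\<forall>k\<in>UNIV. \<forall>x. norm (avg ts (F k) x - H k) \<le> e)"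
    "\<forall>k\<in>UNIV. is_mean (F k) (H k)"
    by (elim exE conjE)
  have H: "is_mean (F k) (H k)" for k using H'(2) by blast
  have "\<forall>n. \<exists>ts. ts \<noteq> [] \<and> (\<forall>x. norm (avg ts (F x) 0 - H x) \<le> 1 / Suc n)"
  proof
    fix n
    have "1 / real (Suc n) > 0" by simp
    then show "\<exists>ts. ts \<noteq> [] \<and> (\<forall>x. norm (avg ts (F x) 0 - H x) \<le> 1 / Suc n)" using H'(1)[rule_format, of "1 / real (Suc n)"]
      by (auto simp del: of_nat_Suc)
  qed
  then obtain ts where ts: "\<And>n. ts n \<noteq> []" "\<And>n x. norm (avg (ts n) (F x) 0 - H x) \<le> 1 / Suc n"
    by metis
  \<comment> \<open>Finite combinations of translates of \<open>u\<close> that converge to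
    \<open>H\<close> uniformly in \<open>x\<close>; almost periodicity, continuity and vanishing
    means pass to the limit through them.\<close>
  define P where "P n x = avg (ts n) (F x) 0" for n x
  have P_eq: "P n x = (\<Sum>i<length (ts n). (w powi (ts n ! i) / of_nat (length (ts n))) * u (x + of_int (ts n ! i) *\<^sub>R a))" for n x
  proof -
    have "(\<Sum>t\<leftarrow>ts n. F x t) = (\<Sum>i<length (ts n). F x (ts n ! i))"
      by (simp add: sum_list_sum_nth atLeast0LessThan)
    then show ?thesis by (simp add: P_def avg_def F_def U_def sum_divide_distrib mult_ac)
  qed
  have app: "\<exists>n. \<forall>x. norm (P n x - H x) \<le> e" if "e > 0" for e
  proof -
    obtain n where "1 / real (Suc n) < e" using nat_approx_posE[OF \<open>e > 0\<close>] by blast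
    then have "norm (P n x - H x) \<le> e" for x using ts(2)[of n x] unfolding P_def by linarith
    then show ?thesis by blast
  qed
  have apP: "ap (P n)" for n
    unfolding P_eq by (intro ap_sum ap_cmult uap_shift[OF assms(1)])
  have apH: "ap H" by (rule uap_uniform_limit[where F = "\<lambda>n _. P n"]) (use apP app in auto)
  have contP: "continuous_on UNIV (P n)" for n
    unfolding P_eq by (intro continuous_intros continuous_on_compose2[OF assms(2)]) auto
  have "uniform_limit UNIV P H sequentially"
  proof (rule uniform_limitI)
    fix e :: real assume "e > 0"
    then obtain N where N: "1 / real (Suc N) < e" using nat_approx_posE by blast
    have "dist (P n x) (H x) < e" if "n \<ge> N" for n x
    proof -
      have "1 / real (Suc n) \<le> 1 / real (Suc N)" using that by (simp add: field_simps)
      then show ?thesis using ts(2)[of n x] N unfolding P_def dist_norm by linarith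
    qed
    then show "\<forall>\<^sub>F n in sequentially. \<forall>x\<in>UNIV. dist (P n x) (H x) < e"
      using eventually_sequentially by blast
  qed
  then have contH: "continuous_on UNIV H"
    by (rule uniform_limit_theorem[rotated]) (simp_all add: contP)
  have H0: "H x0 \<noteq> 0" using w(2) H[of x0] unfolding F_def by auto
  \<comment> \<open>Moving \<open>x\<close> by \<open>a\<close> shifts the index \<open>n\<close> by
    one, which the mean does not see.\<close>
  have Ha: "H (x + a) = inverse w * H x" for x
  proof -
    have "F (x + a) n = inverse w * F x (n + 1)" for n
      by (simp add: F_def U_def power_int_add w0 algebra_simps)
    then have "F (x + a) = (\<lambda>n. inverse w * F x (n + 1))" by (rule ext)
    then have "is_mean (F (x + a)) (inverse w * H x)"
      using is_mean_cmult[OF is_mean_shift[OF H[of x], of 1], of "inverse w"] by simp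
    then show ?thesis using is_mean_unique[OF H] by blast
  qed
  have mean: "is_mean (\<lambda>x. H x * chr l x) 0" if l: "is_mean (\<lambda>x. u x * chr l x) 0" for l
  proof -
    have P0: "is_mean (\<lambda>x. P n x * chr l x) 0" for n
    proof -
      have sh: "is_mean (\<lambda>x. u (x + b) * chr l x) 0" for b
      proof -
        have "is_mean (\<lambda>x. chr (- l) b * (u (x + b) * chr l (x + b))) (chr (- l) b * 0)"
          by (intro is_mean_cmult is_mean_shift[OF l])
        moreover have "chr (- l) b * (u (x + b) * chr l (x + b)) = u (x + b) * chr l x" for x
          using chr_minus_mult(1)[of l b] by (simp add: chr_add algebra_simps)
        ultimately show ?thesis by simp
      qed
      have "is_mean (\<lambda>x. \<Sum>i<length (ts n). (w powi (ts n ! i) / of_nat (length (ts n))) * (u (x + of_int (ts n ! i) *\<^sub>R a) * chr l x))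
         (\<Sum>i<length (ts n). (w powi (ts n ! i) / of_nat (length (ts n))) * 0)"
        by (intro is_mean_sum is_mean_cmult sh)
      then show ?thesis unfolding P_eq by (simp add: sum_distrib_right mult.assoc)
    qed
    obtain m where m: "is_mean (\<lambda>x. H x * chr l x) m" using ap_mean[OF ap_mult[OF apH ap_chr]] by blast
    have small: "norm m \<le> e" if e: "e > 0" for e
    proof -
      obtain n where n: "\<And>x. norm (P n x - H x) \<le> e" using app[OF e] by blast
      have "norm (H x * chr l x - P n x * chr l x) \<le> e" for x
        using n[of x] by (simp add: norm_mult norm_minus_commute flip: left_diff_distrib)
      then show ?thesis using is_mean_dist[OF m P0[of n], of e] by simp
    qed
    have "m = 0"
    proof (rule ccontr)
      assume "m \<noteq> 0"
      then show False using small[of "norm m / 2"] by simp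
    qed
    then show ?thesis using m by simp
  qed
  have eig: "H (x + b) = w' * H x" if "\<And>x. u (x + b) = w' * u x" for b w' x
  proof -
    have "F (x + b) n = w' * F x n" for n
      using that[of "x + of_int n *\<^sub>R a"] by (simp add: F_def U_def add_ac)
    then have "F (x + b) = (\<lambda>n. w' * F x n)" by (rule ext)
    then have "is_mean (F (x + b)) (w' * H x)"
      using is_mean_cmult[OF H[of x], of w'] by simp
    then show ?thesis using is_mean_unique[OF H] by blast
  qed
  have "norm (inverse w) = 1" using w(1) by (simp add: norm_inverse)
  with apH contH H0 Ha mean eig show ?thesis
    by (intro exI[of _ H] exI[of _ "inverse w"]) simp
qed

section \<open>Uniqueness for almost periodic functions\<close>

text \<open>In the iteration of \<open>eigen_step\<close> over \<open>A\<close>, its last clause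
  preserves the eigenvalues found earlier, and nonvanishing at the same \<open>x0\<close> allows the
  next step.\<close>

lemma joint_eigenfunction:
  fixes u :: "'v::euclidean_space \<Rightarrow> complex"
  assumes "ap u" "continuous_on UNIV u" "u x0 \<noteq> 0" "finite A"
    and mean0: "\<And>l. is_mean (\<lambda>x. u x * chr l x) 0"
  shows "\<exists>H w. ap H \<and> continuous_on UNIV H \<and> H x0 \<noteq> 0 \<and> (\<forall>a\<in>A. norm (w a) = 1 \<and> (\<forall>x. H (x + a) = w a * H x)) \<and>
    (\<forall>l. is_mean (\<lambda>x. H x * chr l x) (0::complex))"
  using assms(4)
proof induction
  case empty
  show ?case using assms by auto
next
  case (insert a A)
  then obtain H w where H: "ap H" "continuous_on UNIV H" "H x0 \<noteq> 0"
    "\<And>a. a \<in> A \<Longrightarrow> norm (w a) = 1" "\<And>a x. a \<in> A \<Longrightarrow> H (x + a) = w a * H x"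
    "\<And>l. is_mean (\<lambda>x. H x * chr l x) (0::complex)" by blast
  from eigen_step[OF H(1-3), of a]
  obtain H' w' where H': "norm w' = 1" "ap H'" "continuous_on UNIV H'" "H' x0 \<noteq> 0" "\<forall>x. H' (x + a) = w' * H' x"
    "\<forall>l. is_mean (\<lambda>x. H x * chr l x) 0 \<longrightarrow> is_mean (\<lambda>x. H' x * chr l x) 0"
    "\<forall>b w'. (\<forall>x. H (x + b) = w' * H x) \<longrightarrow> (\<forall>x. H' (x + b) = w' * H' x)"
    by (elim exE conjE)
  have "H' (x + b) = (if b = a then w' else w b) * H' x" if "b \<in> insert a A" for b x
    using that H'(5) H'(7)[rule_format, of b "w b" x] H(5)[of b] by (cases "b = a") auto
  moreover have "norm (if b = a then w' else w b) = 1" if "b \<in> insert a A" for b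
    using that H'(1) H(4) by auto
  ultimately show ?case
    by (intro exI[of _ H'] exI[of _ "\<lambda>b. if b = a then w' else w b"] conjI ballI allI
        H'(2,3,4) H'(6)[rule_format, OF H(6)])
qed

lemma periodic_int_combination:
  fixes \<psi> :: "'v::real_vector \<Rightarrow> 'b" and n :: "'v \<Rightarrow> int"
  assumes per: "\<And>a x. a \<in> A \<Longrightarrow> \<psi> (x + a) = \<psi> x" and "finite A"
  shows "\<psi> (x + (\<Sum>a\<in>A. of_int (n a) *\<^sub>R a)) = \<psi> x"
  using assms(2) subset_refl[of A]
proof (induction A arbitrary: x rule: finite_subset_induct')
  case (insert a F)
  have "\<psi> (y + of_int k *\<^sub>R a) = \<psi> y" for y and k :: int
  proof (induction k rule: int_induct[where k = 0])
    case (step1 i)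
    then show ?case using per[OF \<open>a \<in> A\<close>, of "y + of_int i *\<^sub>R a"] by (simp add: algebra_simps)
  next
    case (step2 i)
    then show ?case using per[OF \<open>a \<in> A\<close>, of "y + of_int (i - 1) *\<^sub>R a"] by (simp add: algebra_simps)
  qed simp
  from this[of "x + (\<Sum>a\<in>F. of_int (n a) *\<^sub>R a)" "n a"] insert show ?case
    by (simp add: add_ac)
qed simp

text \<open>The joint eigenfunction for the basis translations, divided by the character with the
  same eigenvalues, is periodic under the integer lattice and still has vanishing means.
  Concentration on the characters of frequency 2 pi b yields a point near the lattice where it is
  far from its value 1 at the origin, against continuity.\<close>

theorem ap_eq_0:
  fixes u :: "'v::euclidean_space \<Rightarrow> complex"
  assumes "ap u" "continuous_on UNIV u" and mean0: "\<And>l. is_mean (\<lambda>x. u x * chr l x) 0"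
  shows "u x0 = 0"
proof (rule ccontr)
  assume "u x0 \<noteq> 0"
  then obtain H w where H: "ap H" "continuous_on UNIV H" "H x0 \<noteq> 0"
    "\<And>a. a \<in> Basis \<Longrightarrow> norm (w a) = 1" "\<And>a x. a \<in> Basis \<Longrightarrow> H (x + a) = w a * H x"
    "\<And>l. is_mean (\<lambda>x. H x * chr l x) (0::complex)"
    using joint_eigenfunction[OF assms(1,2) _ finite_Basis mean0] by blast
  define \<theta> where "\<theta> = (\<Sum>b\<in>Basis. Arg (w b) *\<^sub>R b)"
  have chr\<theta>: "chr \<theta> b = w b" if "b \<in> Basis" for b
  proof -
    have "\<theta> \<bullet> b = Arg (w b)" using that by (simp add: \<theta>_def)
    then show ?thesis using H(4)[OF that] by (simp add: chr_def cis_Arg) (metis cis_Arg norm_zero sgn_eq zero_neq_one div_by_1 of_real_1)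
  qed
  define \<psi> where "\<psi> x = (1 / H x0) * (H (x + x0) * chr (- \<theta>) x)" for x
  have ap\<psi>: "ap \<psi>" unfolding \<psi>_def by (intro ap_cmult ap_mult uap_shift[OF H(1)] ap_chr)
  have per: "\<psi> (x + b) = \<psi> x" if "b \<in> Basis" for b x
  proof -
    have "H (x + b + x0) = w b * H (x + x0)" using H(5)[OF that, of "x + x0"] by (simp add: add_ac)
    moreover have "w b * chr (- \<theta>) b = 1" using chr\<theta>[OF that] chr_minus_mult(2) by metis
    ultimately have "H (x + b + x0) * chr (- \<theta>) (x + b) = H (x + x0) * chr (- \<theta>) x"
      by (simp add: chr_add algebra_simps)
    then show ?thesis by (simp add: \<psi>_def)
  qed
  have mean\<psi>: "is_mean (\<lambda>x. \<psi> x * chr \<mu> x) 0" for \<mu>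
  proof -
    have "is_mean (\<lambda>x. H (x + x0) * chr (\<mu> - \<theta>) (x + x0)) 0" by (rule is_mean_shift[OF H(6)])
    from is_mean_cmult[OF this, of "chr (\<theta> - \<mu>) x0 / H x0"]
    have "is_mean (\<lambda>x. (chr (\<theta> - \<mu>) x0 / H x0) * (H (x + x0) * chr (\<mu> - \<theta>) (x + x0))) 0" by simp
    moreover have "(chr (\<theta> - \<mu>) x0 / H x0) * (H (x + x0) * chr (\<mu> - \<theta>) (x + x0)) = \<psi> x * chr \<mu> x" for x
    proof -
      have "chr (\<theta> - \<mu>) x0 * chr (\<mu> - \<theta>) (x + x0) = chr (\<mu> - \<theta>) x"
        using chr_minus_mult(2)[of "\<theta> - \<mu>" x0] by (simp add: chr_add algebra_simps)
      also have "\<dots> = chr (- \<theta>) x * chr \<mu> x" using chr_add_left[of "- \<theta>" \<mu> x] by simp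
      finally show ?thesis by (simp add: \<psi>_def)
    qed
    ultimately show ?thesis by simp
  qed
  have cont\<psi>: "continuous_on UNIV \<psi>"
    unfolding \<psi>_def by (intro continuous_intros continuous_on_chr continuous_on_compose2[OF H(2)]) auto
  have "\<psi> 0 = 1" using H(3) by (simp add: \<psi>_def)
  have "isCont \<psi> 0" using cont\<psi> by (simp add: continuous_on_eq_continuous_at)
  then obtain d where d: "d > 0" "\<And>x. norm x < d \<Longrightarrow> norm (\<psi> x - 1) < 1/2"
    unfolding continuous_at_eps_delta using \<open>\<psi> 0 = 1\<close>
    by (metis dist_0_norm dist_commute dist_norm half_gt_zero_iff zero_less_one)
  \<comment> \<open>At most 1/2, to keep 2 pi r where cosine is monotone; the other bound makes a
    vector whose coordinates have modulus at most \<open>r\<close> shorter than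
    \<open>d\<close>.\<close>
  define r where "r = min (1/2) (d / (2 * DIM('v)))"
  have r: "0 < r" "r \<le> 1/2" "DIM('v) * r < d"
  proof -
    have "r \<le> d / (2 * DIM('v))" by (simp add: r_def)
    then have "DIM('v) * r \<le> d / 2" by (simp add: field_simps)
    with d show "DIM('v) * r < d" by simp
  qed (use d in \<open>auto simp: r_def\<close>)
  \<comment> \<open>If 1 - cos (2 pi b \<bullet> t) is below this, the coordinate of
    \<open>t\<close> along \<open>b\<close> is within \<open>r\<close> of an integer.\<close>
  define \<delta> where "\<delta> = 1 - cos (2 * pi * r)"
  have "2 * pi * r \<le> pi" using r by simp
  then have "cos (2 * pi * r) < cos 0" using r by (intro cos_monotone_0_pi) auto
  then have \<delta>: "\<delta> > 0" by (simp add: \<delta>_def)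
  have fin: "finite ((\<lambda>b::'v. (2 * pi) *\<^sub>R b) ` Basis)" by simp
  obtain t where t: "\<And>l. l \<in> (\<lambda>b::'v. (2 * pi) *\<^sub>R b) ` Basis \<Longrightarrow> 1 - cos (l \<bullet> t) < \<delta>" "Re (\<psi> t) < 1/2"
    by (rule chr_concentration[OF fin ap\<psi> UNIV_I UNIV_I UNIV_I mean\<psi> \<delta>]) blast
  define n where "n b = round (t \<bullet> b)" for b
  define s where "s b = t \<bullet> b - of_int (n b)" for b
  have s: "\<bar>s b\<bar> \<le> r" if b: "b \<in> Basis" for b
  proof (rule ccontr)
    assume "\<not> \<bar>s b\<bar> \<le> r"
    moreover have s2: "\<bar>s b\<bar> \<le> 1/2" unfolding s_def n_def using of_int_round_abs_le[of "t \<bullet> b"] by linarith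
    ultimately have "cos (2 * pi * \<bar>s b\<bar>) < cos (2 * pi * r)" using r
      by (intro cos_monotone_0_pi) auto
    moreover have "cos (2 * pi * \<bar>s b\<bar>) = cos (((2 * pi) *\<^sub>R b) \<bullet> t)"
    proof -
      have "cos (2 * pi * \<bar>s b\<bar>) = cos (2 * pi * s b)" by (metis abs_mult abs_numeral abs_of_pos cos_abs_real pi_gt_zero zero_less_numeral mult_pos_pos abs_of_nonneg less_imp_le)
      also have "\<dots> = cos (2 * pi * (t \<bullet> b) - 2 * pi * of_int (n b))" by (simp add: s_def algebra_simps)
      also have "\<dots> = cos (2 * pi * (t \<bullet> b))"
        by (simp add: cos_diff cos_int_2pin sin_int_2pin)
      finally show ?thesis by (simp add: inner_commute)
    qed
    ultimately show False using t(1)[of "(2 * pi) *\<^sub>R b"] b by (simp add: \<delta>_def)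
  qed
  have "t = (\<Sum>b\<in>Basis. s b *\<^sub>R b) + (\<Sum>b\<in>Basis. of_int (n b) *\<^sub>R b)"
    by (simp add: s_def euclidean_representation flip: sum.distrib scaleR_add_left)
  then have "\<psi> t = \<psi> (\<Sum>b\<in>Basis. s b *\<^sub>R b)"
    using periodic_int_combination[of Basis \<psi>, OF per] by simp
  moreover have "norm (\<Sum>b\<in>Basis. s b *\<^sub>R (b::'v)) < d"
  proof -
    have "norm (\<Sum>b\<in>Basis. s b *\<^sub>R (b::'v)) \<le> (\<Sum>b\<in>(Basis::'v set). r)"
      by (intro sum_norm_le) (use s in auto)
    then show ?thesis using r by simp
  qed
  ultimately have "norm (\<psi> t - 1) < 1/2" using d by simp
  then have "\<bar>Re (\<psi> t - 1)\<bar> < 1/2" using abs_Re_le_cmod order.strict_trans1 by blast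
  then have "\<bar>Re (\<psi> t) - 1\<bar> < 1/2" by simp
  then show False using t(2) by linarith
qed

text \<open>Colours at level 1/(n+1) take finitely many values, so they are constant along a
  subsequence; along the diagonal subsequence they are eventually constant for every level, which
  makes it uniformly Cauchy.\<close>

lemma uap_seq_compact:
  fixes F :: "'k \<Rightarrow> 'a::ab_group_add \<Rightarrow> complex" and t :: "nat \<Rightarrow> 'a"
  assumes "uap K F"
  shows "\<exists>(r::nat \<Rightarrow> nat) h. strict_mono r \<and> (\<forall>e>0. \<exists>N. \<forall>n\<ge>N. \<forall>k\<in>K. \<forall>x. norm (F k (x + t (r n)) - h k x) < e)"
proof -
  have "\<forall>n. \<exists>c::'a \<Rightarrow> nat. finite (range c) \<and>
     (\<forall>t t'. c t = c t' \<longrightarrow> (\<forall>k\<in>K. \<forall>x. norm (F k (x + t) - F k (x + t')) < 1 / Suc n))"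
    using assms unfolding uap_def by simp
  then obtain c :: "nat \<Rightarrow> 'a \<Rightarrow> nat" where c: "\<And>n. finite (range (c n))"
     "\<And>n t t' k x. c n t = c n t' \<Longrightarrow> k \<in> K \<Longrightarrow> norm (F k (x + t) - F k (x + t')) < 1 / Suc n"
    by metis
  define P where "P n s \<longleftrightarrow> (\<forall>i j. c n (t (s i)) = c n (t (s j)))" for n and s :: "nat \<Rightarrow> nat"
  have ex: "\<exists>r'. strict_mono r' \<and> P n (s \<circ> r')" for n and s :: "nat \<Rightarrow> nat"
  proof -
    have "range (\<lambda>i. c n (t (s i))) \<subseteq> range (c n)" by auto
    then have fin: "finite (range (\<lambda>i. c n (t (s i))))" using c(1) finite_subset by blast
    obtain i0 where i0: "infinite {i. c n (t (s i)) = c n (t (s i0))}"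
      using pigeonhole_infinite[of UNIV "\<lambda>i. c n (t (s i))"] fin by auto
    define r' where "r' = enumerate {i. c n (t (s i)) = c n (t (s i0))}"
    have "strict_mono r'" unfolding r'_def by (rule strict_mono_enumerate[OF i0])
    moreover have "r' i \<in> {i. c n (t (s i)) = c n (t (s i0))}" for i
      unfolding r'_def by (rule enumerate_in_set[OF i0])
    ultimately show ?thesis unfolding P_def by (intro exI[of _ r']) auto
  qed
  interpret subseqs P by unfold_locales (rule ex)
  define r where "r = diagseq"
  have r: "strict_mono r" unfolding r_def by (rule subseq_diagseq)
  have Pr: "P n (r \<circ> (+) (Suc n))" for n unfolding r_def
    by (rule diagseq_holds) (simp add: P_def)
  have close: "norm (F k (x + t (r i)) - F k (x + t (r j))) < 1 / Suc n" if "i \<ge> Suc n" "j \<ge> Suc n" "k \<in> K" for n i j k x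
  proof (rule c(2)[OF _ that(3)])
    show "c n (t (r i)) = c n (t (r j))"
      using Pr[of n] that(1,2) unfolding P_def o_def by (metis le_add_diff_inverse)
  qed
  define G where "G n p = F (fst p) (snd p + t (r n))" for n p
  have "uniformly_convergent_on (K \<times> UNIV) G"
  proof (rule Cauchy_uniformly_convergent, unfold uniformly_Cauchy_on_def, intro allI impI)
    fix e :: real assume "e > 0"
    then obtain n where n: "1 / real (Suc n) < e" using nat_approx_posE by blast
    have "dist (G i p) (G j p) < e" if "p \<in> K \<times> UNIV" "i \<ge> Suc n" "j \<ge> Suc n" for p i j
      using close[of n i j "fst p" "snd p"] that n by (auto simp: G_def dist_norm)
    then show "\<exists>M. \<forall>x\<in>K \<times> UNIV. \<forall>m\<ge>M. \<forall>n\<ge>M. dist (G m x) (G n x) < e" by blast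
  qed
  then obtain h where h: "uniform_limit (K \<times> UNIV) G h sequentially"
    by (auto simp: uniformly_convergent_on_def)
  have lim: "\<exists>N. \<forall>n\<ge>N. \<forall>k\<in>K. \<forall>x. norm (F k (x + t (r n)) - h (k, x)) < e" if "e > 0" for e
  proof -
    obtain N where "\<And>n p. n \<ge> N \<Longrightarrow> p \<in> K \<times> UNIV \<Longrightarrow> dist (G n p) (h p) < e"
      using uniform_limitD[OF h \<open>e > 0\<close>] unfolding eventually_sequentially by blast
    then show ?thesis by (intro exI[of _ N]) (auto simp: G_def dist_norm)
  qed
  show ?thesis
    by (intro exI[of _ r] exI[of _ "\<lambda>k x. h (k, x)"] conjI r allI impI lim)
qed

text \<open>The squared distance from \<open>u\<close> to its partial Fourier sum \<open>P\<close>
  has mean \<open>b - s\<close>, which cannot have negative real part.\<close>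

lemma bessel:
  fixes u :: "'v::real_inner \<Rightarrow> complex"
  assumes "finite S" "\<And>l. l \<in> S \<Longrightarrow> is_mean (\<lambda>x. u x * chr (- l) x) (a l)"
    and b: "is_mean (\<lambda>x. u x * cnj (u x)) b"
  shows "(\<Sum>l\<in>S. (norm (a l))\<^sup>2) \<le> Re b"
proof -
  define P where "P x = (\<Sum>l\<in>S. a l * chr l x)" for x
  define s where "s = (\<Sum>l\<in>S. a l * cnj (a l))"
  have "is_mean (\<lambda>x. \<Sum>l\<in>S. cnj (a l) * (u x * chr (- l) x)) (\<Sum>l\<in>S. cnj (a l) * a l)"
    by (intro is_mean_sum is_mean_cmult assms)
  then have uP: "is_mean (\<lambda>x. u x * cnj (P x)) s"
    by (simp add: P_def s_def sum_distrib_left chr_minus mult_ac)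
  have "is_mean (\<lambda>x. \<Sum>l\<in>S. \<Sum>k\<in>S. (a l * cnj (a k)) * chr (l - k) x)
      (\<Sum>l\<in>S. \<Sum>k\<in>S. (a l * cnj (a k)) * (if l = k then 1 else 0))"
  proof (intro is_mean_sum is_mean_cmult)
    fix l k :: 'v
    show "is_mean (chr (l - k)) (if l = k then 1 else 0)"
    proof (cases "l = k")
      case True
      then have "chr (l - k) = (\<lambda>x. 1)" by (simp add: fun_eq_iff)
      then show ?thesis using True is_mean_const[of 1] by simp
    next
      case False
      then show ?thesis using is_mean_chr[of "l - k"] by simp
    qed
  qed
  moreover have "chr (l - k) x = chr l x * cnj (chr k x)" for l k x :: 'v
    using chr_add_left[of l "- k" x] by (simp add: chr_minus)
  ultimately have PP: "is_mean (\<lambda>x. P x * cnj (P x)) s"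
    using \<open>finite S\<close> by (simp add: P_def s_def sum_product mult_ac if_distrib cong: if_cong)
  have Pu: "is_mean (\<lambda>x. P x * cnj (u x)) s"
  proof -
    have "cnj s = s" by (simp add: s_def mult.commute)
    then show ?thesis using is_mean_cnj[OF uP] by (simp add: mult.commute)
  qed
  have "is_mean (\<lambda>x. (u x * cnj (u x) - u x * cnj (P x)) - (P x * cnj (u x) - P x * cnj (P x))) ((b - s) - (s - s))"
    by (intro is_mean_diff b uP Pu PP)
  moreover have "(u x * cnj (u x) - u x * cnj (P x)) - (P x * cnj (u x) - P x * cnj (P x)) = of_real ((norm (u x - P x))\<^sup>2)" for x
    unfolding complex_norm_square by (simp add: algebra_simps)
  ultimately have "is_mean (\<lambda>x. of_real ((norm (u x - P x))\<^sup>2)) (b - s)" by simp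
  then have "0 \<le> Re (b - s)" by (rule is_mean_Re_ge) simp
  moreover have "s = of_real (\<Sum>l\<in>S. (norm (a l))\<^sup>2)" unfolding s_def complex_norm_square[symmetric] by simp
  ultimately show ?thesis by simp
qed

section \<open>Frequencies and cube averages\<close>

text \<open>The Fourier-Bohr coefficient; the description is meaningful where the mean exists, in
  particular for almost periodic \<open>u\<close>.\<close>

definition fcoef :: "('v::real_inner \<Rightarrow> complex) \<Rightarrow> 'v \<Rightarrow> complex" where
  "fcoef u l = (THE a. is_mean (\<lambda>x. u x * chr (- l) x) a)"

lemma fcoef: "ap u \<Longrightarrow> is_mean (\<lambda>x. u x * chr (- l) x) (fcoef u l)"
  unfolding fcoef_def using ap_mean[OF ap_mult[OF _ ap_chr]] is_mean_unique by (metis theI)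

lemma finite_large_fcoef:
  assumes "ap u" "\<eta> > 0"
  shows "finite {l. norm (fcoef u l) \<ge> \<eta>}"
proof -
  obtain b where b: "is_mean (\<lambda>x. u x * cnj (u x)) b"
    using ap_mean[OF ap_mult[OF assms(1) uap_cnj[OF assms(1)]]] by blast
  obtain N :: nat where N: "Re b / \<eta>\<^sup>2 < N" using reals_Archimedean2 by blast
  show ?thesis
  proof (rule ccontr)
    assume "infinite {l. norm (fcoef u l) \<ge> \<eta>}"
    then obtain S where S: "S \<subseteq> {l. norm (fcoef u l) \<ge> \<eta>}" "finite S" "card S = N"
      using infinite_arbitrarily_large by blast
    have "N * \<eta>\<^sup>2 = (\<Sum>l\<in>S. \<eta>\<^sup>2)" using S by simp
    also have "\<dots> \<le> (\<Sum>l\<in>S. (norm (fcoef u l))\<^sup>2)"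
      using S assms(2) by (intro sum_mono power_mono) auto
    also have "\<dots> \<le> Re b" by (rule bessel[OF S(2) _ b]) (rule fcoef[OF assms(1)])
    finally show False using N assms(2) by (simp add: divide_less_eq)
  qed
qed

text \<open>The generated subgroup, in the same form as in \<open>Gf\<close>, so that the two are
  matched by unfolding.\<close>

definition zspan :: "'v::real_vector set \<Rightarrow> 'v set" where
  "zspan A = {v. \<exists>S (k :: 'v \<Rightarrow> int). finite S \<and> S \<subseteq> A \<and> v = (\<Sum>l\<in>S. of_int (k l) *\<^sub>R l)}"

lemma zspan_0: "0 \<in> zspan A"
  unfolding zspan_def by (intro CollectI exI[of _ "{}"]) simp

lemma zspan_uminus:
  assumes "v \<in> zspan A" shows "- v \<in> zspan A"
proof -
  obtain S and k :: "'a \<Rightarrow> int" where "finite S" "S \<subseteq> A" "v = (\<Sum>l\<in>S. of_int (k l) *\<^sub>R l)"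
    using assms unfolding zspan_def by blast
  then show ?thesis unfolding zspan_def
    by (intro CollectI exI[of _ S] exI[of _ "\<lambda>l. - k l"]) (simp add: sum_negf)
qed

lemma zspan_add_scaled:
  fixes j :: int
  assumes "v \<in> zspan A" "a \<in> A" shows "v + of_int j *\<^sub>R a \<in> zspan A"
proof -
  obtain S and k :: "'a \<Rightarrow> int" where S: "finite S" "S \<subseteq> A" "v = (\<Sum>l\<in>S. of_int (k l) *\<^sub>R l)"
    using assms unfolding zspan_def by blast
  define k' where "k' l = (if l \<in> S then k l else 0) + (if l = a then j else 0)" for l
  have "(\<Sum>l\<in>insert a S. of_int (k' l) *\<^sub>R l) = (\<Sum>l\<in>insert a S. (if l \<in> S then of_int (k l) *\<^sub>R l else 0)
      + (if l = a then of_int j *\<^sub>R a else 0))"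
    by (intro sum.cong) (auto simp: k'_def algebra_simps)
  also have "\<dots> = (\<Sum>l\<in>insert a S. if l \<in> S then of_int (k l) *\<^sub>R l else 0) + of_int j *\<^sub>R a"
    using S(1) by (simp add: sum.distrib)
  also have "(\<Sum>l\<in>insert a S. if l \<in> S then of_int (k l) *\<^sub>R l else 0) = v"
    unfolding S(3) using S(1) by (intro sum.mono_neutral_cong_right) auto
  finally show ?thesis using S assms(2) unfolding zspan_def
    by (intro CollectI exI[of _ "insert a S"] exI[of _ k']) auto
qed

lemma zspan_add: "v \<in> zspan A \<Longrightarrow> a \<in> A \<Longrightarrow> v + a \<in> zspan A"
  using zspan_add_scaled[of v A a 1] by simp

lemma zspan_diff: "v \<in> zspan A \<Longrightarrow> a \<in> A \<Longrightarrow> v - a \<in> zspan A"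
  using zspan_add_scaled[of v A a "-1"] by simp

text \<open>The hypothesis \<open>near\<close> is the only trace of the logarithm here;
  \<open>mean_motion_near\<close> supplies it. Its threshold 1/2 is the one of
  \<open>concentration\<close>, so the two conclusions contradict each other.\<close>

theorem frequency_in_zspan:
  fixes u :: "'v::euclidean_space \<Rightarrow> complex"
  assumes ap: "ap u" and cont: "continuous_on UNIV u" and "\<epsilon> > 0"
    and near: "\<And>t. (\<And>x. norm (u (x + t) - u x) < \<epsilon>) \<Longrightarrow> cos (c \<bullet> t) \<ge> 1/2"
  shows "c \<in> zspan {l. fcoef u l \<noteq> 0}"
proof (rule ccontr)
  assume c: "c \<notin> zspan {l. fcoef u l \<noteq> 0}"
  \<comment> \<open>Finite by Bessel's inequality, and growing with \<open>n\<close> until every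
    nonzero coefficient is included.\<close>
  define S where "S n = {l. norm (fcoef u l) \<ge> 1 / Suc n}" for n :: nat
  have finS: "finite (S n)" for n unfolding S_def by (rule finite_large_fcoef[OF ap]) simp
  have subS: "S n \<subseteq> {l. fcoef u l \<noteq> 0}" for n
  proof
    fix l assume "l \<in> S n"
    then have "norm (fcoef u l) \<ge> 1 / Suc n" by (simp add: S_def)
    moreover have "1 / real (Suc n) > 0" by simp
    ultimately have "norm (fcoef u l) > 0" by linarith
    then show "l \<in> {l. fcoef u l \<noteq> 0}" by simp
  qed
  \<comment> \<open>The assumption on \<open>c\<close> enters here: c + \<mu> cannot be 0 for \<mu>
    in the span.\<close>
  have mean0: "is_mean (\<lambda>x. chr c x * chr \<mu> x) 0" if "\<mu> \<in> zspan {l. fcoef u l \<noteq> 0}" for \<mu>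
  proof -
    have "c + \<mu> \<noteq> 0"
    proof
      assume "c + \<mu> = 0"
      then have "c = - \<mu>" by (simp add: eq_neg_iff_add_eq_0)
      then show False using c zspan_uminus[OF that] by simp
    qed
    then show ?thesis using is_mean_chr[of "c + \<mu>"] unfolding chr_add_left[abs_def] by simp
  qed
  \<comment> \<open>The square matches \<open>norm_chr_minus_1\<close>: it brings
    \<open>chr l t\<close> within 2/(n+1) of 1.\<close>
  have "\<exists>t. (\<forall>l\<in>S n. 1 - cos (l \<bullet> t) < (1 / Suc n)\<^sup>2) \<and> cos (c \<bullet> t) < 1/2" for n
  proof -
    have d: "(1 / real (Suc n))\<^sup>2 > 0" by simp
    have za: "\<mu> + l \<in> zspan {l. fcoef u l \<noteq> 0}" and zd: "\<mu> - l \<in> zspan {l. fcoef u l \<noteq> 0}"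
      if "\<mu> \<in> zspan {l. fcoef u l \<noteq> 0}" "l \<in> S n" for \<mu> l
      using zspan_add zspan_diff that subS by (metis subsetD)+
    show ?thesis
    proof (rule chr_concentration[OF finS ap_chr zspan_0 za zd mean0 d])
      fix t
      assume "\<And>l. l \<in> S n \<Longrightarrow> 1 - cos (l \<bullet> t) < (1 / real (Suc n))\<^sup>2" "Re (chr c t) < 1/2"
      then show ?thesis by (intro exI[of _ t] conjI ballI) (simp_all add: Re_chr)
    qed
  qed
  then obtain t where t: "\<And>n l. l \<in> S n \<Longrightarrow> 1 - cos (l \<bullet> t n) < (1 / Suc n)\<^sup>2" "\<And>n. cos (c \<bullet> t n) < 1/2"
    by metis
  from uap_seq_compact[OF ap, of t] obtain r :: "nat \<Rightarrow> nat" and h' :: "unit \<Rightarrow> 'v \<Rightarrow> complex" where r: "strict_mono r"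
    and h': "\<forall>e>0. \<exists>N. \<forall>n\<ge>N. \<forall>k\<in>UNIV. \<forall>x. norm (u (x + t (r n)) - h' k x) < e"
    by (elim exE conjE)
  define h where "h = h' ()"
  have h: "\<exists>N. \<forall>n\<ge>N. \<forall>x. norm (u (x + t (r n)) - h x) < e" if "e > 0" for e
    using h'[rule_format, OF that] unfolding h_def by blast
  have aph: "ap h"
  proof (rule uap_uniform_limit[where F = "\<lambda>n _ x. u (x + t (r n))"])
    show "uap UNIV (\<lambda>_::unit. \<lambda>x. u (x + t (r n)))" for n by (rule uap_shift[OF ap])
    show "\<exists>n. \<forall>k\<in>UNIV. \<forall>x. norm (u (x + t (r n)) - h x) \<le> e" if "e > 0" for e :: real
      using h[OF that] by (meson less_imp_le order_refl)
  qed
  have conth: "continuous_on UNIV h"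
  proof (rule uniform_limit_theorem[where f = "\<lambda>n x. u (x + t (r n))" and F = sequentially])
    show "uniform_limit UNIV (\<lambda>n x. u (x + t (r n))) h sequentially"
      using h by (intro uniform_limitI) (simp add: eventually_sequentially dist_norm)
    have "continuous_on UNIV (\<lambda>x. u (x + t (r n)))" for n
      by (intro continuous_on_compose2[OF cont] continuous_intros) auto
    then show "\<forall>\<^sub>F n in sequentially. continuous_on UNIV (\<lambda>x. u (x + t (r n)))" by simp
  qed simp
  obtain B where B: "B > 0" "\<And>l. norm (fcoef u l) \<le> B"
  proof -
    obtain B where B: "B > 0" "\<And>x. norm (u x) \<le> B" using ap_bounded[OF ap] by blast
    have "norm (fcoef u l - 0) \<le> B" for l
      by (rule is_mean_dist[OF fcoef[OF ap] is_mean_const]) (simp add: norm_mult B)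
    then show ?thesis using that[OF B(1)] by simp
  qed
  have coef: "fcoef h l = fcoef u l" for l
  proof (rule ccontr)
    assume "fcoef h l \<noteq> fcoef u l"
    define e where "e = norm (fcoef h l - fcoef u l)"
    have e: "e > 0" using \<open>fcoef h l \<noteq> fcoef u l\<close> by (simp add: e_def)
    have "e/2 > 0" using e by simp
    then obtain N where N: "\<And>n x. n \<ge> N \<Longrightarrow> norm (u (x + t (r n)) - h x) < e/2" using h by blast
    have "e / (4 * (B + 1)) > 0" using e B by simp
    then obtain N' where N': "1 / real (Suc N') < e / (4 * (B + 1))" using nat_approx_posE by blast
    define n where "n = max N N'"
    define a where "a = t (r n)"
    have m1: "is_mean (\<lambda>x. u (x + a) * chr (- l) x) (chr l a * fcoef u l)"
    proof -
      have "is_mean (\<lambda>x. chr l a * (u (x + a) * chr (- l) (x + a))) (chr l a * fcoef u l)"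
        by (intro is_mean_cmult is_mean_shift[OF fcoef[OF ap]])
      moreover have "chr l a * (u (x + a) * chr (- l) (x + a)) = u (x + a) * chr (- l) x" for x
        using chr_minus_mult(2)[of l a] by (simp add: chr_add algebra_simps)
      ultimately show ?thesis by simp
    qed
    have "norm (chr l a * fcoef u l - fcoef h l) \<le> e/2"
    proof (rule is_mean_dist[OF m1 fcoef[OF aph]])
      fix x
      have "norm (u (x + a) - h x) < e/2" using N[of n x] by (simp add: a_def n_def)
      then show "norm (u (x + a) * chr (- l) x - h x * chr (- l) x) \<le> e/2"
        by (simp add: norm_mult flip: left_diff_distrib)
    qed
    moreover have "norm (chr l a * fcoef u l - fcoef u l) < e/2"
    proof -
      have rn: "r n \<ge> N'" using seq_suble[OF r, of n] by (simp add: n_def)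
      define q where "q = 1 / real (Suc (r n))"
      have "q \<le> 1 / real (Suc N')" using rn by (simp add: q_def field_simps)
      then have q: "0 < q" "q < e / (4 * (B + 1))" using N' by (auto simp: q_def)
      have "norm (chr l a * fcoef u l - fcoef u l) = norm (chr l a - 1) * norm (fcoef u l)"
        by (simp add: left_diff_distrib flip: norm_mult)
      \<comment> \<open>Either the coefficient is among the large ones and the character is within 2
        q of 1, or the coefficient is at most \<open>q\<close> and the other factor at most
        2.\<close>
      also have "\<dots> \<le> 2 * q * (B + 1)"
      proof (cases "l \<in> S (r n)")
        case True
        have "(norm (chr l a - 1))\<^sup>2 \<le> (2 * q)\<^sup>2"
        proof -
          have gen: "2 * X \<le> 2\<^sup>2 * Y" if "X < Y" "0 \<le> Y" for X Y :: real using that by simp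
          have "1 - cos (l \<bullet> a) < q\<^sup>2" using t(1)[OF True] by (simp add: a_def q_def)
          then show ?thesis unfolding norm_chr_minus_1 power_mult_distrib by (rule gen) simp
        qed
        then have "norm (chr l a - 1) \<le> 2 * q" using q by (intro power2_le_imp_le[of "norm (chr l a - 1)"]) auto
        then show ?thesis using B(1) B(2)[of l] q by (intro mult_mono) auto
      next
        case False
        then have "norm (fcoef u l) \<le> q" by (simp add: S_def q_def)
        moreover have "norm (chr l a - 1) \<le> 2" using norm_triangle_ineq4[of "chr l a" 1] by simp
        ultimately have "norm (chr l a - 1) * norm (fcoef u l) \<le> 2 * q" by (intro mult_mono) auto
        also have "\<dots> \<le> 2 * q * (B + 1)" using B(1) q by simp
        finally show ?thesis .
      qed
      also have "\<dots> < e/2" using q B(1) by (simp add: field_simps)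
      finally show ?thesis .
    qed
    ultimately have "norm (fcoef h l - fcoef u l) < e"
      using norm_triangle_ineq[of "fcoef h l - chr l a * fcoef u l" "chr l a * fcoef u l - fcoef u l"]
      by (simp add: norm_minus_commute)
    then show False by (simp add: e_def)
  qed
  have eq: "h x - u x = 0" for x
  proof (rule ap_eq_0[where u = "\<lambda>x. h x - u x"])
    show "ap (\<lambda>x. h x - u x)" by (rule ap_diff[OF aph ap])
    show "continuous_on UNIV (\<lambda>x. h x - u x)" by (intro continuous_intros conth cont)
    fix l
    have "is_mean (\<lambda>x. h x * chr (- (- l)) x - u x * chr (- (- l)) x) (fcoef h (- l) - fcoef u (- l))"
      by (intro is_mean_diff fcoef aph ap)
    then show "is_mean (\<lambda>x. (h x - u x) * chr l x) 0" by (simp add: coef left_diff_distrib)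
  qed
  obtain n where n: "\<And>x. norm (u (x + t (r n)) - h x) < \<epsilon>" using h[OF \<open>\<epsilon> > 0\<close>] by blast
  have "h x = u x" for x using eq[of x] by simp
  then have "cos (c \<bullet> t (r n)) \<ge> 1/2" using near n by simp
  then show False using t(2)[of "r n"] by linarith
qed

section \<open>Means as limits of averages over cubes\<close>

lemma cube_eq_box: "cube s = box (vec (- s)) (vec s :: real^'n)"
  by (auto simp: cube_def mem_box_cart abs_less_iff) (metis minus_less_iff)+

lemma integral_cube:
  fixes u :: "real^'n \<Rightarrow> 'b::banach"
  shows "integral (cube s) u = integral (cbox (vec (- s)) (vec s :: real^'n)) u"
  unfolding cube_eq_box by (rule integral_open_interval)

lemma content_cube:
  assumes "s \<ge> 0"
  shows "measure lborel (cbox (vec (- s) + a) (vec s + a :: real^'n)) = (2 * s) ^ CARD('n)"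
proof -
  have "(vec (- s) + a) \<in> cbox (vec (- s) + a) (vec s + a :: real^'n)"
    using assms by (simp add: mem_box_cart)
  then have "cbox (vec (- s) + a) (vec s + a :: real^'n) \<noteq> {}" by blast
  then show ?thesis by (simp add: content_cbox_cart)
qed

lemma integral_cbox_diff_bound:
  fixes u :: "real^'n \<Rightarrow> complex"
  assumes cont: "continuous_on UNIV u" and B: "\<And>x. norm (u x) \<le> B"
    and sub: "cbox a b \<subseteq> cbox c d"
  shows "norm (integral (cbox c d) u - integral (cbox a b) u) \<le> B * (measure lborel (cbox c d) - measure lborel (cbox a b))"
proof -
  have int: "u integrable_on cbox p q" for p q
    by (rule integrable_continuous) (rule continuous_on_subset[OF cont], simp)
  have Int: "cbox a b \<inter> cbox c d = cbox a b" using sub by blast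
  define g where "g x = (if x \<in> cbox a b then u x else 0)" for x
  define k where "k x = (if x \<in> cbox a b then B else 0)" for x
  have g: "g integrable_on cbox c d" "integral (cbox c d) g = integral (cbox a b) u"
    unfolding g_def integrable_restrict_Int integral_restrict_Int Int using int by auto
  have k: "k integrable_on cbox c d" "integral (cbox c d) k = measure lborel (cbox a b) * B"
    unfolding k_def integrable_restrict_Int integral_restrict_Int Int by auto
  have "norm (integral (cbox c d) (\<lambda>x. u x - g x)) \<le> integral (cbox c d) (\<lambda>x. B - k x)"
  proof (rule Henstock_Kurzweil_Integration.integral_norm_bound_integral)
    show "(\<lambda>x. u x - g x) integrable_on cbox c d" by (intro integrable_diff int g)
    show "(\<lambda>x. B - k x) integrable_on cbox c d" by (intro integrable_diff k) auto
    show "norm (u x - g x) \<le> B - k x" if "x \<in> cbox c d" for x using B by (simp add: g_def k_def)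
  qed
  moreover have "integral (cbox c d) (\<lambda>x. B - k x) = measure lborel (cbox c d) * B - measure lborel (cbox a b) * B"
    using k by (subst integral_diff) auto
  ultimately show ?thesis using g int by (simp add: integral_diff algebra_simps)
qed

text \<open>The cube shrunk by \<open>norm t\<close> lies in both the cube and its translate, and
  the two remaining layers have volume of lower order than
  \<open>(2 * s) ^ CARD('n)\<close>.\<close>

lemma cube_average_shift:
  fixes u :: "real^'n \<Rightarrow> complex"
  assumes cont: "continuous_on UNIV u" and B: "\<And>x. norm (u x) \<le> B"
  shows "((\<lambda>s. (integral (cube s) (\<lambda>x. u (x + t)) - integral (cube s) u) / of_real ((2 * s) ^ CARD('n))) \<longlongrightarrow> 0) at_top"
proof (rule Lim_null_comparison)
  have B0: "B \<ge> 0" using B[of 0] norm_ge_zero order_trans by blast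
  define r where "r = norm t"
  show "\<forall>\<^sub>F s in at_top. norm ((integral (cube s) (\<lambda>x. u (x + t)) - integral (cube s) u) / of_real ((2 * s) ^ CARD('n)))
      \<le> 2 * B * (1 - (1 - r / s) ^ CARD('n))"
    using eventually_gt_at_top[of "r + 1"]
  proof eventually_elim
    case (elim s)
    have r: "r \<ge> 0" by (simp add: r_def)
    then have s: "s > 0" "s - r \<ge> 0" using elim by auto
    define Q where "Q = cbox (vec (- (s - r))) (vec (s - r) :: real^'n)"
    have sub: "Q \<subseteq> cbox (vec (- s) + a) (vec s + a)" if "norm a \<le> r" for a
    proof
      fix x assume x: "x \<in> Q"
      have "\<bar>a $ i\<bar> \<le> r" for i using component_le_norm_cart[of a i] that by linarith
      then show "x \<in> cbox (vec (- s) + a) (vec s + a)" using x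
        by (simp add: Q_def mem_box_cart) (smt (verit))
    qed
    have cQ: "measure lborel Q = (2 * (s - r)) ^ CARD('n)"
      using content_cube[OF s(2), where a = "0::real^'n"] by (simp add: Q_def)
    have sh: "integral (cube s) (\<lambda>x. u (x + t)) = integral (cbox (vec (- s) + t) (vec s + t)) u"
      unfolding integral_cube using integral_shift_cbox[of "vec (- s) + t" t "vec s + t" u] by simp
    have bd: "norm (integral (cbox (vec (- s) + a) (vec s + a)) u - integral Q u) \<le> B * ((2 * s) ^ CARD('n) - (2 * (s - r)) ^ CARD('n))"
      if "norm a \<le> r" for a
      using integral_cbox_diff_bound[OF cont B sub[OF that, unfolded Q_def]] content_cube[of s a] s cQ
      by (simp add: Q_def)
    have "norm (integral (cube s) (\<lambda>x. u (x + t)) - integral (cube s) u) \<le> 2 * B * ((2 * s) ^ CARD('n) - (2 * (s - r)) ^ CARD('n))"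
      using bd[of t] bd[of 0] r norm_triangle_ineq4[of "integral (cbox (vec (- s) + t) (vec s + t)) u - integral Q u"
         "integral (cbox (vec (- s) + 0) (vec s + 0)) u - integral Q u"]
      unfolding sh by (simp add: r_def integral_cube)
    then have "norm ((integral (cube s) (\<lambda>x. u (x + t)) - integral (cube s) u) / of_real ((2 * s) ^ CARD('n)))
      \<le> 2 * B * ((2 * s) ^ CARD('n) - (2 * (s - r)) ^ CARD('n)) / (2 * s) ^ CARD('n)"
      using s by (simp add: norm_divide norm_power divide_right_mono norm_mult)
    also have "\<dots> = 2 * B * (1 - ((2 * (s - r)) / (2 * s)) ^ CARD('n))"
    proof -
      have "2 * B * (P - R) / P = 2 * B * (1 - R / P)" if "P \<noteq> 0" for P R :: real
        using that by (simp add: field_simps)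
      moreover have "(2 * s) ^ CARD('n) \<noteq> 0" using s by simp
      ultimately show ?thesis unfolding power_divide by blast
    qed
    also have "(2 * (s - r)) / (2 * s) = 1 - r / s" using s by (simp add: field_simps)
    finally show ?case .
  qed
  have "((\<lambda>s. r / s) \<longlongrightarrow> 0) at_top"
    by (intro tendsto_divide_0[OF tendsto_const] filterlim_at_top_imp_at_infinity filterlim_ident)
  then have "((\<lambda>s. 2 * B * (1 - (1 - r / s) ^ CARD('n))) \<longlongrightarrow> 2 * B * (1 - (1 - 0) ^ CARD('n))) at_top"
    by (intro tendsto_intros)
  then show "((\<lambda>s. 2 * B * (1 - (1 - r / s) ^ CARD('n))) \<longlongrightarrow> 0) at_top" by simp
qed

text \<open>Replacing \<open>u\<close> by a finite average of translates does not affect cube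
  averages in the limit, and that average is uniformly near \<open>m\<close>. This identifies the
  abstract means with the integrals in \<open>spec\<close> and \<open>jessen\<close>.\<close>

theorem cube_average_tendsto_mean:
  fixes u :: "real^'n \<Rightarrow> complex"
  assumes cont: "continuous_on UNIV u" and B: "\<And>x. norm (u x) \<le> B" and "is_mean u m"
  shows "((\<lambda>s. integral (cube s) u / of_real ((2 * s) ^ CARD('n))) \<longlongrightarrow> m) at_top"
proof (rule tendstoI)
  fix e :: real assume e: "e > 0"
  then have "e/2 > 0" by simp
  then obtain ts where ts: "ts \<noteq> []" "\<And>x. norm (avg ts u x - m) \<le> e/2"
    using assms(3) unfolding is_mean_def by meson
  define L where "L = length ts"
  have L: "L > 0" using ts(1) by (simp add: L_def)
  define A where "A s v = integral (cube s) v / of_real ((2 * s) ^ CARD('n))" for s and v :: "real^'n \<Rightarrow> complex"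
  have avg_eq: "avg ts u x = (\<Sum>i<L. (1 / of_nat L) * u (x + ts ! i))" for x
    by (simp add: avg_def L_def sum_list_sum_nth atLeast0LessThan sum_divide_distrib)
  have cont_sh: "continuous_on S (\<lambda>x. u (x + a))" for a S
    by (intro continuous_on_compose2[OF cont] continuous_intros) auto
  have int: "(\<lambda>x. u (x + a)) integrable_on cbox p q" for a p q
    by (rule integrable_continuous[OF cont_sh])
  have contavg: "continuous_on S (avg ts u)" for S
    unfolding avg_eq[abs_def] by (intro continuous_intros cont_sh)
  have intavg: "avg ts u integrable_on cbox p q" for p q
    by (rule integrable_continuous[OF contavg])
  have Aavg: "A s (avg ts u) = (\<Sum>i<L. (1 / of_nat L) * A s (\<lambda>x. u (x + ts ! i)))" for s
  proof -
    have "integral (cube s) (avg ts u) = (\<Sum>i<L. (1 / of_nat L) * integral (cube s) (\<lambda>x. u (x + ts ! i)))"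
      unfolding avg_eq[abs_def] integral_cube
      by (subst integral_sum) (auto intro!: integrable_on_mult_right int)
    then show ?thesis by (simp add: A_def sum_divide_distrib)
  qed
  have "((\<lambda>s. \<Sum>i<L. (1 / of_nat L) * (A s (\<lambda>x. u (x + ts ! i)) - A s u)) \<longlongrightarrow> (\<Sum>i<L. (1 / of_nat L) * 0)) at_top"
    unfolding A_def diff_divide_distrib[symmetric]
    by (intro tendsto_sum tendsto_mult_left cube_average_shift[OF cont B])
  moreover have "(\<Sum>i<L. (1 / of_nat L) * (A s (\<lambda>x. u (x + ts ! i)) - A s u)) = A s (avg ts u) - A s u" for s
    unfolding Aavg using L by (simp add: right_diff_distrib sum_subtractf)
  ultimately have "((\<lambda>s. A s (avg ts u) - A s u) \<longlongrightarrow> 0) at_top" by simp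
  from tendstoD[OF this \<open>e/2 > 0\<close>] have "\<forall>\<^sub>F s in at_top. norm (A s (avg ts u) - A s u) < e/2"
    by (simp only: dist_norm diff_0_right)
  then show "\<forall>\<^sub>F s in at_top. dist (integral (cube s) u / of_real ((2 * s) ^ CARD('n))) m < e"
    using eventually_gt_at_top[of 0]
  proof eventually_elim
    case (elim s)
    define C where "C = cbox (vec (- s)) (vec s :: real^'n)"
    have cC: "measure lborel C = (2 * s) ^ CARD('n)" using content_cube[of s "0::real^'n"] elim by (simp add: C_def)
    have "integral C (\<lambda>x. avg ts u x - m) = integral C (avg ts u) - of_real (measure lborel C) * m"
      unfolding C_def by (subst integral_diff) (auto intro: intavg simp: scaleR_conv_of_real)
    moreover have "norm (integral C (\<lambda>x. avg ts u x - m)) \<le> integral C (\<lambda>x. e/2)"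
      unfolding C_def by (rule Henstock_Kurzweil_Integration.integral_norm_bound_integral)
        (use ts in \<open>auto intro!: integrable_diff intavg\<close>)
    ultimately have "norm (integral C (avg ts u) - of_real (measure lborel C) * m) \<le> measure lborel C * (e/2)"
      by (simp add: C_def)
    moreover have "A s (avg ts u) - m = (integral C (avg ts u) - of_real (measure lborel C) * m) / of_real (measure lborel C)"
      using elim by (simp add: A_def integral_cube C_def[symmetric] cC diff_divide_distrib)
    moreover have "measure lborel C > 0" using cC elim by simp
    ultimately have "norm (A s (avg ts u) - m) \<le> e/2"
      by (simp only: norm_divide norm_of_real abs_of_pos pos_divide_le_eq mult.commute)
    then have "norm (A s u - m) < e" using elim(1)
        norm_triangle_ineq4[of "A s (avg ts u) - m" "A s (avg ts u) - A s u"] by simp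
    then show ?case by (simp add: A_def dist_norm)
  qed
qed

section \<open>Tubes and holomorphic functions\<close>

definition rpart :: "complex^'n \<Rightarrow> real^'n" where
  "rpart z = (\<chi> j. Re (z $ j))"

lemma imv_cpt [simp]: "imv (cpt x y) = y"
  by (simp add: imv_def cpt_def vec_eq_iff)

lemma rpart_cpt [simp]: "rpart (cpt x y) = x"
  by (simp add: rpart_def cpt_def vec_eq_iff)

lemma cpt_rpart_imv [simp]: "cpt (rpart z) (imv z) = z"
  by (simp add: rpart_def imv_def cpt_def vec_eq_iff)

lemma cpt_plus_cvec: "cpt x y + cvec t = cpt (x + t) y"
  by (simp add: cpt_def cvec_def vec_eq_iff complex_eq_iff)

lemma cpt_in_tube [simp]: "cpt x y \<in> tube K \<longleftrightarrow> y \<in> K"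
  by (simp add: tube_def)

lemma imv_plus_cvec [simp]: "imv (z + cvec t) = imv z"
  by (simp add: imv_def cvec_def vec_eq_iff)

lemma linear_imv: "linear imv"
  by (rule linearI) (simp_all add: imv_def vec_eq_iff)

lemma linear_cpt: "linear (\<lambda>p. cpt (fst p) (snd p))"
  by (rule linearI) (simp_all add: cpt_def vec_eq_iff complex_eq_iff)

lemma continuous_on_cpt [continuous_intros]:
  assumes "continuous_on S f" "continuous_on S g"
  shows "continuous_on S (\<lambda>x. cpt (f x) (g x))"
  using continuous_on_compose2[OF linear_continuous_on[OF linear_cpt[unfolded linear_conv_bounded_linear]]
      continuous_on_Pair[OF assms], of UNIV] by simp

lemma tube_eq_image: "tube K = (\<lambda>p. cpt (fst p) (snd p)) ` (UNIV \<times> K)"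
proof
  show "tube K \<subseteq> (\<lambda>p. cpt (fst p) (snd p)) ` (UNIV \<times> K)"
  proof
    fix z assume "z \<in> tube K"
    then have "(rpart z, imv z) \<in> UNIV \<times> K" by (simp add: tube_def)
    then show "z \<in> (\<lambda>p. cpt (fst p) (snd p)) ` (UNIV \<times> K)"
      by (intro image_eqI[where x = "(rpart z, imv z)"]) simp_all
  qed
qed auto

lemma open_tube:
  fixes K :: "(real^'n) set"
  assumes "open K" shows "open (tube K)"
proof -
  have "continuous_on UNIV (imv :: complex^'n \<Rightarrow> real^'n)"
    by (rule linear_continuous_on[OF linear_imv[unfolded linear_conv_bounded_linear]])
  then show ?thesis using open_vimage[OF assms] by (simp add: tube_def vimage_def)
qed

lemma convex_tube: "convex K \<Longrightarrow> convex (tube K)"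
  using convex_linear_vimage[OF linear_imv, of K] by (simp add: tube_def vimage_def)

lemma connected_tube: "connected K \<Longrightarrow> connected (tube K)"
  unfolding tube_eq_image
  by (intro connected_continuous_image connected_Times connected_UNIV continuous_intros)

lemma cinner_cpt: "cinner (cpt x y) c = of_real (x \<bullet> c) + \<i> * of_real (y \<bullet> c)"
proof -
  have "Complex a b = of_real a + \<i> * of_real b" for a b by (simp add: complex_eq_iff)
  then show ?thesis
    by (simp add: cinner_def cpt_def inner_vec_def sum.distrib algebra_simps sum_distrib_left)
qed

lemma exp_cinner_cpt: "exp (\<i> * cinner (cpt x y) c) = chr c x * of_real (exp (- (y \<bullet> c)))"
proof -
  have "\<i> * cinner (cpt x y) c = \<i> * of_real (c \<bullet> x) + of_real (- (y \<bullet> c))"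
    by (simp add: cinner_cpt algebra_simps inner_commute)
  then show ?thesis by (simp add: exp_add chr_def cis_conv_exp exp_of_real del: of_real_minus)
qed

lemma cinner_bounded_linear: "bounded_linear (\<lambda>z. cinner z c)"
  unfolding linear_conv_bounded_linear[symmetric]
  by (rule linearI) (simp_all add: cinner_def distrib_right sum.distrib scaleR_sum_right)

lemma cinner_smult: "cinner (a *s z) c = a * cinner z c"
  by (simp add: cinner_def sum_distrib_left mult.assoc)

section \<open>Restriction to complex lines, and holomorphy of logarithms\<close>

lemma holo_on_continuous:
  assumes "holo_on f U" shows "continuous_on U f"
  using assms unfolding holo_on_def
  by (metis continuous_at_imp_continuous_on has_derivative_continuous)

lemma holo_on_subset: "holo_on f U \<Longrightarrow> V \<subseteq> U \<Longrightarrow> holo_on f V"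
  unfolding holo_on_def by blast

lemma smult_bounded_linear: "bounded_linear (\<lambda>\<zeta>::complex. \<zeta> *s (v :: complex^'n))"
  unfolding linear_conv_bounded_linear[symmetric]
  by (rule linearI) (simp_all add: vec_eq_iff algebra_simps)

lemma open_line_preimage:
  fixes z v :: "complex^'n"
  assumes "open U" shows "open {\<zeta>. z + \<zeta> *s v \<in> U}"
proof -
  have "continuous_on UNIV (\<lambda>\<zeta>. z + \<zeta> *s v)"
    by (intro continuous_intros linear_continuous_on smult_bounded_linear)
  then show ?thesis using open_vimage[OF assms] by (simp add: vimage_def)
qed

lemma convex_line_preimage:
  fixes z v :: "complex^'n"
  assumes "convex U" shows "convex {\<zeta>. z + \<zeta> *s v \<in> U}"
proof (rule convexI)
  fix a b and s t :: real
  assume "a \<in> {\<zeta>. z + \<zeta> *s v \<in> U}" "b \<in> {\<zeta>. z + \<zeta> *s v \<in> U}" and st: "0 \<le> s" "0 \<le> t" "s + t = 1"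
  then have "s *\<^sub>R (z + a *s v) + t *\<^sub>R (z + b *s v) \<in> U" using convexD[OF assms] by blast
  moreover have "s *\<^sub>R (z + a *s v) + t *\<^sub>R (z + b *s v) = z + (s *\<^sub>R a + t *\<^sub>R b) *s v"
  proof -
    have "s *\<^sub>R z + t *\<^sub>R z = z" using st(3) by (simp flip: scaleR_add_left)
    moreover have "s *\<^sub>R (z + a *s v) + t *\<^sub>R (z + b *s v) = (s *\<^sub>R z + t *\<^sub>R z) + (s *\<^sub>R a + t *\<^sub>R b) *s v"
      by (simp add: vec_eq_iff algebra_simps)
    ultimately show ?thesis by simp
  qed
  ultimately show "s *\<^sub>R a + t *\<^sub>R b \<in> {\<zeta>. z + \<zeta> *s v \<in> U}" by simp
qed

text \<open>The passage to one variable: both Hurwitz's theorem and the independence of the mean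
  from the height are obtained on such lines.\<close>

lemma holo_on_line:
  fixes f :: "complex^'n \<Rightarrow> complex"
  assumes "holo_on f U"
  shows "(\<lambda>\<zeta>. f (z + \<zeta> *s v)) holomorphic_on {\<zeta>. z + \<zeta> *s v \<in> U}"
proof (rule holomorphic_onI)
  fix \<zeta> assume "\<zeta> \<in> {\<zeta>. z + \<zeta> *s v \<in> U}"
  then obtain L where L: "(f has_derivative L) (at (z + \<zeta> *s v))" "\<And>c v. L (c *s v) = c * L v"
    using assms unfolding holo_on_def by blast
  have 1: "((\<lambda>\<zeta>. z + \<zeta> *s v) has_derivative (\<lambda>h. h *s v)) (at \<zeta>)"
    using has_derivative_add[OF has_derivative_const bounded_linear_imp_has_derivative[OF smult_bounded_linear]]
    by simp
  have "((\<lambda>\<zeta>. f (z + \<zeta> *s v)) has_derivative (\<lambda>h. L (h *s v))) (at \<zeta>)"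
    by (rule has_derivative_compose[OF 1 L(1)])
  then have "((\<lambda>\<zeta>. f (z + \<zeta> *s v)) has_field_derivative L v) (at \<zeta>)"
    unfolding L(2) has_field_derivative_def by (simp add: mult.commute[of _ "L v"])
  then show "(\<lambda>\<zeta>. f (z + \<zeta> *s v)) field_differentiable at \<zeta> within {\<zeta>. z + \<zeta> *s v \<in> U}"
    using field_differentiable_at_within field_differentiable_def by blast
qed

text \<open>Near \<open>z\<close> one has \<open>q w = q z + Ln (exp (q w - q z))\<close>, because
  continuity keeps the imaginary part of the difference within pi. The quotient \<open>p\<close>
  equals 1 at \<open>z\<close>, where \<open>Ln\<close> has derivative 1.\<close>

lemma has_derivative_log:
  fixes q :: "'a::real_normed_vector \<Rightarrow> complex"
  assumes "continuous (at z) q" "((\<lambda>w. exp (q w)) has_derivative L) (at z)"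
  shows "(q has_derivative (\<lambda>v. L v / exp (q z))) (at z)"
proof -
  define p where "p w = inverse (exp (q z)) * exp (q w)" for w
  have "(p has_derivative (\<lambda>v. inverse (exp (q z)) * L v)) (at z)"
    unfolding p_def by (rule has_derivative_mult_right[OF assms(2)])
  then have p: "(p has_derivative (\<lambda>v. L v / exp (q z))) (at z)" by (simp add: divide_inverse mult.commute)
  have "(Ln has_field_derivative inverse (p z)) (at (p z))"
    by (rule has_field_derivative_Ln) (simp add: p_def complex_nonpos_Reals_iff)
  then have "(Ln has_derivative (*) 1) (at (p z))" by (simp add: p_def has_field_derivative_def)
  from has_derivative_compose[OF p this]
  have "((\<lambda>w. q z + Ln (p w)) has_derivative (\<lambda>v. 0 + 1 * (L v / exp (q z)))) (at z)"
    by (intro has_derivative_add has_derivative_const)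
  then have d: "((\<lambda>w. q z + Ln (p w)) has_derivative (\<lambda>v. L v / exp (q z))) (at z)" by simp
  have "\<forall>\<^sub>F w in at z. norm (q w - q z) < pi"
    using assms(1) pi_gt_zero unfolding continuous_at by (simp add: tendsto_iff dist_norm)
  then have ev: "\<forall>\<^sub>F w in at z. q z + Ln (p w) = q w"
    proof eventually_elim
      case (elim w)
      then have "\<bar>Im (q w - q z)\<bar> < pi" using abs_Im_le_cmod order.strict_trans1 by blast
      then have "Ln (exp (q w - q z)) = q w - q z" by (intro Ln_exp) auto
      then show ?case by (simp add: p_def exp_diff divide_inverse mult.commute)
    qed
  show ?thesis by (rule has_derivative_transform_eventually[OF d ev]) (simp_all add: p_def)
qed

lemma holo_on_log:
  fixes f :: "complex^'n \<Rightarrow> complex"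
  assumes "open U" "holo_on f U" "continuous_on U g" "\<And>z. z \<in> U \<Longrightarrow> f z = exp (g z + \<i> * cinner z c)"
  shows "holo_on g U"
  unfolding holo_on_def
proof
  fix z assume z: "z \<in> U"
  obtain L where L: "(f has_derivative L) (at z)" "\<And>c v. L (c *s v) = c * L v"
    using assms(2) z unfolding holo_on_def by blast
  define q where "q w = g w + \<i> * cinner w c" for w
  have ci: "((\<lambda>w. \<i> * cinner w c) has_derivative (\<lambda>v. \<i> * cinner v c)) (at z)"
    by (intro has_derivative_mult_right bounded_linear_imp_has_derivative cinner_bounded_linear)
  have "continuous (at z) g" using assms(1,3) z continuous_on_eq_continuous_at by blast
  then have "continuous (at z) q"
    unfolding q_def by (intro continuous_intros has_derivative_continuous[OF ci])
  moreover have "((\<lambda>w. exp (q w)) has_derivative L) (at z)"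
    by (rule has_derivative_transform_within_open[OF L(1) assms(1) z]) (simp add: q_def assms(4))
  ultimately have "(q has_derivative (\<lambda>v. L v / exp (q z))) (at z)" by (rule has_derivative_log)
  from has_derivative_diff[OF this ci]
  have "(g has_derivative (\<lambda>v. L v / exp (q z) - \<i> * cinner v c)) (at z)"
    by (simp add: q_def)
  moreover have "L (a *s v) / exp (q z) - \<i> * cinner (a *s v) c = a * (L v / exp (q z) - \<i> * cinner v c)" for a v
    by (simp add: L(2) cinner_smult algebra_simps)
  ultimately show "\<exists>L. (g has_derivative L) (at z) \<and> (\<forall>c v. L (c *s v) = c * L v)" by blast
qed

text \<open>Without a finite net one could choose a sequence of translations that are pairwise far
  apart, which contradicts a convergent subsequence. The colour of a translation is a net point near
  it.\<close>

lemma AP_imp_uap: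
  fixes f :: "complex^'n \<Rightarrow> complex"
  assumes "AP \<Omega> f" "rel_compact_in K \<Omega>"
  shows "uap K (\<lambda>y x. f (cpt x y))"
proof (rule uapI)
  fix e :: real assume e: "e > 0"
  define near where "near t t' \<longleftrightarrow> (\<forall>y\<in>K. \<forall>x. norm (f (cpt (x + t) y) - f (cpt (x + t') y)) < e/2)" for t t'
  have "\<exists>T. finite T \<and> (\<forall>t. \<exists>t'\<in>T. near t t')"
  proof (rule ccontr)
    assume "\<not> ?thesis"
    then have far: "\<exists>t. \<forall>t'\<in>T. \<not> near t t'" if "finite T" for T using that by blast
    have "\<exists>t. \<forall>n::nat. \<forall>m<n. \<not> near (t n) (t m)"
    proof (rule dependent_wellorder_choice)
      show "\<exists>r. \<forall>m<n. \<not> near r (t m)" for n :: nat and t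
        using far[of "t ` {..<n}"] by auto
    qed simp
    then obtain t :: "nat \<Rightarrow> real^'n" where t: "\<And>n m. m < n \<Longrightarrow> \<not> near (t n) (t m)" by blast
    obtain r h where r: "strict_mono r" and h: "uniform_limit (tube K) (\<lambda>n z. f (z + cvec (t (r n)))) h sequentially"
      using assms unfolding AP_def by metis
    have "e/4 > 0" using e by simp
    from uniform_limitD[OF h this] obtain N where
      N: "\<And>n z. n \<ge> N \<Longrightarrow> z \<in> tube K \<Longrightarrow> dist (f (z + cvec (t (r n)))) (h z) < e/4"
      unfolding eventually_sequentially by blast
    have "near (t (r (Suc N))) (t (r N))"
      unfolding near_def
    proof (intro ballI allI)
      fix y x assume "y \<in> K"
      then have z: "cpt x y \<in> tube K" by simp
      show "norm (f (cpt (x + t (r (Suc N))) y) - f (cpt (x + t (r N)) y)) < e/2"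
        using N[OF _ z, of "Suc N"] N[OF _ z, of N] 
          dist_triangle2[of "f (cpt (x + t (r (Suc N))) y)" "f (cpt (x + t (r N)) y)" "h (cpt x y)"]
        unfolding cpt_plus_cvec by (simp add: dist_norm)
    qed
    then show False using t[of "r N" "r (Suc N)"] r by (simp add: strict_mono_def)
  qed
  then obtain T c where T: "finite T" "\<And>t. c t \<in> T" "\<And>t. near t (c t)" by metis
  have "finite (range c)" using T(1,2) by (meson finite_subset image_subsetI)
  moreover have "norm (f (cpt (x + t) y) - f (cpt (x + t') y)) < e" if "c t = c t'" "y \<in> K" for t t' y x
  proof -
    have "norm (f (cpt (x + t) y) - f (cpt (x + c t) y)) < e/2" "norm (f (cpt (x + t') y) - f (cpt (x + c t) y)) < e/2"
      using T(3)[of t] T(3)[of t'] that unfolding near_def by auto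
    then show ?thesis
      using norm_triangle_ineq4[of "f (cpt (x + t) y) - f (cpt (x + c t) y)" "f (cpt (x + t') y) - f (cpt (x + c t) y)"] by simp
  qed
  ultimately show "\<exists>c::real^'n \<Rightarrow> real^'n. finite (range c) \<and>
     (\<forall>t t'. c t = c t' \<longrightarrow> (\<forall>k\<in>K. \<forall>x. norm (f (cpt (x + t) k) - f (cpt (x + t') k)) < e))" by blast
qed

lemma uap_imp_AP:
  fixes g :: "complex^'n \<Rightarrow> complex"
  assumes "holo_on g (tube D)" "uap D (\<lambda>y x. g (cpt x y))"
  shows "AP D g"
  unfolding AP_def
proof (intro conjI allI assms(1))
  fix t :: "nat \<Rightarrow> real^'n"
  from uap_seq_compact[OF assms(2), of t] obtain r :: "nat \<Rightarrow> nat" and h where r: "strict_mono r"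
    and h: "\<forall>e>0. \<exists>N. \<forall>n\<ge>N. \<forall>k\<in>D. \<forall>x. norm (g (cpt (x + t (r n)) k) - h k x) < e"
    by (elim exE conjE)
  have "uniform_limit (tube E) (\<lambda>n z. g (z + cvec (t (r n)))) (\<lambda>z. h (imv z) (rpart z)) sequentially"
    if E: "rel_compact_in E D" for E
  proof (rule uniform_limitI)
    fix e :: real assume "e > 0"
    then obtain N where N: "\<And>n k x. n \<ge> N \<Longrightarrow> k \<in> D \<Longrightarrow> norm (g (cpt (x + t (r n)) k) - h k x) < e"
      using h by blast
    have "E \<subseteq> D" using E closure_subset unfolding rel_compact_in_def by blast
    have "dist (g (z + cvec (t (r n)))) (h (imv z) (rpart z)) < e" if "n \<ge> N" "z \<in> tube E" for n z
    proof -
      have "imv z \<in> D" using that \<open>E \<subseteq> D\<close> by (auto simp: tube_def)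
      moreover have "z + cvec (t (r n)) = cpt (rpart z + t (r n)) (imv z)" by (simp flip: cpt_plus_cvec)
      ultimately show ?thesis using N[OF that(1), of "imv z" "rpart z"] by (simp add: dist_norm)
    qed
    then show "\<forall>\<^sub>F n in sequentially. \<forall>z\<in>tube E. dist (g (z + cvec (t (r n)))) (h (imv z) (rpart z)) < e"
      unfolding eventually_sequentially by blast
  qed
  with r show "\<exists>r h. strict_mono r \<and> (\<forall>E. rel_compact_in E D \<longrightarrow>
     uniform_limit (tube E) (\<lambda>n z. g (z + cvec (t (r n)))) h sequentially)" by blast
qed

lemma uniform_limit_holomorphic_on:
  assumes "open S" "\<And>n::nat. \<phi> n holomorphic_on S" "uniform_limit S \<phi> \<psi> sequentially"
  shows "\<psi> holomorphic_on S"
proof (rule holomorphic_uniform_sequence[OF assms(1,2)])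
  fix x assume "x \<in> S"
  then obtain d where "d > 0" "cball x d \<subseteq> S" using assms(1) open_contains_cball by blast
  then show "\<exists>d>0. cball x d \<subseteq> S \<and> uniform_limit (cball x d) \<phi> \<psi> sequentially"
    using uniform_limit_on_subset[OF assms(3)] by blast
qed

text \<open>Suppose \<open>f\<close> tends to 0 along points whose heights tend to \<open>y\<close>.
  After moving their real parts to 0, a limit \<open>h\<close> of translates vanishes at a point
  over \<open>y\<close>, and Hurwitz's theorem on complex lines through it makes \<open>h\<close>
  vanish on the tube over a ball. The convergence is uniform on this unbounded tube, so some
  translate of \<open>f\<close>, hence \<open>f\<close> itself, is as small there as desired, which
  is absurd at \<open>z0\<close>.\<close>

lemma AP_lower_bound:
  fixes f :: "complex^'n \<Rightarrow> complex"
  assumes AP: "AP \<Omega> f" and U: "open U" "U \<subseteq> \<Omega>" and nz: "\<And>z. z \<in> tube U \<Longrightarrow> f z \<noteq> 0"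
    and K: "rel_compact_in K U"
  shows "\<exists>\<delta>>0. \<forall>z\<in>tube K. \<delta> \<le> norm (f z)"
proof (rule ccontr)
  assume neg: "\<not> ?thesis"
  have "\<exists>z\<in>tube K. norm (f z) < 1 / Suc n" for n :: nat
  proof (rule ccontr)
    assume "\<not> (\<exists>z\<in>tube K. norm (f z) < 1 / Suc n)"
    moreover have "1 / real (Suc n) > 0" by simp
    ultimately show False using neg by (meson not_less)
  qed
  then obtain Z where Z: "\<And>n. Z n \<in> tube K" "\<And>n. norm (f (Z n)) < 1 / Suc n" by metis
  have cK: "seq_compact (closure K)" "closure K \<subseteq> U"
    using K by (auto simp: rel_compact_in_def compact_eq_seq_compact_metric)
  have ZK: "\<forall>n. imv (Z n) \<in> closure K" using Z(1) closure_subset by (auto simp: tube_def)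
  obtain y and s :: "nat \<Rightarrow> nat" where y: "y \<in> closure K" "strict_mono s" "((\<lambda>n. imv (Z n)) \<circ> s) \<longlonglongrightarrow> y"
    by (rule seq_compactE[OF cK(1) ZK])
  have "y \<in> U" using y(1) cK(2) by blast
  then obtain \<rho> where \<rho>: "\<rho> > 0" "cball y \<rho> \<subseteq> U" using U(1) open_contains_cball by blast
  \<comment> \<open>A ball, so that its tube is convex and meets every complex line in a connected
    set.\<close>
  define D where "D = ball y \<rho>"
  have D: "rel_compact_in D \<Omega>" "D \<subseteq> U" "open D" "convex D" "y \<in> D"
    using \<rho> U(2) unfolding D_def rel_compact_in_def by (auto simp: subset_iff)
  have DO: "tube D \<subseteq> tube \<Omega>" using D(2) U(2) by (auto simp: tube_def)
  define t where "t n = rpart (Z (s n))" for n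
  obtain r h where r: "strict_mono r" and h: "uniform_limit (tube D) (\<lambda>n z. f (z + cvec (t (r n)))) h sequentially"
    using AP D(1) unfolding AP_def by metis
  have holo: "holo_on f (tube \<Omega>)" using AP by (simp add: AP_def)
  have holo_sh: "holo_on (\<lambda>z. f (z + cvec a)) (tube D)" for a
    unfolding holo_on_def
  proof
    fix z assume "z \<in> tube D"
    then have "z + cvec a \<in> tube \<Omega>" using DO by (auto simp: tube_def)
    then obtain L where L: "(f has_derivative L) (at (z + cvec a))" "\<forall>c v. L (c *s v) = c * L v"
      using holo unfolding holo_on_def by blast
    have "((\<lambda>z. f (z + cvec a)) has_derivative L) (at z)"
      using has_derivative_compose[of "\<lambda>z. z + cvec a" "\<lambda>v. v" z UNIV f L] L(1)
      by (simp add: has_derivative_add_const)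
    with L(2) show "\<exists>L. ((\<lambda>z. f (z + cvec a)) has_derivative L) (at z) \<and> (\<forall>c v. L (c *s v) = c * L v)" by blast
  qed
  have conth: "continuous_on (tube D) h"
    by (rule uniform_limit_theorem[OF always_eventually[OF allI[OF holo_on_continuous[OF holo_sh]]] h]) simp
  define z0 where "z0 = cpt 0 y"
  define w where "w n = cpt 0 (imv (Z (s (r n))))" for n
  have z0: "z0 \<in> tube D" using D(5) by (simp add: z0_def)
  have w_lim: "w \<longlonglongrightarrow> z0"
  proof -
    have "(\<lambda>n. imv (Z (s (r n)))) \<longlonglongrightarrow> y" using LIMSEQ_subseq_LIMSEQ[OF y(3) r] by (simp add: o_def)
    moreover have "continuous_on UNIV (\<lambda>y::real^'n. cpt 0 y)" by (intro continuous_intros)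
    then have "isCont (\<lambda>y. cpt 0 y) y" by (simp add: continuous_on_eq_continuous_at)
    ultimately show ?thesis unfolding w_def z0_def using isCont_tendsto_compose by blast
  qed
  have w_in: "\<forall>\<^sub>F n in sequentially. w n \<in> tube D"
    using topological_tendstoD[OF w_lim open_tube[OF D(3)] z0] .
  have fw: "f (w n + cvec (t (r n))) = f (Z (s (r n)))" for n
    unfolding w_def t_def cpt_plus_cvec by simp
  have "(\<lambda>n. norm (h (w n))) \<longlonglongrightarrow> norm (h z0)"
  proof -
    have "isCont h z0" using conth open_tube[OF D(3)] z0 continuous_on_eq_continuous_at by blast
    then show ?thesis using isCont_tendsto_compose[OF _ w_lim] tendsto_norm by blast
  qed
  moreover have "(\<lambda>n. norm (h (w n))) \<longlonglongrightarrow> 0"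
  proof (rule tendstoI)
    fix e :: real assume "e > 0"
    then have e2: "e/2 > 0" by simp
    have "\<forall>\<^sub>F n in sequentially. 1 / real (Suc n) < e/2"
      using order_tendstoD(2)[OF LIMSEQ_Suc[OF lim_1_over_n] e2] .
    then have "\<forall>\<^sub>F n in sequentially. norm (f (Z (s (r n)))) < e/2"
    proof eventually_elim
      case (elim n)
      have "n \<le> s (r n)" using seq_suble[OF y(2), of "r n"] seq_suble[OF r, of n] by linarith
      then have "1 / real (Suc (s (r n))) \<le> 1 / real (Suc n)" by (simp add: field_simps)
      then show ?case using Z(2)[of "s (r n)"] elim by linarith
    qed
    then show "\<forall>\<^sub>F n in sequentially. dist (norm (h (w n))) 0 < e"
      using uniform_limitD[OF h e2] w_in
    proof eventually_elim
      case (elim n)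
      have "dist (f (w n + cvec (t (r n)))) (h (w n)) < e/2" using elim by blast
      then have "norm (h (w n) - f (Z (s (r n)))) < e/2" unfolding fw by (simp add: dist_norm norm_minus_commute)
      then show ?case using elim norm_triangle_sub[of "h (w n)" "f (Z (s (r n)))"] by simp
    qed
  qed
  ultimately have "norm (h z0) = 0" using LIMSEQ_unique by blast
  then have h0: "h z0 = 0" by simp
  have hz: "h q = 0" if q: "q \<in> tube D" for q
  proof -
    define v where "v = q - z0"
    define S where "S = {\<zeta>. z0 + \<zeta> *s v \<in> tube D}"
    have S: "open S" "connected S" unfolding S_def
      by (intro open_line_preimage open_tube D convex_connected convex_line_preimage convex_tube)+
    define \<phi> where "\<phi> n \<zeta> = f (z0 + \<zeta> *s v + cvec (t (r n)))" for n \<zeta>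
    have \<phi>: "\<phi> n holomorphic_on S" for n
      unfolding \<phi>_def S_def by (rule holo_on_line[OF holo_sh])
    have ul: "uniform_limit S \<phi> (\<lambda>\<zeta>. h (z0 + \<zeta> *s v)) sequentially"
      using h unfolding uniform_limit_iff S_def \<phi>_def by (auto elim!: eventually_mono)
    have hol: "(\<lambda>\<zeta>. h (z0 + \<zeta> *s v)) holomorphic_on S"
      by (rule uniform_limit_holomorphic_on[OF S(1) \<phi> ul])
    have "z0 + 0 *s v = z0" "z0 + 1 *s v = q" by (simp_all add: v_def)
    then have in_S: "0 \<in> S" "1 \<in> S" using z0 q by (simp_all add: S_def)
    have "(\<lambda>\<zeta>. h (z0 + \<zeta> *s v)) constant_on S"
    proof (rule ccontr)
      assume nc: "\<not> (\<lambda>\<zeta>. h (z0 + \<zeta> *s v)) constant_on S"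
      have "\<phi> n \<zeta> \<noteq> 0" if "\<zeta> \<in> S" for n \<zeta>
        using that D(2) nz unfolding \<phi>_def S_def by (auto simp: tube_def)
      from Hurwitz_no_zeros[OF S \<phi> hol uniform_limit_on_subset[OF ul] nc this in_S(1)]
      have "h (z0 + 0 *s v) \<noteq> 0" by blast
      then show False using h0 by simp
    qed
    then have "h (z0 + 1 *s v) = h (z0 + 0 *s v)" using in_S unfolding constant_on_def by metis
    then show ?thesis using h0 by (simp add: v_def)
  qed
  have "norm (f z0) > 0" using nz[of z0] z0 D(2) by (auto simp: tube_def)
  from uniform_limitD[OF h this] obtain n where
    n: "\<And>z. z \<in> tube D \<Longrightarrow> dist (f (z + cvec (t (r n)))) (h z) < norm (f z0)"
    unfolding eventually_sequentially by blast
  \<comment> \<open>Undoing the translation stays in the tube, so smallness of the translate reaches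
    \<open>f z0\<close>.\<close>
  have "z0 + cvec (- t (r n)) \<in> tube D" using z0 by (simp add: tube_def)
  from n[OF this] hz[OF this] have "norm (f (z0 + cvec (- t (r n)) + cvec (t (r n)))) < norm (f z0)"
    by (simp add: dist_norm)
  then show False by (simp add: z0_def cpt_plus_cvec)
qed

text \<open>On a connected set \<open>q\<close> differs from the principal logarithm of its
  exponential by a constant in 2 pi i Z, and that logarithm has modulus at most 2 \<eta>. The bound
  does not depend on the size of the set; this is what turns closeness of two translates into an
  almost constant difference of logarithms.\<close>

lemma log_oscillation:
  fixes q :: "'a::topological_space \<Rightarrow> complex"
  assumes S: "connected S" "continuous_on S q" and \<eta>: "\<eta> < 1/2" "\<And>z. z \<in> S \<Longrightarrow> norm (exp (q z) - 1) \<le> \<eta>"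
    and "z \<in> S" "w \<in> S"
  shows "norm (q z - q w) \<le> 4 * \<eta>"
proof -
  define k where "k z = q z - Ln (exp (q z))" for z
  have nn: "exp (q z) \<notin> \<real>\<^sub>\<le>\<^sub>0" if "z \<in> S" for z
  proof
    assume "exp (q z) \<in> \<real>\<^sub>\<le>\<^sub>0"
    then have "Re (exp (q z) - 1) \<le> -1" by (auto simp: complex_nonpos_Reals_iff)
    then show False using \<eta>(1) \<eta>(2)[OF that] abs_Re_le_cmod[of "exp (q z) - 1"] by linarith
  qed
  have contk: "continuous_on S k"
    unfolding k_def by (intro continuous_intros continuous_on_compose2[OF continuous_on_Ln] S) (use nn in auto)
  have expk: "exp (k z) = 1" for z by (simp add: k_def exp_diff)
  have "k constant_on S"
  proof (rule continuous_discrete_range_constant[OF S(1) contk])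
    fix x assume "x \<in> S"
    show "\<exists>e>0. \<forall>y. y \<in> S \<and> k y \<noteq> k x \<longrightarrow> e \<le> norm (k y - k x)"
    proof (intro exI[of _ 1] conjI allI impI)
      fix y assume y: "y \<in> S \<and> k y \<noteq> k x"
      have "exp (k y - k x) = 1" using expk by (simp add: exp_diff)
      then obtain n :: int where n: "Re (k y - k x) = 0" "Im (k y - k x) = of_int (2 * n) * pi"
        unfolding exp_eq_1 by blast
      have "n \<noteq> 0" using n y by (auto simp: complex_eq_iff)
      then have "1 \<le> \<bar>real_of_int (2 * n)\<bar>" by linarith
      moreover have "1 \<le> pi" using pi_gt3 by linarith
      ultimately have "1 * 1 \<le> \<bar>real_of_int (2 * n)\<bar> * pi" by (intro mult_mono) auto
      then have "1 \<le> \<bar>Im (k y - k x)\<bar>" using n(2) by (simp add: abs_mult)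
      then show "1 \<le> norm (k y - k x)" using abs_Im_le_cmod order_trans by blast
    qed simp
  qed
  then have "k z = k w" using assms(5,6) unfolding constant_on_def by metis
  then have "q z - q w = Ln (exp (q z)) - Ln (exp (q w))" by (simp add: k_def algebra_simps)
  moreover have "norm (Ln (exp (q z))) \<le> 2 * \<eta>" if "z \<in> S" for z
    using norm_Ln_le[of "exp (q z) - 1"] \<eta>(1) \<eta>(2)[OF that] by simp
  ultimately show ?thesis using assms(5,6) norm_triangle_ineq4[of "Ln (exp (q z))" "Ln (exp (q w))"]
    by (smt (verit))
qed

text \<open>The defect \<open>L (s *\<^sub>R x) - s *\<^sub>R L x\<close> depends only on the
  fractional part of \<open>s\<close> and is therefore bounded, while multiplying \<open>s\<close>
  by n multiplies it by n; so it vanishes.\<close>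

lemma additive_bounded_imp_linear:
  fixes L :: "'v::real_normed_vector \<Rightarrow> 'w::real_normed_vector"
  assumes add: "\<And>x y. L (x + y) = L x + L y" and bd: "\<And>x. norm x \<le> 1 \<Longrightarrow> norm (L x) \<le> M"
  shows "linear L"
proof (rule linearI[OF add])
  fix r :: real and x :: 'v
  have L0: "L 0 = 0" using add[of 0 0] by simp
  have Ln: "L (of_nat n *\<^sub>R y) = of_nat n *\<^sub>R L y" for n y
    by (induction n) (simp_all add: L0 add scaleR_add_left)
  have Lm: "L (- y) = - L y" for y using add[of y "- y"] L0 by (simp add: eq_neg_iff_add_eq_0 add.commute)
  have Li: "L (of_int k *\<^sub>R y) = of_int k *\<^sub>R L y" for k :: int and y
  proof (cases "k \<ge> 0")
    case True
    then show ?thesis using Ln[of "nat k" y] by simp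
  next
    case False
    then show ?thesis using Ln[of "nat (- k)" "y"] Lm[of "of_int (- k) *\<^sub>R y"] by simp
  qed
  obtain N :: nat where N: "norm x < N" using reals_Archimedean2 by blast
  have N0: "N > 0" using N norm_ge_zero[of x] by (metis of_nat_0_less_iff order.strict_trans1)
  define C where "C = N * M + norm (L x)"
  have D: "norm (L (s *\<^sub>R x) - s *\<^sub>R L x) \<le> C" for s
  proof -
    define f where "f = frac s"
    have f: "0 \<le> f" "f < 1" "s = of_int \<lfloor>s\<rfloor> + f" unfolding f_def frac_def by linarith+
    have "L (s *\<^sub>R x) - s *\<^sub>R L x = L (f *\<^sub>R x) - f *\<^sub>R L x"
    proof -
      have "s *\<^sub>R x = of_int \<lfloor>s\<rfloor> *\<^sub>R x + f *\<^sub>R x" "s *\<^sub>R L x = of_int \<lfloor>s\<rfloor> *\<^sub>R L x + f *\<^sub>R L x"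
        using f(3) by (metis scaleR_add_left)+
      then show ?thesis using Li add by simp
    qed
    moreover have "norm (L (f *\<^sub>R x)) \<le> N * M"
    proof -
      have "norm ((1 / N) *\<^sub>R (f *\<^sub>R x)) \<le> 1"
      proof -
        have "f * norm x \<le> 1 * real N" using f N by (intro mult_mono) auto
        then show ?thesis using N0 f by (simp add: field_simps)
      qed
      then have "norm (L ((1 / N) *\<^sub>R (f *\<^sub>R x))) \<le> M" by (rule bd)
      moreover have "L (f *\<^sub>R x) = of_nat N *\<^sub>R L ((1 / N) *\<^sub>R (f *\<^sub>R x))" using N0 by (simp flip: Ln)
      ultimately show ?thesis by (simp add: mult_left_mono)
    qed
    moreover have "norm (f *\<^sub>R L x) \<le> norm (L x)" using f by (simp add: mult_left_le_one_le)
    ultimately show ?thesis using norm_triangle_ineq4[of "L (f *\<^sub>R x)" "f *\<^sub>R L x"] by (simp add: C_def)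
  qed
  have nD: "of_nat n * norm (L (r *\<^sub>R x) - r *\<^sub>R L x) \<le> C" for n
  proof -
    have "L ((of_nat n * r) *\<^sub>R x) - (of_nat n * r) *\<^sub>R L x = of_nat n *\<^sub>R (L (r *\<^sub>R x) - r *\<^sub>R L x)"
      using Ln[of n "r *\<^sub>R x"] by (simp add: scaleR_diff_right)
    then show ?thesis using D[of "of_nat n * r"] by simp
  qed
  show "L (r *\<^sub>R x) = r *\<^sub>R L x"
  proof (rule ccontr)
    assume "L (r *\<^sub>R x) \<noteq> r *\<^sub>R L x"
    then have "norm (L (r *\<^sub>R x) - r *\<^sub>R L x) > 0" by simp
    then obtain n :: nat where "C < of_nat n * norm (L (r *\<^sub>R x) - r *\<^sub>R L x)"
      using ex_less_of_nat_mult by blast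
    then show False using nD[of n] by simp
  qed
qed

text \<open>Hyers' construction of \<open>L x\<close> as the limit of \<open>k (2\<^sup>n x) / 2\<^sup>n\<close>.\<close>

lemma quasi_additive_near_linear:
  fixes k :: "'v::real_normed_vector \<Rightarrow> 'w::banach"
  assumes C: "\<And>s t. norm (k (s + t) - k s - k t) \<le> C" and bd: "\<And>x. norm x \<le> 1 \<Longrightarrow> norm (k x) \<le> M"
  shows "\<exists>L. linear L \<and> (\<forall>x. norm (k x - L x) \<le> C)"
proof -
  have C0: "C \<ge> 0" using C[of 0 0] norm_ge_zero order_trans by blast
  define a where "a x n = (1 / 2 ^ n) *\<^sub>R k ((2 ^ n) *\<^sub>R x)" for x and n :: nat
  \<comment> \<open>Written as a difference so that \<open>tele\<close> can sum it by
    telescoping.\<close>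
  have step: "norm (a x (Suc n) - a x n) \<le> C / 2 ^ n - C / 2 ^ Suc n" for x n
  proof -
    define y where "y = (2 ^ n :: real) *\<^sub>R x"
    have y2: "(2 ^ Suc n :: real) *\<^sub>R x = y + y" by (simp add: y_def scaleR_2[symmetric])
    have "a x n = (1 / 2 ^ Suc n) *\<^sub>R (k y + k y)" by (simp add: a_def y_def scaleR_2[symmetric])
    then have "a x (Suc n) - a x n = (1 / 2 ^ Suc n) *\<^sub>R (k (y + y) - k y - k y)"
      unfolding a_def y2 by (simp add: scaleR_diff_right scaleR_add_right algebra_simps)
    then have "norm (a x (Suc n) - a x n) \<le> (1 / 2 ^ Suc n) * C"
      using C[of y y] by (simp add: divide_right_mono)
    also have "\<dots> = C / 2 ^ n - C / 2 ^ Suc n" by (simp add: field_simps)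
    finally show ?thesis .
  qed
  have tele: "norm (a x (n + j) - a x n) \<le> C / 2 ^ n - C / 2 ^ (n + j)" for x n j
  proof (induction j)
    case (Suc j)
    then show ?case using step[of x "n + j"] norm_triangle_ineq[of "a x (n + Suc j) - a x (n + j)" "a x (n + j) - a x n"]
      by simp
  qed simp
  have le: "norm (a x m - a x n) \<le> C / 2 ^ n" if "m \<ge> n" for x m n
  proof -
    have "norm (a x m - a x n) \<le> C / 2 ^ n - C / 2 ^ m" using tele[of x n "m - n"] that by simp
    moreover have "C / 2 ^ m \<ge> 0" using C0 by simp
    ultimately show ?thesis by linarith
  qed
  have pow0: "(\<lambda>n. C / 2 ^ n) \<longlonglongrightarrow> 0"
    using tendsto_mult_right_zero[OF LIMSEQ_divide_realpow_zero[of 2 1], of C] by simp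
  have "\<exists>l. a x \<longlonglongrightarrow> l" for x
  proof -
    have "Cauchy (a x)"
    proof (rule CauchyI')
      fix e :: real assume "e > 0"
      then obtain N where N: "\<And>n. n \<ge> N \<Longrightarrow> C / 2 ^ n < e"
        using order_tendstoD(2)[OF pow0] unfolding eventually_sequentially by blast
      have "dist (a x m) (a x n) < e" if "m \<ge> N" "n > m" for m n
        using le[of m n x] N[OF that(1)] that by (simp add: dist_norm norm_minus_commute)
      then show "\<exists>M. \<forall>m\<ge>M. \<forall>n>m. dist (a x m) (a x n) < e" by blast
    qed
    then show ?thesis by (simp add: Cauchy_convergent_iff convergent_def)
  qed
  then obtain L where L: "\<And>x. a x \<longlonglongrightarrow> L x" by metis
  have near: "norm (k x - L x) \<le> C" for x
  proof -
    have "(\<lambda>n. norm (a x n - a x 0)) \<longlonglongrightarrow> norm (L x - a x 0)" by (intro tendsto_intros L)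
    moreover have "norm (a x n - a x 0) \<le> C" for n using le[of 0 n x] by simp
    ultimately have "norm (L x - a x 0) \<le> C" by (meson LIMSEQ_le_const2)
    then show ?thesis by (simp add: a_def norm_minus_commute)
  qed
  have add: "L (x + y) = L x + L y" for x y
  proof -
    have "(\<lambda>n. norm (a (x + y) n - a x n - a y n)) \<longlonglongrightarrow> norm (L (x + y) - L x - L y)" by (intro tendsto_intros L)
    moreover have "norm (a (x + y) n - a x n - a y n) \<le> C / 2 ^ n" for n
    proof -
      have "a (x + y) n - a x n - a y n = (1 / 2 ^ n) *\<^sub>R (k ((2 ^ n) *\<^sub>R x + (2 ^ n) *\<^sub>R y) - k ((2 ^ n) *\<^sub>R x) - k ((2 ^ n) *\<^sub>R y))"
        by (simp add: a_def scaleR_add_right scaleR_diff_right)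
      then show ?thesis using C[of "(2 ^ n) *\<^sub>R x" "(2 ^ n) *\<^sub>R y"] by (simp add: divide_right_mono)
    qed
    ultimately have "norm (L (x + y) - L x - L y) \<le> 0" using LIMSEQ_le[OF _ pow0] by blast
    then show ?thesis by (simp add: algebra_simps)
  qed
  have "linear L"
  proof (rule additive_bounded_imp_linear[OF add])
    show "norm (L x) \<le> M + C" if "norm x \<le> 1" for x
      using bd[OF that] near[of x] norm_triangle_ineq4[of "k x" "k x - L x"] by simp
  qed
  with near show ?thesis by blast
qed

section \<open>Logarithms on tubes over convex sets\<close>

lemma uap_bounded_compact:
  fixes F :: "'k::topological_space \<Rightarrow> 'a::ab_group_add \<Rightarrow> complex"
  assumes "uap K F" "compact K" "\<And>t. continuous_on K (\<lambda>y. F y t)"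
  shows "\<exists>M. \<forall>y\<in>K. \<forall>x. norm (F y x) \<le> M"
proof -
  obtain T \<tau> where T: "finite T" "\<And>t. \<tau> t \<in> T" "\<And>t k x. k \<in> K \<Longrightarrow> norm (F k (x + t) - F k (x + \<tau> t)) < 1"
    using uap_net[OF assms(1) zero_less_one] by blast
  have "\<exists>b. \<forall>y\<in>K. norm (F y t) \<le> b" for t
    using compact_imp_bounded[OF compact_continuous_image[OF assms(3) assms(2)], of t]
    by (auto simp: bounded_iff)
  then obtain b where b: "\<And>t y. y \<in> K \<Longrightarrow> norm (F y t) \<le> b t" by metis
  have "norm (F y x) \<le> 1 + (\<Sum>t\<in>T. \<bar>b t\<bar>)" if y: "y \<in> K" for y x
  proof -
    have "norm (F y x - F y (\<tau> x)) < 1" using T(3)[OF y, of 0 x] by simp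
    moreover have "norm (F y (\<tau> x)) \<le> \<bar>b (\<tau> x)\<bar>" using b[OF y, of "\<tau> x"] by linarith
    moreover have "\<bar>b (\<tau> x)\<bar> \<le> (\<Sum>t\<in>T. \<bar>b t\<bar>)" by (rule member_le_sum[where f = "\<lambda>t. \<bar>b t\<bar>"]) (use T in auto)
    ultimately show ?thesis using norm_triangle_sub[of "F y x" "F y (\<tau> x)"] by linarith
  qed
  then show ?thesis by blast
qed

lemma linear_bounded_imp_0:
  fixes L :: "'v::real_vector \<Rightarrow> real"
  assumes "linear L" "\<And>x. \<bar>L x\<bar> \<le> M"
  shows "L x = 0"
proof (rule ccontr)
  assume "L x \<noteq> 0"
  then obtain n :: nat where "M < of_nat n * \<bar>L x\<bar>" using ex_less_of_nat_mult[of "\<bar>L x\<bar>" M] by auto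
  moreover have "\<bar>L (of_nat n *\<^sub>R x)\<bar> = of_nat n * \<bar>L x\<bar>"
    by (simp add: linear_cmul[OF assms(1)] abs_mult)
  ultimately show False using assms(2)[of "of_nat n *\<^sub>R x"] by simp
qed

lemma exp_quotient_near_1:
  assumes "norm (exp a - exp b) \<le> \<eta> * \<delta>" "\<delta> \<le> norm (exp b)" "\<delta> > 0" "\<eta> \<ge> 0"
  shows "norm (exp (a - b) - 1 :: complex) \<le> \<eta>"
proof -
  have "norm (exp (a - b) - 1) = norm (exp a - exp b) / norm (exp b)"
  proof -
    have "exp (a - b) - 1 = (exp a - exp b) / exp b" by (simp add: exp_diff diff_divide_distrib)
    then show ?thesis by (simp only: norm_divide)
  qed
  also have "\<dots> \<le> (\<eta> * \<delta>) / \<delta>" using assms by (intro frac_le) auto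
  finally show ?thesis using assms(3) by simp
qed

text \<open>Convexity makes the tube contractible, so a logarithm \<open>G\<close> exists, but it
  may grow in the real directions. This growth is additive up to a bounded error, so a linear part
  can be split off that leaves a bounded remainder; the bounds on the modulus of \<open>f\<close>
  make the linear part purely imaginary.\<close>

lemma tube_logarithm:
  fixes f :: "complex^'n \<Rightarrow> complex" and K :: "(real^'n) set"
  assumes K: "compact K" "convex K" "y0 \<in> K" and cont: "continuous_on (tube K) f"
    and uap: "uap K (\<lambda>y x. f (cpt x y))"
    and \<delta>: "\<delta> > 0" "\<And>z. z \<in> tube K \<Longrightarrow> \<delta> \<le> norm (f z)"
  shows "\<exists>c g M. continuous_on (tube K) g \<and> (\<forall>z\<in>tube K. norm (g z) \<le> M) \<and>
    (\<forall>z\<in>tube K. f z = exp (g z + \<i> * cinner z c))"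
proof -
  have "f z \<noteq> 0" if "z \<in> tube K" for z using \<delta>(1) \<delta>(2)[OF that] by auto
  then obtain G where contG: "continuous_on (tube K) G" and fG: "\<And>z. z \<in> tube K \<Longrightarrow> f z = exp (G z)"
    using continuous_logarithm_on_contractible[OF cont convex_imp_contractible[OF convex_tube[OF K(2)]]] by metis
  define E where "E x y = G (cpt x y)" for x y
  have fE: "f (cpt x y) = exp (E x y)" if "y \<in> K" for x y using fG[of "cpt x y"] that by (simp add: E_def)
  have contE: "continuous_on K (E x)" for x
    unfolding E_def by (intro continuous_on_compose2[OF contG] continuous_intros) auto
  have contE': "continuous_on UNIV (\<lambda>x. E x y)" if "y \<in> K" for y
    unfolding E_def by (intro continuous_on_compose2[OF contG] continuous_intros) (use that in auto)
  have "\<delta>/4 > 0" using \<delta>(1) by simp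
  from uap_net[OF uap this] obtain T \<tau> where T: "finite T" "\<And>t. \<tau> t \<in> T"
    "\<And>t y x. y \<in> K \<Longrightarrow> norm (f (cpt (x + t) y) - f (cpt (x + \<tau> t) y)) < \<delta>/4" by blast
  \<comment> \<open>The two translates of \<open>f\<close> differ by less than \<delta>/4, so their
    quotient is within 1/4 of 1, and \<open>log_oscillation\<close> gives 4 * 1/4.\<close>
  have osc: "norm ((E (x + t) y - E (x + \<tau> t) y) - (E (x' + t) y' - E (x' + \<tau> t) y')) \<le> 1"
    if "y \<in> K" "y' \<in> K" for x y x' y' t
  proof -
    define q where "q z = G (z + cvec t) - G (z + cvec (\<tau> t))" for z
    have "continuous_on (tube K) q"
      unfolding q_def by (intro continuous_intros continuous_on_compose2[OF contG]) (auto simp: tube_def)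
    moreover have "norm (exp (q z) - 1) \<le> 1/4" if "z \<in> tube K" for z
      unfolding q_def
    proof (rule exp_quotient_near_1[of _ _ _ \<delta>])
      have y: "imv z \<in> K" using that by (simp add: tube_def)
      have z: "z + cvec a = cpt (rpart z + a) (imv z)" for a by (simp flip: cpt_plus_cvec)
      have in_K: "z + cvec a \<in> tube K" for a using y by (simp add: tube_def)
      show "norm (exp (G (z + cvec t)) - exp (G (z + cvec (\<tau> t)))) \<le> 1/4 * \<delta>"
        unfolding fG[OF in_K, symmetric] using T(3)[OF y, of "rpart z" t] unfolding z by simp
      show "\<delta> \<le> norm (exp (G (z + cvec (\<tau> t))))" unfolding fG[OF in_K, symmetric] by (rule \<delta>(2)[OF in_K])
    qed (use \<delta> in auto)
    ultimately have "norm (q (cpt x y) - q (cpt x' y')) \<le> 4 * (1/4)"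
      using that by (intro log_oscillation[of "tube K"] connected_tube convex_connected K(2)) auto
    then show ?thesis by (simp add: q_def E_def cpt_plus_cvec)
  qed
  have "\<exists>b. \<forall>y\<in>K. norm (E (s + r) y - E s y) \<le> b" for s r
    using compact_imp_bounded[OF compact_continuous_image[OF continuous_on_diff[OF contE contE] K(1)], of "s + r" s]
    by (auto simp: bounded_iff)
  then obtain b where b: "\<And>s r y. y \<in> K \<Longrightarrow> norm (E (s + r) y - E s y) \<le> b s r" by metis
  \<comment> \<open>Bounds the increments of \<open>E\<close> by net elements: by \<open>osc\<close>
    the base point may be taken in \<open>T\<close> as well, at the cost of 1.\<close>
  define M1 where "M1 = 1 + (\<Sum>p\<in>T \<times> T. \<bar>b (fst p) (snd p)\<bar>)"
  have shift: "norm (E (x + r) y - E x y) \<le> M1" if "r \<in> T" "y \<in> K" for x r y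
  proof -
    have "norm ((E (x + r) y - E x y) - (E (\<tau> x + r) y - E (\<tau> x) y)) \<le> 1"
      using osc[OF that(2) that(2), of r x 0] by (simp add: algebra_simps)
    moreover have "norm (E (\<tau> x + r) y - E (\<tau> x) y) \<le> \<bar>b (\<tau> x) r\<bar>" using b[OF that(2), of "\<tau> x" r] by linarith
    moreover have "\<bar>b (fst (\<tau> x, r)) (snd (\<tau> x, r))\<bar> \<le> (\<Sum>p\<in>T \<times> T. \<bar>b (fst p) (snd p)\<bar>)"
      by (rule member_le_sum[where f = "\<lambda>p. \<bar>b (fst p) (snd p)\<bar>"]) (use T that in auto)
    ultimately show ?thesis
      using norm_triangle_sub[of "E (x + r) y - E x y" "E (\<tau> x + r) y - E (\<tau> x) y"] unfolding M1_def fst_conv snd_conv by linarith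
  qed
  define k where "k t = E t y0 - E 0 y0" for t
  \<comment> \<open>One application of \<open>osc\<close> and two of \<open>shift\<close>, in the
    splitting used for \<open>quasi\<close>.\<close>
  define C where "C = 1 + 2 * M1"
  have quasi: "norm (E (x + t) y - E x y - k t) \<le> C" if y: "y \<in> K" for x t y
  proof -
    have "E (x + t) y - E x y - k t = ((E (x + t) y - E (x + \<tau> t) y) - (E (0 + t) y0 - E (0 + \<tau> t) y0))
        + ((E (x + \<tau> t) y - E x y) - (E (0 + \<tau> t) y0 - E 0 y0))" by (simp add: k_def)
    also have "norm \<dots> \<le> 1 + (M1 + M1)"
      by (intro norm_triangle_le add_mono osc y K(3) order_trans[OF norm_triangle_ineq4] shift T(2))
    finally show ?thesis by (simp add: C_def)
  qed
  have kq: "norm (k (s + t) - k s - k t) \<le> C" for s t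
    using quasi[OF K(3), of s t] by (simp add: k_def algebra_simps)
  obtain Mk where Mk: "\<And>x. norm x \<le> 1 \<Longrightarrow> norm (k x) \<le> Mk"
  proof -
    have "continuous_on (cball 0 1) k"
      unfolding k_def by (intro continuous_intros continuous_on_subset[OF contE'[OF K(3)]]) auto
    from compact_imp_bounded[OF compact_continuous_image[OF this compact_cball]] 
    obtain a where "\<forall>x\<in>cball 0 1. norm (k x) \<le> a" by (auto simp: bounded_iff)
    then show ?thesis by (intro that[of a]) simp
  qed
  from quasi_additive_near_linear[of k, OF kq Mk] obtain L where L: "linear L" "\<And>x. norm (k x - L x) \<le> C" by blast
  obtain M0 where M0: "\<And>y. y \<in> K \<Longrightarrow> norm (E 0 y) \<le> M0"
    using compact_imp_bounded[OF compact_continuous_image[OF contE K(1)], of 0] by (auto simp: bounded_iff)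
  have EL: "norm (E x y - L x) \<le> 2 * C + M0" if y: "y \<in> K" for x y
  proof -
    have "E x y - L x = (E (0 + x) y - E 0 y - k x) + (k x - L x) + E 0 y" by simp
    also have "norm \<dots> \<le> C + C + M0" by (intro norm_triangle_le add_mono quasi L M0 y)
    finally show ?thesis by simp
  qed
  have contf: "continuous_on K (\<lambda>y. f (cpt t y))" for t
    by (intro continuous_on_compose2[OF cont] continuous_intros) auto
  obtain Mf where Mf: "\<And>y x. y \<in> K \<Longrightarrow> norm (f (cpt x y)) \<le> Mf"
    using uap_bounded_compact[OF uap K(1) contf] by blast
  have ReE: "\<bar>Re (E x y0)\<bar> \<le> \<bar>ln \<delta>\<bar> + \<bar>ln Mf\<bar>" for x
  proof -
    have n: "norm (f (cpt x y0)) = exp (Re (E x y0))" using fE[OF K(3), of x] by (simp add: norm_exp_eq_Re)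
    have "\<delta> \<le> exp (Re (E x y0))" using \<delta>(2)[of "cpt x y0"] K(3) n by simp
    then have 1: "ln \<delta> \<le> Re (E x y0)" using \<delta>(1) by (simp add: ln_ge_iff[symmetric] ln_le_cancel_iff[symmetric])
    have 2: "exp (Re (E x y0)) \<le> Mf" using Mf[OF K(3), of x] n by simp
    then have "Re (E x y0) \<le> ln Mf" by (metis exp_gt_zero ln_exp ln_le_cancel_iff order.strict_trans2)
    with 1 show ?thesis by linarith
  qed
  have ReL: "Re (L x) = 0" for x
  proof (rule linear_bounded_imp_0[where L = "\<lambda>x. Re (L x)"])
    show "linear (\<lambda>x. Re (L x))" using linear_compose[OF L(1), of Re] by (simp add: o_def bounded_linear.linear[OF bounded_linear_Re])
    show "\<bar>Re (L x)\<bar> \<le> (\<bar>ln \<delta>\<bar> + \<bar>ln Mf\<bar>) + (2 * C + M0)" for x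
      using ReE[of x] EL[OF K(3), of x] abs_Re_le_cmod[of "E x y0 - L x"] by simp
  qed
  \<comment> \<open>The vector representing the functional
    \<open>\<lambda>x. Im (L x)\<close>.\<close>
  define c where "c = adjoint (\<lambda>x. Im (L x)) 1"
  have "linear (\<lambda>x. Im (L x))" using linear_compose[OF L(1), of Im] by (simp add: o_def bounded_linear.linear[OF bounded_linear_Im])
  from adjoint_works[OF this] have "x \<bullet> c = Im (L x)" for x by (simp add: c_def)
  then have Lc: "L x = \<i> * of_real (x \<bullet> c)" for x using ReL[of x] by (simp add: complex_eq_iff)
  obtain R where R: "\<And>y. y \<in> K \<Longrightarrow> norm y \<le> R" using compact_imp_bounded[OF K(1)] by (auto simp: bounded_iff)
  define g where "g z = G z - \<i> * cinner z c" for z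
  have "continuous_on (tube K) g"
    unfolding g_def by (intro continuous_intros contG linear_continuous_on cinner_bounded_linear)
  moreover have "norm (g z) \<le> (2 * C + M0) + R * norm c" if "z \<in> tube K" for z
  proof -
    have y: "imv z \<in> K" using that by (simp add: tube_def)
    have "g z = (E (rpart z) (imv z) - L (rpart z)) + of_real (imv z \<bullet> c)"
      using cinner_cpt[of "rpart z" "imv z" c] by (simp add: g_def E_def Lc algebra_simps)
    also have "norm \<dots> \<le> (2 * C + M0) + R * norm c"
    proof (intro norm_triangle_le add_mono EL y)
      have "norm (complex_of_real (imv z \<bullet> c)) \<le> norm (imv z) * norm c"
        unfolding norm_of_real by (rule Cauchy_Schwarz_ineq2)
      also have "\<dots> \<le> R * norm c" using R[OF y] by (intro mult_right_mono) auto
      finally show "norm (complex_of_real (imv z \<bullet> c)) \<le> R * norm c" .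
    qed
    finally show ?thesis .
  qed
  moreover have "f z = exp (g z + \<i> * cinner z c)" if "z \<in> tube K" for z
    using fG[OF that] by (simp add: g_def)
  ultimately show ?thesis by blast
qed

text \<open>The colour of \<open>t\<close> records three things: the class of the translate of
  \<open>f\<close>, the approximate value of \<open>chr c t\<close>, and the approximate value of
  \<open>g (cpt t y0)\<close>. The first two make the difference of two translates of
  \<open>g\<close> nearly constant on the tube, the third makes that constant small.\<close>

lemma uap_logarithm:
  fixes f g :: "complex^'n \<Rightarrow> complex"
  assumes "connected K" and cont: "continuous_on (tube K) g" and M: "\<And>z. z \<in> tube K \<Longrightarrow> norm (g z) \<le> M"
    and uap: "uap K (\<lambda>y x. f (cpt x y))" and \<delta>: "\<delta> > 0" "\<And>z. z \<in> tube K \<Longrightarrow> \<delta> \<le> norm (f z)"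
    and fg: "\<And>z. z \<in> tube K \<Longrightarrow> f z = exp (g z + \<i> * cinner z c)"
  shows "uap K (\<lambda>y x. g (cpt x y))"
proof (cases "K = {}")
  case True
  then show ?thesis by (simp add: uap_def) (metis finite.emptyI finite.insertI image_constant_conv)
next
  case False
  then obtain y0 where y0: "y0 \<in> K" by blast
  show ?thesis
  proof (rule uapI)
    fix e :: real assume e: "e > 0"
    \<comment> \<open>Below the 1/2 required by \<open>log_oscillation\<close>, and with oscillation
      4 \<eta> at most e/4; the third colour contributes e/2.\<close>
    define \<eta> where "\<eta> = min (1/4) (e/16)"
    have \<eta>: "\<eta> > 0" "\<eta> \<le> 1/4" "4 * \<eta> \<le> e/4" using e by (auto simp: \<eta>_def)
    have "\<eta> * \<delta> / 2 > 0" using \<eta> \<delta>(1) by simp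
    from uapE[OF uap this] obtain c1 :: "real^'n \<Rightarrow> nat" where c1: "finite (range c1)"
      "\<And>t t' y x. c1 t = c1 t' \<Longrightarrow> y \<in> K \<Longrightarrow> norm (f (cpt (x + t) y) - f (cpt (x + t') y)) < \<eta> * \<delta> / 2" by blast
    have "\<eta> / 2 > 0" using \<eta> by simp
    from finite_colour_bounded[of "chr c" 1, OF _ this] obtain c2 :: "real^'n \<Rightarrow> int \<times> int" where c2: "finite (range c2)"
      "\<And>t t'. c2 t = c2 t' \<Longrightarrow> norm (chr c t - chr c t') < \<eta> / 2" by auto
    have M': "norm (g (cpt t y0)) \<le> M" for t using M[of "cpt t y0"] y0 by simp
    have "e / 2 > 0" using e by simp
    from finite_colour_bounded[of "\<lambda>t. g (cpt t y0)" M, OF M' this] obtain c3 :: "real^'n \<Rightarrow> int \<times> int" where c3: "finite (range c3)"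
      "\<And>t t'. c3 t = c3 t' \<Longrightarrow> norm (g (cpt t y0) - g (cpt t' y0)) < e / 2" by blast
    define col where "col t = (c1 t, c2 t, c3 t)" for t
    have "finite (range col)"
      by (rule finite_subset[of _ "range c1 \<times> range c2 \<times> range c3"]) (use c1(1) c2(1) c3(1) in \<open>auto simp: col_def\<close>)
    moreover have "norm (g (cpt (x + t) y) - g (cpt (x + t') y)) < e" if col: "col t = col t'" and y: "y \<in> K" for t t' x y
    proof -
      define q where "q z = g (z + cvec t) - g (z + cvec t')" for z
      have contq: "continuous_on (tube K) q"
        unfolding q_def by (intro continuous_intros continuous_on_compose2[OF cont]) (auto simp: tube_def)
      have small: "norm (exp (q z) - 1) \<le> \<eta>" if "z \<in> tube K" for z
      proof -
        define x1 y1 where "x1 = rpart z" and "y1 = imv z"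
        have y1: "y1 \<in> K" using that by (simp add: tube_def y1_def)
        have z: "z + cvec a = cpt (x1 + a) y1" for a by (simp add: x1_def y1_def flip: cpt_plus_cvec)
        have inK: "cpt a y1 \<in> tube K" for a using y1 by simp
        define A B where "A = f (cpt (x1 + t) y1)" and "B = f (cpt (x1 + t') y1)"
        have B: "norm B \<ge> \<delta>" unfolding B_def by (rule \<delta>(2)[OF inK])
        then have B0: "B \<noteq> 0" using \<delta>(1) by auto
        have AB: "norm (A - B) < \<eta> * \<delta> / 2" unfolding A_def B_def using c1(2) col y1 by (simp add: col_def)
        have expg: "exp (g (cpt a y1)) = f (cpt a y1) * chr (- c) a * of_real (exp (y1 \<bullet> c))" for a
        proof -
          have "f (cpt a y1) = exp (g (cpt a y1)) * (chr c a * of_real (exp (- (y1 \<bullet> c))))"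
            unfolding fg[OF inK] exp_add exp_cinner_cpt ..
          then have "f (cpt a y1) * chr (- c) a * of_real (exp (y1 \<bullet> c))
             = exp (g (cpt a y1)) * (chr c a * chr (- c) a) * of_real (exp (- (y1 \<bullet> c)) * exp (y1 \<bullet> c))"
            by (simp add: mult_ac)
          then show ?thesis by (simp flip: exp_add)
        qed
        define W where "W = chr (- c) t * chr c t'"
        have "chr (- c) (x1 + t) / chr (- c) (x1 + t') = W"
        proof -
          have "W * chr (- c) (x1 + t') = chr (- c) (x1 + t) * (chr c t' * chr (- c) t')"
            unfolding W_def chr_add by (simp add: mult_ac)
          then show ?thesis by (simp add: divide_eq_eq)
        qed
        then have "exp (q z) = A / B * W"
          unfolding q_def z exp_diff expg A_def[symmetric] B_def[symmetric]
          by (simp add: field_simps)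
        then have q: "exp (q z) - 1 = ((A - B) / B) * W + (W - 1)"
          using B0 by (simp add: field_simps)
        have "norm W = 1" by (simp add: W_def norm_mult)
        then have "norm ((A - B) / B * W) = norm ((A - B) / B)" unfolding norm_mult by simp
        moreover have "norm ((A - B) / B) \<le> \<eta> / 2"
        proof -
          have "norm ((A - B) / B) \<le> (\<eta> * \<delta> / 2) / \<delta>"
            unfolding norm_divide using AB B \<delta>(1) \<eta> by (intro frac_le) auto
          then show ?thesis using \<delta>(1) by simp
        qed
        moreover have "norm (W - 1) \<le> \<eta> / 2"
        proof -
          have "W - 1 = chr (- c) t * (chr c t' - chr c t)"
            by (simp add: W_def right_diff_distrib)
          then have "norm (W - 1) = norm (chr c t - chr c t')" by (simp add: norm_mult norm_minus_commute)
          then show ?thesis using c2(2)[of t t'] col by (simp add: col_def)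
        qed
        ultimately show ?thesis unfolding q
          using norm_triangle_ineq[of "((A - B) / B) * W" "W - 1"] by linarith
      qed
      have "norm (q (cpt x y) - q (cpt 0 y0)) \<le> 4 * \<eta>"
        by (rule log_oscillation[OF connected_tube[OF assms(1)] contq _ small]) (use \<eta> y y0 in auto)
      moreover have "norm (q (cpt 0 y0)) < e/2"
        using c3(2)[of t t'] col by (simp add: q_def cpt_plus_cvec col_def)
      ultimately have "norm (q (cpt x y)) < e"
        using \<eta>(3) e norm_triangle_sub[of "q (cpt x y)" "q (cpt 0 y0)"] by linarith
      then show ?thesis by (simp add: q_def cpt_plus_cvec)
    qed
    ultimately show "\<exists>col :: real^'n \<Rightarrow> nat \<times> (int \<times> int) \<times> int \<times> int. finite (range col) \<and>
      (\<forall>t t'. col t = col t' \<longrightarrow> (\<forall>y\<in>K. \<forall>x. norm (g (cpt (x + t) y) - g (cpt (x + t') y)) < e))" by blast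
  qed
qed

text \<open>
  Along a complex line in a real direction the mean is a limit of holomorphic functions that depends
  only on the imaginary part of the parameter.
\<close>

lemma mean_independent_of_height:
  fixes g :: "complex^'n \<Rightarrow> complex"
  assumes B: "open B" "convex B" and holo: "holo_on g (tube B)" and M: "\<And>z. z \<in> tube B \<Longrightarrow> norm (g z) \<le> M"
    and uap: "uap B (\<lambda>y x. g (cpt x y))"
  shows "\<exists>m. \<forall>y\<in>B. is_mean (\<lambda>x. g (cpt x y)) m"
proof -
  have M': "norm (g (cpt x y)) \<le> M" if "y \<in> B" for x y using M[of "cpt x y"] that by simp
  have "\<exists>m. (\<forall>e>0. \<exists>ts. ts \<noteq> [] \<and> (\<forall>y\<in>B. \<forall>x. norm (avg ts (\<lambda>x. g (cpt x y)) x - m y) \<le> e)) \<and>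
      (\<forall>y\<in>B. is_mean (\<lambda>x. g (cpt x y)) (m y))"
    by (rule uap_mean[OF uap, of M]) (rule M')
  then obtain m where m: "\<forall>e>0. \<exists>ts. ts \<noteq> [] \<and> (\<forall>y\<in>B. \<forall>x. norm (avg ts (\<lambda>x. g (cpt x y)) x - m y) \<le> e)"
    "\<forall>y\<in>B. is_mean (\<lambda>x. g (cpt x y)) (m y)" by (elim exE conjE)
  have "\<forall>n::nat. \<exists>ts. ts \<noteq> [] \<and> (\<forall>y\<in>B. \<forall>x. norm (avg ts (\<lambda>x. g (cpt x y)) x - m y) \<le> 1 / Suc n)"
    using m(1) by (simp del: of_nat_Suc)
  then obtain ts where ts: "\<And>n. ts n \<noteq> []" "\<And>n y x. y \<in> B \<Longrightarrow> norm (avg (ts n) (\<lambda>x. g (cpt x y)) x - m y) \<le> 1 / Suc n"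
    by metis
  have "m y = m y'" if "y \<in> B" "y' \<in> B" for y y'
  proof -
    define v where "v = y' - y"
    \<comment> \<open>Real motion of the parameter is a real translation, and the parameters 0 and
      \<i> lie over \<open>y\<close> and \<open>y'\<close>.\<close>
    have line: "cpt a y + \<zeta> *s cvec v = cpt (a + Re \<zeta> *\<^sub>R v) (y + Im \<zeta> *\<^sub>R v)" for \<zeta> a
      by (simp add: cpt_def cvec_def vec_eq_iff complex_eq_iff)
    define S where "S = {\<zeta>. cpt 0 y + \<zeta> *s cvec v \<in> tube B}"
    have S: "open S" "connected S" unfolding S_def
      by (intro open_line_preimage open_tube B convex_connected convex_line_preimage convex_tube)+
    have S_iff: "\<zeta> \<in> S \<longleftrightarrow> y + Im \<zeta> *\<^sub>R v \<in> B" for \<zeta> by (simp add: S_def line)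
    define \<Phi> where "\<Phi> \<zeta> = m (y + Im \<zeta> *\<^sub>R v)" for \<zeta>
    define \<phi> where "\<phi> n \<zeta> = (\<Sum>i<length (ts n). g (cpt (ts n ! i) y + \<zeta> *s cvec v)) / of_nat (length (ts n))" for n \<zeta>
    have \<phi>_avg: "\<phi> n \<zeta> = avg (ts n) (\<lambda>x. g (cpt x (y + Im \<zeta> *\<^sub>R v))) (Re \<zeta> *\<^sub>R v)" for n \<zeta>
      unfolding \<phi>_def avg_def line by (simp add: sum_list_sum_nth atLeast0LessThan add.commute)
    have S_eq: "S = {\<zeta>. cpt a y + \<zeta> *s cvec v \<in> tube B}" for a by (auto simp: S_def line)
    have "(\<lambda>\<zeta>. g (cpt a y + \<zeta> *s cvec v)) holomorphic_on S" for a
      unfolding S_eq[of a] by (rule holo_on_line[OF holo])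
    then have hol: "\<phi> n holomorphic_on S" for n
      unfolding \<phi>_def using ts(1) by (intro holomorphic_intros) auto
    have "uniform_limit S \<phi> \<Phi> sequentially"
    proof (rule uniform_limitI)
      fix e :: real assume "e > 0"
      then have "\<forall>\<^sub>F n in sequentially. 1 / real (Suc n) < e"
        using order_tendstoD(2)[OF LIMSEQ_Suc[OF lim_1_over_n]] by blast
      then show "\<forall>\<^sub>F n in sequentially. \<forall>\<zeta>\<in>S. dist (\<phi> n \<zeta>) (\<Phi> \<zeta>) < e"
      proof eventually_elim
        case (elim n)
        show ?case
        proof
          fix \<zeta> assume "\<zeta> \<in> S"
          then show "dist (\<phi> n \<zeta>) (\<Phi> \<zeta>) < e"
            using ts(2)[of "y + Im \<zeta> *\<^sub>R v" n "Re \<zeta> *\<^sub>R v"] elim unfolding S_iff \<phi>_avg \<Phi>_def dist_norm by linarith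
        qed
      qed
    qed
    then have hol\<Phi>: "\<Phi> holomorphic_on S" by (rule uniform_limit_holomorphic_on[OF S(1) hol])
    \<comment> \<open>\<Phi> depends only on the imaginary part of the parameter, so its derivative
      in the real direction, which equals the complex derivative, is 0.\<close>
    have "(\<Phi> has_field_derivative 0) (at \<zeta>)" if "\<zeta> \<in> S" for \<zeta>
    proof -
      have "\<Phi> field_differentiable at \<zeta>"
        using hol\<Phi> S(1) \<open>\<zeta> \<in> S\<close> by (rule holomorphic_on_imp_differentiable_at)
      then obtain d where d: "(\<Phi> has_field_derivative d) (at \<zeta>)" unfolding field_differentiable_def by blast
      have "((\<lambda>h. \<zeta> + of_real h) has_vector_derivative 1) (at 0)"
        by (auto intro!: derivative_eq_intros)
      moreover have "(\<Phi> has_field_derivative d) (at (\<zeta> + of_real 0))" using d by simp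
      ultimately have D: "((\<Phi> \<circ> (\<lambda>h. \<zeta> + of_real h)) has_vector_derivative (1 * d)) (at 0)"
        by (rule field_vector_diff_chain_at)
      have const: "\<Phi> \<circ> (\<lambda>h. \<zeta> + of_real h) = (\<lambda>h. \<Phi> \<zeta>)" by (auto simp: \<Phi>_def)
      have "1 * d = 0"
        by (rule vector_derivative_unique_at[OF D[unfolded const] has_vector_derivative_const])
      with d show ?thesis by simp
    qed
    then have "\<Phi> constant_on S" by (rule has_field_derivative_0_imp_constant_on[OF _ S(2,1)])
    moreover have "0 \<in> S" "\<i> \<in> S" using that by (simp_all add: S_iff v_def)
    ultimately have "\<Phi> 0 = \<Phi> \<i>" unfolding constant_on_def by metis
    then show ?thesis by (simp add: \<Phi>_def v_def)
  qed
  then have "\<forall>y\<in>B. is_mean (\<lambda>x. g (cpt x y)) (m y0)" if "y0 \<in> B" for y0 using m(2) that by metis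
  then show ?thesis by (cases "B = {}") blast+
qed

section \<open>The mean motion\<close>

text \<open>The mean \<open>m\<close> is recorded because it singles out one of the logarithms
  differing by elements of 2 pi i Z; being the same at all heights of \<open>B\<close>, it can be
  compared on overlaps.\<close>

definition log_data :: "(complex^'n \<Rightarrow> complex) \<Rightarrow> (real^'n) set \<Rightarrow> real^'n \<Rightarrow> complex \<Rightarrow> (complex^'n \<Rightarrow> complex) \<Rightarrow> bool" where
  "log_data f B c m g \<longleftrightarrow> holo_on g (tube B) \<and> bounded (g ` tube B) \<and>
     (\<forall>z\<in>tube B. f z = exp (g z + \<i> * cinner z c)) \<and> (\<forall>y\<in>B. is_mean (\<lambda>x. g (cpt x y)) m)"

lemma local_logarithm:
  fixes f :: "complex^'n \<Rightarrow> complex"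
  assumes AP: "AP \<Omega> f" and U: "open U" "U \<subseteq> \<Omega>" and nz: "\<And>z. z \<in> tube U \<Longrightarrow> f z \<noteq> 0" and y: "y \<in> U"
  shows "\<exists>r c m g. r > 0 \<and> ball y r \<subseteq> U \<and> log_data f (ball y r) c m g"
proof -
  obtain r where r: "r > 0" "cball y r \<subseteq> U" using U(1) y open_contains_cball by blast
  \<comment> \<open>The closed ball supplies compactness and the lower bound for \<open>f\<close>,
    the open ball \<open>B\<close> below supplies holomorphy.\<close>
  define K where "K = cball y r"
  have KU: "rel_compact_in K U" and KO: "rel_compact_in K \<Omega>"
    using r U(2) by (auto simp: rel_compact_in_def K_def)
  have holo: "holo_on f (tube \<Omega>)" using AP by (simp add: AP_def)
  have uap: "uap K (\<lambda>y x. f (cpt x y))" by (rule AP_imp_uap[OF AP KO])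
  obtain \<delta> where \<delta>: "\<delta> > 0" "\<And>z. z \<in> tube K \<Longrightarrow> \<delta> \<le> norm (f z)"
    using AP_lower_bound[OF AP U nz KU] by blast
  have cont: "continuous_on (tube K) f"
    by (rule holo_on_continuous[OF holo_on_subset[OF holo]]) (use r(2) U(2) in \<open>auto simp: tube_def K_def\<close>)
  have K: "compact K" "convex K" "y \<in> K" using r(1) by (simp_all add: K_def)
  have "\<exists>c g M. continuous_on (tube K) g \<and> (\<forall>z\<in>tube K. norm (g z) \<le> M) \<and>
    (\<forall>z\<in>tube K. f z = exp (g z + \<i> * cinner z c))"
    by (rule tube_logarithm[OF K cont uap \<delta>(1)]) (rule \<delta>(2))
  then obtain c g M where g: "continuous_on (tube K) g"
    "\<forall>z\<in>tube K. norm (g z) \<le> M" "\<forall>z\<in>tube K. f z = exp (g z + \<i> * cinner z c)" by (elim exE conjE)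
  define B where "B = ball y r"
  have BK: "B \<subseteq> K" by (auto simp: B_def K_def)
  have "K \<subseteq> \<Omega>" using r(2) U(2) by (simp add: K_def)
  with BK have BK: "B \<subseteq> K" "tube B \<subseteq> tube K" "tube B \<subseteq> tube \<Omega>" unfolding tube_def by blast+
  have B: "open B" "convex B" by (simp_all add: B_def)
  have contB: "continuous_on (tube B) g" by (rule continuous_on_subset[OF g(1) BK(2)])
  have fgB: "f z = exp (g z + \<i> * cinner z c)" if "z \<in> tube B" for z using g(3) BK(2) that by blast
  have MB: "norm (g z) \<le> M" if "z \<in> tube B" for z using g(2) BK(2) that by blast
  have holoB: "holo_on g (tube B)"
    by (rule holo_on_log[OF open_tube[OF B(1)] holo_on_subset[OF holo BK(3)] contB fgB])
  have \<delta>B: "\<delta> \<le> norm (f z)" if "z \<in> tube B" for z using \<delta>(2) BK(2) that by blast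
  have uapB: "uap B (\<lambda>y x. g (cpt x y))"
    by (rule uap_logarithm[OF convex_connected[OF B(2)] contB MB uap_mono[OF uap BK(1)] \<delta>(1) \<delta>B fgB])
  have "\<exists>m. \<forall>y\<in>B. is_mean (\<lambda>x. g (cpt x y)) m"
    by (rule mean_independent_of_height[OF B holoB MB uapB])
  then obtain m where "\<forall>y\<in>B. is_mean (\<lambda>x. g (cpt x y)) m" by blast
  then have "log_data f B c m g"
    unfolding log_data_def bounded_iff using holoB MB fgB by blast
  moreover have "B \<subseteq> U" using BK(1) r(2) by (auto simp: K_def)
  ultimately show ?thesis using r(1) unfolding B_def by blast
qed

text \<open>On the slice over a common height the difference of the two exponents is continuous with
  exponential 1, hence constant. As \<open>g\<close> and \<open>g'\<close> are bounded, its linear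
  part vanishes, so the frequencies agree, and the remaining constant is its own mean.\<close>

lemma log_data_unique:
  fixes f :: "complex^'n \<Rightarrow> complex"
  assumes 1: "log_data f B c m g" and 2: "log_data f B' c' m' g'" and y: "y \<in> B" "y \<in> B'"
  shows "c = c'" "exp m = exp m'" "\<And>x. g (cpt x y) - g' (cpt x y) = m - m'"
proof -
  define h where "h x = g (cpt x y) - g' (cpt x y)" for x
  define q where "q x = h x + \<i> * (cinner (cpt x y) c - cinner (cpt x y) c')" for x
  have hol: "holo_on g (tube B)" "holo_on g' (tube B')" using 1 2 by (auto simp: log_data_def)
  have conth: "continuous_on UNIV h"
    unfolding h_def
    by (intro continuous_intros continuous_on_compose2[OF holo_on_continuous[OF hol(1)]]
        continuous_on_compose2[OF holo_on_continuous[OF hol(2)]]) (use y in auto)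
  then have contq: "continuous_on UNIV q"
    unfolding q_def
    by (intro continuous_intros bounded_linear.continuous_on[OF cinner_bounded_linear])
  have eq: "exp (q x) = 1" for x
  proof -
    have "f (cpt x y) = exp (g (cpt x y) + \<i> * cinner (cpt x y) c)"
      using 1 cpt_in_tube[of x y B] y(1) unfolding log_data_def by blast
    moreover have "f (cpt x y) = exp (g' (cpt x y) + \<i> * cinner (cpt x y) c')"
      using 2 cpt_in_tube[of x y B'] y(2) unfolding log_data_def by blast
    ultimately have "exp (g (cpt x y) + \<i> * cinner (cpt x y) c - (g' (cpt x y) + \<i> * cinner (cpt x y) c')) = 1"
      unfolding exp_diff by (metis div_self exp_not_eq_zero)
    moreover have "g (cpt x y) + \<i> * cinner (cpt x y) c - (g' (cpt x y) + \<i> * cinner (cpt x y) c') = q x"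
      by (simp add: q_def h_def algebra_simps)
    ultimately show ?thesis by simp
  qed
  \<comment> \<open>The case \<eta> = 0 of \<open>log_oscillation\<close>.\<close>
  have q0: "q x = q 0" for x
    using log_oscillation[OF connected_UNIV contq, of 0 x 0] eq by simp
  obtain M1 M2 where M: "\<And>z. z \<in> tube B \<Longrightarrow> norm (g z) \<le> M1" "\<And>z. z \<in> tube B' \<Longrightarrow> norm (g' z) \<le> M2"
    using 1 2 unfolding log_data_def bounded_iff by (metis image_eqI)
  have hM: "norm (h x) \<le> M1 + M2" for x
    unfolding h_def using M(1)[of "cpt x y"] M(2)[of "cpt x y"] y
      norm_triangle_ineq4[of "g (cpt x y)" "g' (cpt x y)"] by simp
  have lin0: "x \<bullet> (c - c') = 0" for x
  proof (rule linear_bounded_imp_0[where L = "\<lambda>x. x \<bullet> (c - c')"])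
    show "linear (\<lambda>x. x \<bullet> (c - c'))" by (rule linearI) (simp_all add: inner_add_left)
    fix x
    have "Im (q x) = Im (h x) + x \<bullet> (c - c')" for x
      by (simp add: q_def cinner_cpt inner_diff_right)
    from this[of x] this[of 0] q0[of x] have "x \<bullet> (c - c') = Im (h 0) - Im (h x)" by simp
    moreover have "\<bar>p - q\<bar> \<le> 2 * K" if "\<bar>p\<bar> \<le> K" "\<bar>q\<bar> \<le> K" for p q K :: real using that by linarith
    ultimately show "\<bar>x \<bullet> (c - c')\<bar> \<le> 2 * (M1 + M2)"
      using order_trans[OF abs_Im_le_cmod hM[of 0]] order_trans[OF abs_Im_le_cmod hM[of x]] by metis
  qed
  show c: "c = c'" using lin0[of "c - c'"] by simp
  have hq: "h x = q 0" for x using q0[of x] by (simp add: q_def c)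
  have "is_mean h (m - m')" unfolding h_def using 1 2 y by (intro is_mean_diff) (auto simp: log_data_def)
  moreover have "h = (\<lambda>x. q 0)" using hq by (rule ext)
  ultimately have "m - m' = q 0" using is_mean_unique[OF _ is_mean_const[of "q 0"]] by simp
  then have "exp (m - m') = 1" using eq[of 0] by simp
  then show "exp m = exp m'" by (simp add: exp_diff)
  show "g (cpt x y) - g' (cpt x y) = m - m'" for x using hq[of x] \<open>m - m' = q 0\<close> by (simp add: h_def)
qed

lemma log_data_shift:
  assumes "log_data f B c m g" "exp m = exp m'"
  shows "log_data f B c m' (\<lambda>z. g z + (m' - m))"
proof -
  have "exp (m' - m) = 1" using assms(2) by (simp add: exp_diff)
  then have "exp (g z + (m' - m) + \<i> * cinner z c) = exp (g z + \<i> * cinner z c)" for z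
    by (simp add: exp_add)
  moreover have "holo_on (\<lambda>z. g z + (m' - m)) (tube B)"
    using assms(1) has_derivative_add_const unfolding log_data_def holo_on_def by blast
  moreover have "bounded ((\<lambda>z. g z + (m' - m)) ` tube B)"
    using assms(1) bounded_translation[of "g ` tube B" "m' - m"] by (simp add: log_data_def image_image add.commute)
  moreover have "is_mean (\<lambda>x. g (cpt x y) + (m' - m)) m'" if "y \<in> B" for y
    using is_mean_add[OF _ is_mean_const, of "\<lambda>x. g (cpt x y)" m "m' - m"] assms(1) that by (simp add: log_data_def)
  ultimately show ?thesis using assms(1) unfolding log_data_def by simp
qed

text \<open>Only \<open>exp (m0 y)\<close> is determined by \<open>f\<close>, the mean itself being
  free modulo 2 pi i. So local constancy is shown for the pair of frequency and exponential, and one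
  representative \<open>m\<close> is imposed on all balls. Bounds over a compact set come from
  finitely many balls.\<close>

lemma global_logarithm:
  fixes f :: "complex^'n \<Rightarrow> complex"
  assumes AP: "AP \<Omega> f" and U: "open U" "U \<subseteq> \<Omega>" "connected U" "U \<noteq> {}" and nz: "\<And>z. z \<in> tube U \<Longrightarrow> f z \<noteq> 0"
  shows "\<exists>c m g. holo_on g (tube U) \<and> (\<forall>z\<in>tube U. f z = exp (g z + \<i> * cinner z c)) \<and>
    (\<forall>y\<in>U. is_mean (\<lambda>x. g (cpt x y)) m) \<and> (\<forall>K. compact K \<longrightarrow> K \<subseteq> U \<longrightarrow> bounded (g ` tube K))"
proof -
  have "\<forall>y\<in>U. \<exists>r c m g. r > 0 \<and> ball y r \<subseteq> U \<and> log_data f (ball y r) c m g"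
    using local_logarithm[OF AP U(1,2) nz] by blast
  then obtain r C m0 g0 where loc: "\<And>y. y \<in> U \<Longrightarrow> r y > 0" "\<And>y. y \<in> U \<Longrightarrow> ball y (r y) \<subseteq> U"
    "\<And>y. y \<in> U \<Longrightarrow> log_data f (ball y (r y)) (C y) (m0 y) (g0 y)" by metis
  have agree: "(C y', exp (m0 y')) = (C y, exp (m0 y))" if "y \<in> U" "y' \<in> ball y (r y)" for y y'
  proof -
    have "y' \<in> U" using loc(2) that by blast
    then have "y' \<in> ball y' (r y')" using loc(1) by simp
    from log_data_unique(1,2)[OF loc(3)[OF \<open>y' \<in> U\<close>] loc(3)[OF that(1)] this that(2)] show ?thesis by simp
  qed
  have "(\<lambda>y. (C y, exp (m0 y))) constant_on U"
  proof (rule locally_constant_imp_constant[OF U(3)])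
    fix a assume a: "a \<in> U"
    show "\<exists>T. openin (top_of_set U) T \<and> a \<in> T \<and> (\<forall>x\<in>T. (C x, exp (m0 x)) = (C a, exp (m0 a)))"
      by (intro exI[of _ "ball a (r a)"] conjI ballI agree[OF a] open_subset loc(2)[OF a] open_ball)
        (simp_all add: loc(1)[OF a])
  qed
  then obtain p where p: "\<And>y. y \<in> U \<Longrightarrow> (C y, exp (m0 y)) = p" unfolding constant_on_def by blast
  obtain y1 where y1: "y1 \<in> U" using U(4) by blast
  define c where "c = C y1"
  define m where "m = m0 y1"
  have const: "C y = c" "exp (m0 y) = exp m" if "y \<in> U" for y
    using p[OF that] p[OF y1] by (auto simp: c_def m_def)
  define g1 where "g1 y z = g0 y z + (m - m0 y)" for y z
  have ld: "log_data f (ball y (r y)) c m (g1 y)" if "y \<in> U" for y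
    using log_data_shift[OF loc(3)[OF that] const(2)[OF that]] const(1)[OF that] by (simp add: g1_def[abs_def])
  \<comment> \<open>Each height uses the logarithm of the ball centred at itself;
    \<open>g_eq\<close> allows any other ball containing it.\<close>
  define g where "g z = g1 (imv z) z" for z
  have g_eq: "g z = g1 y z" if "y \<in> U" "z \<in> tube (ball y (r y))" for y z
  proof -
    have b: "imv z \<in> ball y (r y)" using that by (simp add: tube_def)
    then have "imv z \<in> U" using loc(2) that by blast
    then have "imv z \<in> ball (imv z) (r (imv z))" using loc(1) by simp
    from log_data_unique(3)[OF ld[OF \<open>imv z \<in> U\<close>] ld[OF that(1)] this b, of "rpart z"]
    show ?thesis by (simp add: g_def)
  qed
  have own: "z \<in> tube (ball (imv z) (r (imv z)))" if "z \<in> tube U" for z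
    using loc(1)[of "imv z"] that by (simp add: tube_def)
  have "holo_on g (tube U)"
    unfolding holo_on_def
  proof
    fix z assume z: "z \<in> tube U"
    define y where "y = imv z"
    have y: "y \<in> U" using z by (simp add: y_def tube_def)
    have zb: "z \<in> tube (ball y (r y))" using own[OF z] by (simp add: y_def)
    then obtain L where L: "(g1 y has_derivative L) (at z)" "\<forall>c v. L (c *s v) = c * L v"
      using ld[OF y] unfolding log_data_def holo_on_def by blast
    have "(g has_derivative L) (at z)"
      by (rule has_derivative_transform_within_open[OF L(1) open_tube[OF open_ball] zb]) (simp add: g_eq[OF y])
    with L(2) show "\<exists>L. (g has_derivative L) (at z) \<and> (\<forall>c v. L (c *s v) = c * L v)" by blast
  qed
  moreover have "f z = exp (g z + \<i> * cinner z c)" if z: "z \<in> tube U" for z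
  proof -
    have "imv z \<in> U" using z by (simp add: tube_def)
    then show ?thesis using ld[of "imv z"] own[OF z] unfolding log_data_def g_def by blast
  qed
  moreover have "is_mean (\<lambda>x. g (cpt x y)) m" if y: "y \<in> U" for y
    using ld[OF y] loc(1)[OF y] unfolding log_data_def g_def by simp
  moreover have "bounded (g ` tube K)" if K: "compact K" "K \<subseteq> U" for K
  proof -
    have "K \<subseteq> (\<Union>y\<in>K. ball y (r y))" using loc(1) K(2) by force
    then obtain T where T: "T \<subseteq> K" "finite T" "K \<subseteq> (\<Union>y\<in>T. ball y (r y))"
      using compactE_image[OF K(1), of K "\<lambda>y. ball y (r y)"] by auto
    have "g ` tube K \<subseteq> (\<Union>y\<in>T. g1 y ` tube (ball y (r y)))"
    proof
      fix w assume "w \<in> g ` tube K"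
      then obtain z where z: "imv z \<in> K" "w = g z" by (auto simp: tube_def)
      then obtain y where y: "y \<in> T" "imv z \<in> ball y (r y)" using T(3) by blast
      then have "z \<in> tube (ball y (r y))" by (simp add: tube_def)
      moreover have "y \<in> U" using y(1) T(1) K(2) by blast
      ultimately show "w \<in> (\<Union>y\<in>T. g1 y ` tube (ball y (r y)))" using g_eq z(2) y(1) by blast
    qed
    moreover have "bounded (\<Union>y\<in>T. g1 y ` tube (ball y (r y)))"
      using T K(2) ld unfolding log_data_def by (intro bounded_UN ballI) auto
    ultimately show ?thesis using bounded_subset by blast
  qed
  ultimately show ?thesis by blast
qed

text \<open>For a near-invariance \<open>t\<close> the function \<open>q\<close> is a logarithm of a
  quotient close to 1, hence nearly constant. Its mean is
  \<open>\<i> * of_real (c \<bullet> t)\<close>, since the two translates of \<open>h\<close> have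
  equal means; so \<open>chr c t\<close> is close to \<open>exp (q 0)\<close>, which is close to
  1.\<close>

lemma mean_motion_near:
  fixes u h :: "real^'n \<Rightarrow> complex"
  assumes cont: "continuous_on UNIV h" and "is_mean h m" and u: "\<And>x. u x = exp (h x) * chr c x"
    and \<delta>: "\<delta> > 0" "\<And>x. \<delta> \<le> norm (u x)"
  shows "\<exists>\<epsilon>>0. \<forall>t. (\<forall>x. norm (u (x + t) - u x) < \<epsilon>) \<longrightarrow> cos (c \<bullet> t) \<ge> 1/2"
proof -
  have "isCont exp (0::complex)" by simp
  then obtain d where d: "d > 0" "\<And>w::complex. norm w < d \<Longrightarrow> norm (exp w - 1) < 1/4"
    unfolding continuous_at_eps_delta by (metis dist_0_norm dist_commute dist_norm exp_zero zero_less_divide_1_iff zero_less_numeral)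
  \<comment> \<open>The bound d/8 brings 4 \<eta> below \<open>d\<close>; the bound 1/8, added to
    the 1/4 from the choice of \<open>d\<close>, stays below 1/2.\<close>
  define \<eta> where "\<eta> = min (1/8) (d/8)"
  have \<eta>: "\<eta> > 0" "\<eta> \<le> 1/8" "4 * \<eta> < d" using d(1) by (auto simp: \<eta>_def)
  have "cos (c \<bullet> t) \<ge> 1/2" if near: "\<forall>x. norm (u (x + t) - u x) < \<eta> * \<delta>" for t
  proof -
    define q where "q x = h (x + t) - h x + \<i> * of_real (c \<bullet> t)" for x
    have contq: "continuous_on UNIV q"
      unfolding q_def by (intro continuous_intros cont continuous_on_compose2[OF cont]) auto
    have small: "norm (exp (q x) - 1) \<le> \<eta>" for x
    proof -
      have e: "u y = exp (h y + \<i> * of_real (c \<bullet> y))" for y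
        by (simp add: u exp_add chr_def cis_conv_exp)
      have "q x = (h (x + t) + \<i> * of_real (c \<bullet> (x + t))) - (h x + \<i> * of_real (c \<bullet> x))"
        by (simp add: q_def inner_add_right algebra_simps)
      then show ?thesis
        using exp_quotient_near_1[of "h (x + t) + \<i> * of_real (c \<bullet> (x + t))" "h x + \<i> * of_real (c \<bullet> x)" \<eta> \<delta>]
          near \<delta> \<eta> unfolding e[symmetric] by (simp add: less_imp_le)
    qed
    have osc: "norm (q x - q 0) \<le> 4 * \<eta>" for x
      by (rule log_oscillation[OF connected_UNIV contq _ small]) (use \<eta> in auto)
    have "is_mean q (m - m + \<i> * of_real (c \<bullet> t))"
      unfolding q_def[abs_def]
      by (rule is_mean_add[OF is_mean_diff[OF is_mean_shift[OF assms(2)] assms(2)] is_mean_const])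
    from is_mean_dist[OF this is_mean_const osc] have "norm (m - m + \<i> * of_real (c \<bullet> t) - q 0) \<le> 4 * \<eta>" .
    then have "norm (\<i> * of_real (c \<bullet> t) - q 0) \<le> 4 * \<eta>" by simp
    then have "norm (q 0 - \<i> * of_real (c \<bullet> t)) \<le> 4 * \<eta>" by (subst norm_minus_commute)
    then have "norm (q 0 - \<i> * of_real (c \<bullet> t)) < d" using \<eta>(3) by linarith
    from d(2)[OF this] have "norm (exp (q 0) / chr c t - 1) < 1/4"
      by (simp add: exp_diff chr_def cis_conv_exp)
    moreover have "norm (exp (q 0) / chr c t - 1) = norm (exp (q 0) - chr c t)"
    proof -
      have "exp (q 0) / chr c t - 1 = (exp (q 0) - chr c t) / chr c t" by (simp add: diff_divide_distrib)
      then show ?thesis by (simp add: norm_divide)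
    qed
    ultimately have "norm (exp (q 0) - chr c t) < 1/4" by simp
    then have "norm (chr c t - 1) < 1/4 + 1/8"
      using small[of 0] \<eta>(2) norm_triangle_ineq4[of "exp (q 0) - 1" "exp (q 0) - chr c t"] by simp
    then have "\<bar>Re (chr c t - 1)\<bar> < 1/2" using abs_Re_le_cmod[of "chr c t - 1"] by linarith
    then show ?thesis by (simp add: Re_chr abs_less_iff)
  qed
  then show ?thesis using \<eta>(1) \<delta>(1) by (intro exI[of _ "\<eta> * \<delta>"]) auto
qed

theorem mainTheorem1:
  fixes \<Omega> D0 :: "(real^'n) set" and f :: "complex^'n \<Rightarrow> complex"
  assumes "domain \<Omega>"
    and "AP \<Omega> f"
    and "\<exists>z\<in>tube \<Omega>. f z \<noteq> 0"
    and "D0 \<in> components (\<Omega> - amoeba \<Omega> f)"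
  shows "\<exists>c \<in> Gf \<Omega> f.
           (\<forall>D'. domain D' \<and> rel_compact_in D' D0 \<longrightarrow>
              (\<exists>g. AP D' g \<and> bounded (g ` tube D') \<and>
                   (\<forall>z\<in>tube D'. f z = exp (g z + \<i> * cinner z c)))) \<and>
           (\<forall>y\<in>D0. (jessen f has_derivative (\<lambda>v. - (c \<bullet> v))) (at y))"
proof -
  define Z where "Z = {y\<in>\<Omega>. \<exists>x. f (cpt x y) = 0}"
  have "\<Omega> - amoeba \<Omega> f = \<Omega> \<inter> - closure Z" by (auto simp: amoeba_def Z_def)
  then have "open (\<Omega> - amoeba \<Omega> f)" using assms(1) by (simp add: domain_def open_Int open_Compl)
  then have D0: "open D0" "connected D0" "D0 \<noteq> {}" "D0 \<subseteq> \<Omega> - amoeba \<Omega> f"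
    using assms(4) open_components in_components_connected in_components_nonempty in_components_subset by blast+
  have D0\<Omega>: "D0 \<subseteq> \<Omega>" using D0(4) by blast
  have nz: "f z \<noteq> 0" if z: "z \<in> tube D0" for z
  proof
    assume "f z = 0"
    then have "imv z \<in> Z" using z D0\<Omega> unfolding Z_def by (auto simp: tube_def intro!: exI[of _ "rpart z"])
    then have "imv z \<in> \<Omega> \<inter> closure Z" using closure_subset[of Z] Z_def by blast
    then have "imv z \<in> amoeba \<Omega> f" by (simp add: amoeba_def Z_def)
    then show False using z D0(4) by (auto simp: tube_def)
  qed
  have "\<exists>c m g. holo_on g (tube D0) \<and> (\<forall>z\<in>tube D0. f z = exp (g z + \<i> * cinner z c)) \<and>
    (\<forall>y\<in>D0. is_mean (\<lambda>x. g (cpt x y)) m) \<and> (\<forall>K. compact K \<longrightarrow> K \<subseteq> D0 \<longrightarrow> bounded (g ` tube K))"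
    by (rule global_logarithm[OF assms(2) D0(1) D0\<Omega> D0(2,3) nz])
  then obtain c m g where g': "holo_on g (tube D0)"
    "\<forall>z\<in>tube D0. f z = exp (g z + \<i> * cinner z c)" "\<forall>y\<in>D0. is_mean (\<lambda>x. g (cpt x y)) m"
    "\<forall>K. compact K \<longrightarrow> K \<subseteq> D0 \<longrightarrow> bounded (g ` tube K)" by (elim exE conjE)
  note g = g'(1) g'(2,3,4)[rule_format]
  have holo: "holo_on f (tube \<Omega>)" using assms(2) by (simp add: AP_def)
  have slice_cont: "continuous_on UNIV (\<lambda>x. f (cpt x y))" "continuous_on UNIV (\<lambda>x. g (cpt x y))" if "y \<in> D0" for y
    using that D0\<Omega> by (intro continuous_on_compose2[OF holo_on_continuous[OF holo]]
        continuous_on_compose2[OF holo_on_continuous[OF g(1)]] continuous_intros; auto)+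
  have single: "rel_compact_in {y} D0" "rel_compact_in {y} \<Omega>" if "y \<in> D0" for y
    using that D0\<Omega> by (auto simp: rel_compact_in_def)

  have "\<exists>g. AP D' g \<and> bounded (g ` tube D') \<and> (\<forall>z\<in>tube D'. f z = exp (g z + \<i> * cinner z c))"
    if D': "domain D'" "rel_compact_in D' D0" for D'
  proof -
    have sub: "closure D' \<subseteq> D0" "compact (closure D')" "D' \<subseteq> closure D'"
      using D'(2) closure_subset by (auto simp: rel_compact_in_def)
    have tsub: "tube D' \<subseteq> tube D0" "tube D' \<subseteq> tube (closure D')" using sub by (auto simp: tube_def)
    have rc: "rel_compact_in D' \<Omega>" using D'(2) D0\<Omega> by (auto simp: rel_compact_in_def)
    have bdd: "bounded (g ` tube D')"
      using g(4)[OF sub(2,1)] by (rule bounded_subset) (use tsub in blast)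
    then obtain M where M: "\<And>z. z \<in> tube D' \<Longrightarrow> norm (g z) \<le> M" unfolding bounded_iff by blast
    obtain \<delta> where \<delta>: "\<delta> > 0" "\<And>z. z \<in> tube D' \<Longrightarrow> \<delta> \<le> norm (f z)"
      using AP_lower_bound[OF assms(2) D0(1) D0\<Omega> nz D'(2)] by blast
    have holo': "holo_on g (tube D')" by (rule holo_on_subset[OF g(1) tsub(1)])
    have fg: "f z = exp (g z + \<i> * cinner z c)" if "z \<in> tube D'" for z using g(2) tsub(1) that by blast
    have "connected D'" using D'(1) by (simp add: domain_def)
    then have "uap D' (\<lambda>y x. g (cpt x y))"
      by (rule uap_logarithm[OF _ holo_on_continuous[OF holo'] M AP_imp_uap[OF assms(2) rc] \<delta>(1) \<delta>(2) fg])
    then have "AP D' g" by (rule uap_imp_AP[OF holo'])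
    with bdd fg show ?thesis by blast
  qed

  moreover have "c \<in> Gf \<Omega> f"
  proof -
    \<comment> \<open>One height suffices, because \<open>spec\<close> asks for a nonzero
      coefficient at some height only.\<close>
    obtain y0 where y0: "y0 \<in> D0" using D0(3) by blast
    define u where "u x = f (cpt x y0)" for x
    \<comment> \<open>Absorbs the real factor of \<open>exp (\<i> * cinner z c)\<close> at height
      \<open>y0\<close>, leaving the pure character \<open>chr c\<close>.\<close>
    define h where "h x = g (cpt x y0) - of_real (y0 \<bullet> c)" for x
    have apu: "ap u" unfolding u_def using uap_slice[OF AP_imp_uap[OF assms(2) single(2)[OF y0]], of y0] by simp
    have contu: "continuous_on UNIV u" unfolding u_def by (rule slice_cont(1)[OF y0])
    obtain \<delta> where \<delta>: "\<delta> > 0" "\<And>z. z \<in> tube {y0} \<Longrightarrow> \<delta> \<le> norm (f z)"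
      using AP_lower_bound[OF assms(2) D0(1) D0\<Omega> nz single(1)[OF y0]] by blast
    have conth: "continuous_on UNIV h" unfolding h_def by (intro continuous_intros slice_cont(2)[OF y0])
    have meanh: "is_mean h (m - of_real (y0 \<bullet> c))"
      unfolding h_def[abs_def] by (intro is_mean_diff g(3)[OF y0] is_mean_const)
    have uh: "u x = exp (h x) * chr c x" for x
    proof -
      have "u x = exp (g (cpt x y0)) * (chr c x * of_real (exp (- (y0 \<bullet> c))))"
        unfolding u_def using g(2)[of "cpt x y0"] y0 by (simp add: exp_add exp_cinner_cpt)
      then show ?thesis by (simp add: h_def exp_diff exp_minus exp_of_real field_simps)
    qed
    have \<delta>u: "\<delta> \<le> norm (u x)" for x unfolding u_def by (rule \<delta>(2)) simp
    from mean_motion_near[OF conth meanh uh \<delta>(1) \<delta>u] obtain \<epsilon> where \<epsilon>: "\<epsilon> > 0"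
      "\<And>t. (\<And>x. norm (u (x + t) - u x) < \<epsilon>) \<Longrightarrow> cos (c \<bullet> t) \<ge> 1/2" by blast
    have "c \<in> zspan {l. fcoef u l \<noteq> 0}" by (rule frequency_in_zspan[OF apu contu \<epsilon>])
    moreover have "{l. fcoef u l \<noteq> 0} \<subseteq> spec \<Omega> f"
    proof
      fix l assume "l \<in> {l. fcoef u l \<noteq> 0}"
      then have l: "fcoef u l \<noteq> 0" by simp
      \<comment> \<open>The integrand of \<open>spec\<close> at height \<open>y0\<close>, where the
        exponential carries the real factor \<open>exp (y0 \<bullet> l)\<close>.\<close>
      define v where "v x = of_real (exp (y0 \<bullet> l)) * (u x * chr (- l) x)" for x
      obtain B where B: "\<And>x. norm (u x) \<le> B" using ap_bounded[OF apu] by blast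
      have "continuous_on UNIV v" unfolding v_def by (intro continuous_intros contu continuous_on_chr)
      moreover have "norm (v x) \<le> exp (y0 \<bullet> l) * B" for x
        unfolding v_def norm_mult norm_of_real using B by simp
      moreover have "is_mean v (of_real (exp (y0 \<bullet> l)) * fcoef u l)"
        unfolding v_def[abs_def] by (intro is_mean_cmult fcoef apu)
      ultimately have lim: "((\<lambda>s. integral (cube s) v / of_real ((2 * s) ^ CARD('n))) \<longlongrightarrow> of_real (exp (y0 \<bullet> l)) * fcoef u l) at_top"
        by (rule cube_average_tendsto_mean)
      have "exp (- \<i> * cinner (cpt x y0) l) * f (cpt x y0) = v x" for x
      proof -
        have "exp (- \<i> * cinner (cpt x y0) l) = chr (- l) x * of_real (exp (y0 \<bullet> l))"
          using exp_cinner_cpt[of x y0 "- l"] by (simp add: cinner_def sum_negf)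
        then show ?thesis by (simp add: v_def u_def mult_ac)
      qed
      then have v: "(\<lambda>x. exp (- \<i> * cinner (cpt x y0) l) * f (cpt x y0)) = v" by (rule ext)
      have "complex_of_real (exp (y0 \<bullet> l)) * fcoef u l \<noteq> 0" using l by simp
      moreover have "y0 \<in> \<Omega>" using y0 D0\<Omega> by blast
      ultimately show "l \<in> spec \<Omega> f"
        unfolding spec_def using lim[folded v] by (intro CollectI bexI exI conjI)
    qed
    ultimately show ?thesis unfolding zspan_def Gf_def by blast
  qed

  moreover have "(jessen f has_derivative (\<lambda>v. - (c \<bullet> v))) (at y)" if y: "y \<in> D0" for y
  proof -
    \<comment> \<open>At each height the integrand of \<open>jessen\<close> is exactly
      \<open>Re (h x)\<close> for a bounded \<open>h\<close> with a mean, so the limit is the real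
      part of that mean; since \<open>m\<close> is the same at all heights, only the subtracted
      \<open>y \<bullet> c\<close> varies.\<close>
    have jes: "jessen f y = Re m - c \<bullet> y" if y: "y \<in> D0" for y
    proof -
      define h where "h x = g (cpt x y) - of_real (y \<bullet> c)" for x
      have conth: "continuous_on UNIV h" unfolding h_def by (intro continuous_intros slice_cont(2)[OF y])
      have "bounded (g ` tube {y})" using y by (intro g(4)) auto
      then obtain M where M: "\<And>z. z \<in> tube {y} \<Longrightarrow> norm (g z) \<le> M" unfolding bounded_iff by blast
      have "norm (h x) \<le> M + \<bar>y \<bullet> c\<bar>" for x
        using M[of "cpt x y"] norm_triangle_ineq4[of "g (cpt x y)" "of_real (y \<bullet> c)"] by (simp add: h_def)
      moreover have "is_mean h (m - of_real (y \<bullet> c))"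
        unfolding h_def[abs_def] by (intro is_mean_diff g(3)[OF y] is_mean_const)
      ultimately have "((\<lambda>s. integral (cube s) h / of_real ((2 * s) ^ CARD('n))) \<longlongrightarrow> m - of_real (y \<bullet> c)) at_top"
        by (rule cube_average_tendsto_mean[OF conth])
      from tendsto_Re[OF this]
      have lim: "((\<lambda>s. Re (integral (cube s) h) / (2 * s) ^ CARD('n)) \<longlongrightarrow> Re m - c \<bullet> y) at_top"
        by (simp add: inner_commute flip: of_real_power del: of_real_power)
      have "Re (integral (cube s) h) = integral (cube s) (\<lambda>x. ln (norm (f (cpt x y))))" for s
      proof -
        have "h integrable_on cbox (vec (- s)) (vec s)"
          by (rule integrable_continuous[OF continuous_on_subset[OF conth]]) simp
        from integral_linear[OF this bounded_linear_Re]
        have "Re (integral (cube s) h) = integral (cube s) (\<lambda>x. Re (h x))" by (simp add: integral_cube o_def)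
        moreover have "ln (norm (f (cpt x y))) = Re (h x)" for x
          using g(2)[of "cpt x y"] y by (simp add: h_def cinner_cpt)
        ultimately show ?thesis by simp
      qed
      then show ?thesis unfolding jessen_def using tendsto_Lim[OF _ lim] by simp
    qed
    have "((\<lambda>y. Re m - c \<bullet> y) has_derivative (\<lambda>v. - (c \<bullet> v))) (at y)"
      by (auto intro!: derivative_eq_intros)
    then show ?thesis
      by (rule has_derivative_transform_within_open[OF _ D0(1) y]) (simp add: jes)
  qed
  ultimately show ?thesis by blast
qed

end
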